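(* Let $q$ be a prime power with $q\equiv3\bmod 4$. Let $\Gamma=\operatorname{PGL}_2(\mathbb F_q[Y])$ and let $I_\alpha$ be the conjugacy class in $\Gamma$ of the involution $\alpha=\begin{bmatrix}0&1\\-1&0\end{bmatrix}$. The number $\mathcal N_{I_\alpha,I_\alpha}(n)$ of conjugacy classes (counted with multiplicities) of $\{I_\alpha,I_\alpha\}$-reversible loxodromic elements of $\Gamma$ whose translation length on the Bruhat-Tits tree of $(\operatorname{PGL}_2,\mathbb F_q((Y^{-1})))$ is at most $n$ satisfies, as $n\in4\mathbb Z$ tends to $+\infty$, $$\mathcal N_{I_\alpha,I_\alpha}(n)\sim\frac{q^{\frac n2-1}}{q^2-1}.$$
   Context: $\begin{bmatrix}a&b\\c&d\end{bmatrix}$ denotes the image in $\operatorname{PGL}_2$ of the corresponding matrix in $\operatorname{GL}_2$. The group $\Gamma$ acts on the Bruhat-Tits tree $\mathbb X$ of $(\operatorname{PGL}_2,\mathbb F_q((Y^{-1})))$, a $(q+1)$-regular tree with edges of length $1$. Write $I=I_\alpha$. For $\beta\in I$, $F_\beta$ is the fixed point set of $\beta$ in the geometric realisation of $\mathbb X$, $\Gamma_{F_\beta}$ its global stabiliser in $\Gamma$, and $Z_\Gamma(\beta)$ the centraliser of $\beta$ in $\Gamma$. A loxodromic element $\gamma\in\Gamma$ (one with positive translation length $\lambda(\gamma)=\inf_x d(x,\gamma x)$ on $\mathbb X$) is $\{I,I\}$-reversible if there is $\alpha'\in I$ with $\gamma\alpha'=\alpha'\gamma^{-1}\in I$. Let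 $\widetilde{II}$ be the set of $(\alpha',\beta')\in I\times I$ such that the closures of $F_{\alpha'}$ and $F_{\beta'}$ in $\mathbb X\cup\partial_\infty\mathbb X$ are disjoint, with the diagonal conjugation action of $\Gamma$. The multiplicity of the conjugacy class $[\gamma]$ of an $\{I,I\}$-reversible loxodromic element is $$\operatorname{mult}([\gamma])=\sum_{\Gamma(\alpha',\beta')\in\Gamma\backslash\widetilde{II}:\ \beta'\alpha'\in[\gamma]}\frac1{\operatorname{Card}(\Gamma_{F_{\alpha'}}\cap\Gamma_{F_{\beta'}})\;|\Gamma_{F_{\alpha'}}/Z_\Gamma(\alpha')|\;|\Gamma_{F_{\beta'}}/Z_\Gamma(\beta')|},$$ and $\mathcal N_{I,I}(n)=\sum_{[\gamma]:\lambda(\gamma)\le n}\operatorname{mult}([\gamma])$, the sum being over conjugacy classes of $\{I,I\}$-reversible loxodromic elements of $\Gamma$. *)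

theory Defs
  imports
    "HOL-Analysis.Analysis"
    "HOL-Algebra.Group_Action"
    "HOL-Algebra.Left_Coset"
    "HOL-Computational_Algebra.Formal_Laurent_Series"
    "HOL-Computational_Algebra.Polynomial"
    "HOL-Library.Landau_Symbols"
begin

section \<open>Geometric realisation and compactification of a tree\<close>

text \<open>
  A simplicial tree is given by its set \<open>E\<close> of edges, a symmetric irreflexive relation; each edge
  occurs with both orientations, and every vertex is assumed to lie on an edge.  A point of the
  geometric realisation is its function of barycentric coordinates on the vertices.
\<close>

definition segment :: "'v \<Rightarrow> 'v \<Rightarrow> ('v \<Rightarrow> real) set" where
  "segment u v =
     {x. (\<forall>w. 0 \<le> x w) \<and> (\<forall>w. w \<noteq> u \<and> w \<noteq> v \<longrightarrow> x w = 0) \<and> x u + x v = 1}"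

definition realisation :: "('v \<times> 'v) set \<Rightarrow> ('v \<Rightarrow> real) set" where
  "realisation E = (\<Union>(u, v)\<in>E. segment u v)"

text \<open>
  The length metric for which every edge is isometric to \<open>[0,1]\<close>: the infimum of the lengths of the
  chains \<open>c 0, \<dots>, c n\<close> whose consecutive points \<open>c i\<close> and \<open>c (i + 1)\<close> lie on a common closed edge
  \<open>segment (u i) (v i)\<close>.
\<close>

definition tree_dist :: "('v \<times> 'v) set \<Rightarrow> ('v \<Rightarrow> real) \<Rightarrow> ('v \<Rightarrow> real) \<Rightarrow> real" where
  "tree_dist E x y =
     Inf {\<Sum>i<n. \<bar>c i (u i) - c (Suc i) (u i)\<bar> | (n :: nat) c u v.
            c 0 = x \<and> c n = y \<and>
            (\<forall>i<n. (u i, v i) \<in> E \<and>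
                   c i \<in> segment (u i) (v i) \<and> c (Suc i) \<in> segment (u i) (v i))}"

text \<open>The affine extension to the geometric realisation of a map \<open>\<phi>\<close> on the vertices.\<close>

definition affine_ext :: "('v \<Rightarrow> 'w) \<Rightarrow> ('v \<Rightarrow> real) \<Rightarrow> 'w \<Rightarrow> real" where
  "affine_ext \<phi> x = (\<lambda>w. \<Sum>v | x v \<noteq> 0 \<and> \<phi> v = w. x v)"

text \<open>Only the values of a ray on \<open>[0,\<infinity>)\<close> are meaningful.\<close>

definition geodesic_ray :: "('v \<times> 'v) set \<Rightarrow> (real \<Rightarrow> 'v \<Rightarrow> real) \<Rightarrow> bool" where
  "geodesic_ray E c \<longleftrightarrow>
     (\<forall>t\<ge>0. c t \<in> realisation E) \<and>
     (\<forall>s\<ge>0. \<forall>t\<ge>0. tree_dist E (c s) (c t) = \<bar>s - t\<bar>)"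

definition asymptotic ::
    "('v \<times> 'v) set \<Rightarrow> (real \<Rightarrow> 'v \<Rightarrow> real) \<Rightarrow> (real \<Rightarrow> 'v \<Rightarrow> real) \<Rightarrow> bool" where
  "asymptotic E c c' \<longleftrightarrow> (\<exists>B. \<forall>t\<ge>0. tree_dist E (c t) (c' t) \<le> B)"

definition boundary :: "('v \<times> 'v) set \<Rightarrow> (real \<Rightarrow> 'v \<Rightarrow> real) set set" where
  "boundary E = {{c'. geodesic_ray E c' \<and> asymptotic E c c'} | c. geodesic_ray E c}"

text \<open>
  The cone topology on the disjoint union of the tree and its boundary.  For a ray \<open>c\<close>, the basic
  set \<open>cone_nbhd E c r \<epsilon>\<close> consists of the points at distance more than \<open>r\<close> from \<open>c 0\<close>, or at
  infinity, whose projection to the closed ball of centre \<open>c 0\<close> and radius \<open>r\<close> is at distance less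
  than \<open>\<epsilon>\<close> from \<open>c r\<close>.  The projection \<open>p\<close> of a point \<open>x\<close> is the point at distance \<open>r\<close> from \<open>c 0\<close>
  on the geodesic from \<open>c 0\<close> to \<open>x\<close>.
\<close>

definition cone_nbhd ::
    "('v \<times> 'v) set \<Rightarrow> (real \<Rightarrow> 'v \<Rightarrow> real) \<Rightarrow> real \<Rightarrow> real \<Rightarrow>
     (('v \<Rightarrow> real) + (real \<Rightarrow> 'v \<Rightarrow> real) set) set" where
  "cone_nbhd E c r \<epsilon> =
     Inl ` {x \<in> realisation E. r < tree_dist E (c 0) x \<and>
              (\<exists>p\<in>realisation E. tree_dist E (c 0) p = r \<and>
                 tree_dist E p x = tree_dist E (c 0) x - r \<and> tree_dist E p (c r) < \<epsilon>)} \<union>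
     Inr ` {\<xi> \<in> boundary E. \<exists>c'\<in>\<xi>. c' 0 = c 0 \<and> tree_dist E (c' r) (c r) < \<epsilon>}"

definition cone_topology ::
    "('v \<times> 'v) set \<Rightarrow> (('v \<Rightarrow> real) + (real \<Rightarrow> 'v \<Rightarrow> real) set) topology" where
  "cone_topology E = topology_generated_by
     ({Inl ` {y \<in> realisation E. tree_dist E x y < r} | x r. x \<in> realisation E \<and> 0 < r} \<union>
      {cone_nbhd E c r \<epsilon> | c r \<epsilon>. geodesic_ray E c \<and> 0 < r \<and> 0 < \<epsilon>})"


section \<open>The groups \<open>GL\<^sub>2\<close> and \<open>PGL\<^sub>2\<close>\<close>

definition GL2 :: "('r::comm_ring_1 ^ 2 ^ 2) monoid" where
  "GL2 = \<lparr>carrier = {A. invertible A}, mult = (**), one = mat 1\<rparr>"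

definition scalars2 :: "('r::comm_ring_1 ^ 2 ^ 2) set" where
  "scalars2 = {mat c | c. c dvd 1}"

text \<open>
  The quotient of \<open>GL\<^sub>2(R)\<close> by its scalar matrices is the group of \<open>R\<close>-points of the algebraic group
  \<open>PGL\<^sub>2\<close> when \<open>R\<close> is a principal ideal domain, as \<open>R = F\<^sub>q[Y]\<close> is.
\<close>

definition PGL2 :: "('r::comm_ring_1 ^ 2 ^ 2) set monoid" where
  "PGL2 = GL2 Mod scalars2"

definition pgl2_of :: "'r \<Rightarrow> 'r \<Rightarrow> 'r \<Rightarrow> 'r \<Rightarrow> ('r::comm_ring_1 ^ 2 ^ 2) set" where
  "pgl2_of a b c d = scalars2 #>\<^bsub>GL2\<^esub> vector [vector [a, b], vector [c, d]]"


section \<open>The Bruhat-Tits tree\<close>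

text \<open>
  The local field \<open>F\<^sub>q((Y\<^sup>-\<^sup>1))\<close> is the field of formal Laurent series in \<open>T = Y\<^sup>-\<^sup>1\<close>; its valuation ring
  \<open>F\<^sub>q[[T]]\<close> is \<open>range fps_to_fls\<close>, and \<open>fls_X = T\<close> is a uniformiser.  The field type \<open>'a\<close> is \<open>F\<^sub>q\<close>.
\<close>

definition poly_emb :: "'a::field poly \<Rightarrow> 'a fls" where
  "poly_emb p = poly (map_poly fls_const p) fls_X_inv"

definition lattices :: "('a::field fls ^ 2) set set" where
  "lattices =
     {(\<lambda>x. B *v x) ` {x. \<forall>i. x $ i \<in> range fps_to_fls} | B :: 'a fls ^ 2 ^ 2. invertible B}"

definition homothety_class :: "('a::field fls ^ 2) set \<Rightarrow> ('a fls ^ 2) set set" where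
  "homothety_class L = {(\<lambda>x. c *s x) ` L | c. c \<noteq> 0}"

definition bt_edges :: "(('a::field fls ^ 2) set set \<times> ('a fls ^ 2) set set) set" where
  "bt_edges =
     {(homothety_class L, homothety_class L') | L L'.
        L \<in> lattices \<and> L' \<in> lattices \<and> (\<lambda>x. fls_X *s x) ` L \<subset> L' \<and> L' \<subset> L}"

abbreviation bt_tree :: "(('a::field fls ^ 2) set set \<Rightarrow> real) set" where
  "bt_tree \<equiv> realisation bt_edges"

text \<open>
  An element of \<open>PGL\<^sub>2(F\<^sub>q[Y])\<close> is a coset \<open>g\<close> of matrices; all of them induce the same map on the
  homothety classes of lattices.
\<close>

definition vertex_act ::
    "('a::field poly ^ 2 ^ 2) set \<Rightarrow> ('a fls ^ 2) set set \<Rightarrow> ('a fls ^ 2) set set" where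
  "vertex_act g v = {(\<lambda>x. map_matrix poly_emb A *v x) ` L | A L. A \<in> g \<and> L \<in> v}"

definition tree_act ::
    "('a::field poly ^ 2 ^ 2) set \<Rightarrow> (('a fls ^ 2) set set \<Rightarrow> real) \<Rightarrow>
     (('a fls ^ 2) set set \<Rightarrow> real)" where
  "tree_act g = affine_ext (vertex_act g)"


section \<open>Counting reversible loxodromic elements\<close>

definition conj_act :: "('g, 'b) monoid_scheme \<Rightarrow> 'g \<Rightarrow> 'g \<Rightarrow> 'g" where
  "conj_act G g h = g \<otimes>\<^bsub>G\<^esub> h \<otimes>\<^bsub>G\<^esub> inv\<^bsub>G\<^esub> g"

definition conj_class :: "('g, 'b) monoid_scheme \<Rightarrow> 'g \<Rightarrow> 'g set" where
  "conj_class G h = orbit G (conj_act G) h"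

definition centraliser :: "('g, 'b) monoid_scheme \<Rightarrow> 'g \<Rightarrow> 'g set" where
  "centraliser G h = {g \<in> carrier G. g \<otimes>\<^bsub>G\<^esub> h = h \<otimes>\<^bsub>G\<^esub> g}"

definition translation_length :: "('a::field poly ^ 2 ^ 2) set \<Rightarrow> real" where
  "translation_length g = (INF x\<in>bt_tree. tree_dist bt_edges x (tree_act g x))"

definition loxodromic :: "('a::field poly ^ 2 ^ 2) set \<Rightarrow> bool" where
  "loxodromic g \<longleftrightarrow> g \<in> carrier PGL2 \<and> 0 < translation_length g"

definition reversible ::
    "('a::field poly ^ 2 ^ 2) set set \<Rightarrow> ('a poly ^ 2 ^ 2) set \<Rightarrow> bool" where
  "reversible I g \<longleftrightarrow>
     (\<exists>a\<in>I. g \<otimes>\<^bsub>PGL2\<^esub> a = a \<otimes>\<^bsub>PGL2\<^esub> inv\<^bsub>PGL2\<^esub> g \<and> g \<otimes>\<^bsub>PGL2\<^esub> a \<in> I)"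

definition fixed_set ::
    "('a::field poly ^ 2 ^ 2) set \<Rightarrow> (('a fls ^ 2) set set \<Rightarrow> real) set" where
  "fixed_set b = invariants bt_tree tree_act b"

definition fixed_set_stabiliser ::
    "('a::field poly ^ 2 ^ 2) set \<Rightarrow> ('a poly ^ 2 ^ 2) set set" where
  "fixed_set_stabiliser b = stabilizer PGL2 (\<lambda>g. (`) (tree_act g)) (fixed_set b)"

definition stabiliser_index :: "('a::field poly ^ 2 ^ 2) set \<Rightarrow> nat" where
  "stabiliser_index b =
     card (lcosets\<^bsub>PGL2\<lparr>carrier := fixed_set_stabiliser b\<rparr>\<^esub> (centraliser PGL2 b))"

definition disjoint_pairs ::
    "('a::field poly ^ 2 ^ 2) set set \<Rightarrow>
     (('a poly ^ 2 ^ 2) set \<times> ('a poly ^ 2 ^ 2) set) set" where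
  "disjoint_pairs I =
     {(a, b). a \<in> I \<and> b \<in> I \<and>
        (cone_topology bt_edges closure_of (Inl ` fixed_set a)) \<inter>
        (cone_topology bt_edges closure_of (Inl ` fixed_set b)) = {}}"

definition pair_weight ::
    "('a::field poly ^ 2 ^ 2) set \<times> ('a poly ^ 2 ^ 2) set \<Rightarrow> real" where
  "pair_weight = (\<lambda>(a, b).
     1 / (real (card (fixed_set_stabiliser a \<inter> fixed_set_stabiliser b)) *
          real (stabiliser_index a) * real (stabiliser_index b)))"

text \<open>
  \<open>pair_weight\<close> is constant on the orbits of the diagonal conjugation action, so that \<open>the_elem\<close>
  picks its value on the orbit \<open>P\<close>.
\<close>

definition multiplicity_class ::
    "('a::field poly ^ 2 ^ 2) set set \<Rightarrow> ('a poly ^ 2 ^ 2) set set \<Rightarrow> real" where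
  "multiplicity_class I C =
     (\<Sum>\<^sub>\<infinity>P \<in> {P \<in> orbits PGL2 (disjoint_pairs I)
                     (\<lambda>g. map_prod (conj_act PGL2 g) (conj_act PGL2 g)).
                \<exists>(a, b)\<in>P. b \<otimes>\<^bsub>PGL2\<^esub> a \<in> C}.
        the_elem (pair_weight ` P))"

definition reversible_count :: "('a::field poly ^ 2 ^ 2) set set \<Rightarrow> real \<Rightarrow> real" where
  "reversible_count I n =
     (\<Sum>\<^sub>\<infinity>C \<in> {conj_class PGL2 g | g.
                 loxodromic g \<and> reversible I g \<and> translation_length g \<le> n}.
        multiplicity_class I C)"

end

theory Submission
  imports Defs
begin

text \<open>
  Let \<open>F\<close> be the field of Laurent series in \<open>T = Y\<^sup>-\<^sup>1\<close>, let \<open>x\<^sub>0\<close> be the vertex of the standard lattice, and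
  let \<open>\<Gamma>\<^sub>0\<close> be the group of constant matrices modulo scalars, which is the stabiliser of \<open>x\<^sub>0\<close> in \<open>\<Gamma>\<close>.

  \<^bold>\<open>Geometry.\<close>  Since \<open>q \<equiv> 3\<close> modulo \<open>4\<close>, \<open>-1\<close> is not a square in the finite field, so the leading terms of
  a sum of two squares in \<open>F\<close> never cancel.  Therefore \<open>\<alpha>\<close> moves a vertex at distance \<open>d\<close> from \<open>x\<^sub>0\<close> by at
  least \<open>2 d\<close> (\<open>lat_dist_J\<close>), and \<open>g \<alpha> g\<^sup>-\<^sup>1\<close> fixes the vertex \<open>g x\<^sub>0\<close> and nothing else.  The closures of
  the fixed sets of two such involutions are disjoint exactly when their vertices differ.  The distance
  from \<open>x\<^sub>0\<close> to \<open>k x\<^sub>0\<close> is twice the largest degree \<open>pdeg k\<close> of an entry of \<open>k\<close>.  The trace of \<open>(k \<alpha> k\<^sup>-\<^sup>1) \<alpha>\<close> is, up to a unit, the sum of the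
  squares of the entries of \<open>k\<close>; again nothing cancels in top degree, so its degree is \<open>2 pdeg k\<close>, and the
  translation length is \<open>4 pdeg k\<close> (\<open>translation_length_product\<close>).  For the lower bound the trace is
  compared with the displacement of vertices under high powers; the upper bound is attained at \<open>x\<^sub>0\<close>.

  \<^bold>\<open>Orbits.\<close>  Hence the quantity at \<open>n = 4 K\<close> is a sum over the orbits of the pairs \<open>(\<alpha>, k \<alpha> k\<^sup>-\<^sup>1)\<close>, that is, over
  the double cosets \<open>Z k Z\<close> of the centraliser \<open>Z \<subseteq> \<Gamma>\<^sub>0\<close> of \<open>\<alpha>\<close>, with \<open>1 \<le> pdeg k \<le> K\<close>.  The weight of such an
  orbit is \<open>|Z|\<^sup>2 / |\<Gamma>\<^sub>0|\<^sup>2\<close> divided by the order of \<open>\<Gamma>\<^sub>0 \<inter> k \<Gamma>\<^sub>0 k\<^sup>-\<^sup>1\<close>.  If this intersection is trivial, the double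
  coset has \<open>|Z|\<^sup>2\<close> elements, and each of them carries the share \<open>1 / |\<Gamma>\<^sub>0|\<^sup>2\<close>.  The other \<open>k\<close> satisfy \<open>g k = k g'\<close>
  for constant \<open>g\<close>, \<open>g'\<close> with \<open>g\<close> not scalar.  Such a \<open>k\<close> is determined by a single row, whose entries solve a
  quadratic equation, so only \<open>O(q\<^sup>n)\<close> of them have degree \<open>n\<close> (\<open>card_nongeneric_le\<close>).

  \<^bold>\<open>Counting.\<close>  By the Euclidean algorithm on rows there are exactly \<open>(q\<^sup>2 - 1) q\<^sup>2\<^sup>n |\<Gamma>\<^sub>0|\<close> elements \<open>k\<close> of degree
  \<open>n + 1\<close> (\<open>card_deg_sphere_Suc\<close>), and \<open>|\<Gamma>\<^sub>0| = q (q\<^sup>2 - 1)\<close>.  Summing the geometric series, the quantity at \<open>4 K\<close> is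
  \<open>(q\<^sup>2\<^sup>K - 1) / (q (q\<^sup>2 - 1)) + O(q\<^sup>K)\<close>.
\<close>

\<comment> \<open>The coefficients of power series compete with the components of vectors for the symbol \<open>$\<close>.\<close>
no_notation fps_nth (infixl \<open>$\<close> 75)
notation fls_nth (infixl \<open>$$\<close> 75)

section \<open>Matrices of size two\<close>

definition mat2 :: "'r \<Rightarrow> 'r \<Rightarrow> 'r \<Rightarrow> 'r \<Rightarrow> ('r::comm_ring_1) ^ 2 ^ 2" where
  "mat2 a b c d = vector [vector [a, b], vector [c, d]]"

lemma mat2_nth [simp]:
  "mat2 a b c d $ 1 $ 1 = a" "mat2 a b c d $ 1 $ 2 = b"
  "mat2 a b c d $ 2 $ 1 = c" "mat2 a b c d $ 2 $ 2 = d"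
  by (simp_all add: mat2_def vector_2)

lemma mat2_eq_iff:
  "A = B \<longleftrightarrow> A $ 1 $ 1 = B $ 1 $ 1 \<and> A $ 1 $ 2 = B $ 1 $ 2 \<and> A $ 2 $ 1 = B $ 2 $ 1 \<and> A $ 2 $ 2 = B $ 2 $ 2"
  for A B :: "'r ^ 2 ^ 2"
  by (auto simp: vec_eq_iff forall_2)

lemma mat2_cases: obtains a b c d where "A = mat2 a b c d"
proof -
  have "A = mat2 (A$1$1) (A$1$2) (A$2$1) (A$2$2)" by (simp add: mat2_eq_iff)
  then show ?thesis by (rule that)
qed

lemma mult_nth:
  "(A ** B) $ i $ j = A $ i $ 1 * B $ 1 $ j + A $ i $ 2 * B $ 2 $ j"
  for A B :: "('r::comm_ring_1) ^ 2 ^ 2"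
  by (simp add: matrix_matrix_mult_def sum_2)

lemma mat2_mult [simp]:
  "mat2 a b c d ** mat2 a' b' c' d' =
     mat2 (a * a' + b * c') (a * b' + b * d') (c * a' + d * c') (c * b' + d * d')"
  by (simp add: mat2_eq_iff mult_nth)

lemma mat_eq_mat2: "mat c = mat2 c 0 0 c"
  by (simp add: mat2_eq_iff mat_def)

lemma det_mat2 [simp]: "det (mat2 a b c d) = a * d - b * c"
  by (simp add: det_2)

lemma trace_mat2 [simp]: "trace (mat2 a b c d) = a + d"
  by (simp add: trace_def sum_2)

lemma mat2_inject [simp]:
  "mat2 a b c d = mat2 a' b' c' d' \<longleftrightarrow> a = a' \<and> b = b' \<and> c = c' \<and> d = d'"
  by (simp add: mat2_eq_iff)

lemma scalar_mult_nth [simp]: "(mat c ** A) $ i $ j = c * A $ i $ j"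
  for A :: "('r::comm_ring_1) ^ 2 ^ 2"
  using exhaust_2[of i] by (auto simp: mat_eq_mat2 mult_nth)

lemma scalar_commute: "A ** mat c = mat c ** A"
  for A :: "('r::comm_ring_1) ^ 2 ^ 2"
  by (cases A rule: mat2_cases) (simp add: mat_eq_mat2 algebra_simps)

lemma scalar_mult_assoc: "A ** (mat c ** B) = mat c ** (A ** B)"
  for A B :: "('r::comm_ring_1) ^ 2 ^ 2"
  by (simp add: matrix_mul_assoc scalar_commute)

lemma scalar_mult_scalar [simp]: "mat c ** mat d = (mat (c * d) :: ('r::comm_ring_1) ^ 2 ^ 2)"
  by (simp add: mat_eq_mat2)

lemma det_scalar_mult [simp]: "det (mat c ** A) = c ^ 2 * det A"
  for A :: "('r::comm_ring_1) ^ 2 ^ 2"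
  by (cases A rule: mat2_cases) (simp add: mat_eq_mat2 algebra_simps power2_eq_square)

definition adj2 :: "('r::comm_ring_1) ^ 2 ^ 2 \<Rightarrow> 'r ^ 2 ^ 2" where
  "adj2 A = mat2 (A $ 2 $ 2) (- A $ 1 $ 2) (- A $ 2 $ 1) (A $ 1 $ 1)"

lemma adj2_mat2 [simp]: "adj2 (mat2 a b c d) = mat2 d (-b) (-c) a"
  by (simp add: adj2_def)

lemma adj2_right: "A ** adj2 A = mat (det A)"
  and adj2_left: "adj2 A ** A = mat (det A)"
  and det_adj2 [simp]: "det (adj2 A) = det A"
  and adj2_adj2 [simp]: "adj2 (adj2 A) = A"
  by (cases A rule: mat2_cases; simp add: mat_eq_mat2 algebra_simps)+

lemma adj2_mult: "adj2 (A ** B) = adj2 B ** adj2 A"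
  by (cases A rule: mat2_cases, cases B rule: mat2_cases) (simp add: algebra_simps)

lemma adj2_mult_cancel: "adj2 A ** (A ** B) = mat (det A) ** B"
  by (simp add: matrix_mul_assoc adj2_left)

lemma adj2_mult_cancel': "A ** (adj2 A ** B) = mat (det A) ** B"
  by (simp add: matrix_mul_assoc adj2_right)

lemma invertible_iff_det: "invertible A \<longleftrightarrow> det A dvd 1" for A :: "('r::comm_ring_1) ^ 2 ^ 2"
proof
  assume "invertible A"
  then obtain B where "A ** B = mat 1" by (auto simp: invertible_def)
  then have "det A * det B = 1" by (metis det_I det_mul)
  then show "det A dvd 1" by (metis dvdI)
next
  assume "det A dvd 1"
  then obtain c where c: "det A * c = 1" by (metis dvdE)
  have "A ** (mat c ** adj2 A) = mat 1" "(mat c ** adj2 A) ** A = mat 1"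
    by (simp_all add: scalar_mult_assoc adj2_right matrix_mul_assoc[symmetric] adj2_left c mult.commute[of c])
  then show "invertible A" unfolding invertible_def by blast
qed

section \<open>Valuations of matrices over the local field\<close>

text \<open>
  Valuation at least \<open>n\<close>, stated through coefficients: the zero series then needs no separate
  treatment, although its \<open>fls_subdegree\<close> is \<open>0\<close>.
\<close>

definition val_ge :: "int \<Rightarrow> 'a::zero fls \<Rightarrow> bool" where
  "val_ge n x \<longleftrightarrow> (\<forall>k<n. x $$ k = 0)"

lemma val_ge_iff: "val_ge n x \<longleftrightarrow> x = 0 \<or> n \<le> fls_subdegree x"
  unfolding val_ge_def using fls_subdegree_geI[of x n] by (cases "x = 0") auto

lemma val_ge_0 [simp]: "val_ge n 0" by (simp add: val_ge_def)

lemma val_ge_add: "val_ge n x \<Longrightarrow> val_ge n y \<Longrightarrow> val_ge n (x + y)"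
  for x :: "'a::ab_group_add fls" by (simp add: val_ge_def)

lemma val_ge_uminus [simp]: "val_ge n (- x) \<longleftrightarrow> val_ge n x"
  for x :: "'a::ab_group_add fls" by (simp add: val_ge_def)

lemma val_ge_diff: "val_ge n x \<Longrightarrow> val_ge n y \<Longrightarrow> val_ge n (x - y)"
  for x :: "'a::ab_group_add fls" by (simp add: val_ge_def)

lemma val_ge_mult: "val_ge m x \<Longrightarrow> val_ge n y \<Longrightarrow> val_ge (m + n) (x * y)"
  for x y :: "'a::field fls"
  by (cases "x = 0 \<or> y = 0") (auto simp: val_ge_iff)

text \<open>
  The coefficient at the sum of two lower bounds of the valuations sees the leading terms only.  It
  turns questions of cancellation in the local field into questions over the residue field.
\<close>

lemma val_ge_mult_nth: "val_ge m x \<Longrightarrow> val_ge n y \<Longrightarrow> (x * y) $$ (m + n) = x $$ m * y $$ n"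
  for x y :: "'a::field fls"
proof -
  assume "val_ge m x" "val_ge n y"
  show ?thesis
  proof (cases "x = 0 \<or> y = 0")
    case False
    then have m: "m \<le> fls_subdegree x" and n: "n \<le> fls_subdegree y"
      using \<open>val_ge m x\<close> \<open>val_ge n y\<close> by (auto simp: val_ge_iff)
    show ?thesis
    proof (cases "m = fls_subdegree x \<and> n = fls_subdegree y")
      case False
      then have "m + n < fls_subdegree x + fls_subdegree y" using m n by linarith
      moreover have "x $$ m = 0 \<or> y $$ n = 0" using m n False by force
      ultimately show ?thesis by (auto simp: fls_times_nth_eq0)
    qed simp
  qed auto
qed

lemma integral_iff: "x \<in> range fps_to_fls \<longleftrightarrow> val_ge 0 x"
proof
  assume "val_ge 0 x"
  then have "fls_subdegree x \<ge> 0" by (auto simp: val_ge_iff)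
  then show "x \<in> range fps_to_fls" by (metis fls_regpart_to_fls_trivial rangeI)
next
  assume "x \<in> range fps_to_fls"
  then show "val_ge 0 x" by (auto simp: val_ge_def)
qed

definition entries_ge :: "int \<Rightarrow> 'a::zero fls ^ 2 ^ 2 \<Rightarrow> bool" where
  "entries_ge n A \<longleftrightarrow> (\<forall>i j. val_ge n (A $ i $ j))"

lemma entries_ge_mat2 [simp]: "entries_ge n (mat2 a b c d) \<longleftrightarrow> val_ge n a \<and> val_ge n b \<and> val_ge n c \<and> val_ge n d"
  by (auto simp: entries_ge_def forall_2)

lemma entries_ge_mult: "entries_ge m A \<Longrightarrow> entries_ge n B \<Longrightarrow> entries_ge (m + n) (A ** B)"
  for A B :: "'a::field fls ^ 2 ^ 2"
  by (simp add: entries_ge_def mult_nth val_ge_add val_ge_mult)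

definition min_val :: "'a::zero fls ^ 2 ^ 2 \<Rightarrow> int" where
  "min_val A = Min {fls_subdegree (A $ i $ j) | i j. A $ i $ j \<noteq> 0}"

lemma entries_ge_iff: assumes "A \<noteq> 0" shows "entries_ge n A \<longleftrightarrow> n \<le> min_val A"
proof -
  let ?S = "{fls_subdegree (A $ i $ j) | i j. A $ i $ j \<noteq> 0}"
  have "?S = (\<lambda>(i, j). fls_subdegree (A $ i $ j)) ` {(i, j). A $ i $ j \<noteq> 0}" by auto
  then have fin: "finite ?S" by simp
  have "?S \<noteq> {}" using assms by (auto simp: vec_eq_iff)
  then show ?thesis unfolding min_val_def using fin by (auto simp: entries_ge_def val_ge_iff)
qed

lemma det_nonzero: "det A \<noteq> 0 \<Longrightarrow> A \<noteq> 0" for A :: "('r::comm_ring_1) ^ 2 ^ 2"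
  by (auto simp: det_2)

lemma min_val_geI: "det A \<noteq> 0 \<Longrightarrow> entries_ge n A \<Longrightarrow> n \<le> min_val A"
  for A :: "'a::field fls ^ 2 ^ 2"
  by (simp add: entries_ge_iff det_nonzero)

lemma entries_ge_min_val: "det A \<noteq> 0 \<Longrightarrow> entries_ge (min_val A) A"
  for A :: "'a::field fls ^ 2 ^ 2"
  by (simp add: entries_ge_iff det_nonzero)

lemma min_val_eqI:
  fixes A :: "'a::field fls ^ 2 ^ 2" and B :: "'b::field fls ^ 2 ^ 2"
  assumes "det A \<noteq> 0" "det B \<noteq> 0" "\<And>n. entries_ge n A \<longleftrightarrow> entries_ge (n + k) B"
  shows "min_val B = min_val A + k"
proof (rule antisym)
  show "min_val A + k \<le> min_val B" using assms by (metis min_val_geI entries_ge_min_val)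
  have "entries_ge (min_val B - k) A" using assms entries_ge_min_val[of B] by simp
  then show "min_val B \<le> min_val A + k" using assms min_val_geI by fastforce
qed

lemma min_val_adj2 [simp]: "det A \<noteq> 0 \<Longrightarrow> min_val (adj2 A) = min_val A"
  for A :: "'a::field fls ^ 2 ^ 2"
  using min_val_eqI[of A "adj2 A" 0]
  by (cases A rule: mat2_cases) (auto simp: mult.commute conj_ac)

lemma min_val_mult_ge: "det A \<noteq> 0 \<Longrightarrow> det B \<noteq> 0 \<Longrightarrow> min_val A + min_val B \<le> min_val (A ** B)"
  for A B :: "'a::field fls ^ 2 ^ 2"
  by (intro min_val_geI entries_ge_mult entries_ge_min_val) (auto simp: det_mul)

lemma min_val_scalar_mult:
  fixes A :: "'a::field fls ^ 2 ^ 2"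
  assumes "c \<noteq> 0" "det A \<noteq> 0" shows "min_val (mat c ** A) = min_val A + fls_subdegree c"
proof (rule min_val_eqI)
  have "val_ge n x \<longleftrightarrow> val_ge (n + fls_subdegree c) (c * x)" for n x
    using assms by (cases "x = 0") (auto simp: val_ge_iff)
  then show "entries_ge n A \<longleftrightarrow> entries_ge (n + fls_subdegree c) (mat c ** A)" for n
    by (simp add: entries_ge_def)
qed (use assms in auto)

abbreviation vdet :: "'a::field fls ^ 2 ^ 2 \<Rightarrow> int" where
  "vdet A \<equiv> fls_subdegree (det A)"

lemma vdet_mult: "det A \<noteq> 0 \<Longrightarrow> det B \<noteq> 0 \<Longrightarrow> vdet (A ** B) = vdet A + vdet B"
  for A B :: "'a::field fls ^ 2 ^ 2"
  by (simp add: det_mul)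

lemma min_val_det:
  fixes A :: "'a::field fls ^ 2 ^ 2"
  assumes "det A \<noteq> 0" shows "2 * min_val A \<le> vdet A"
proof -
  have "val_ge (min_val A + min_val A) (det A)" unfolding det_2
    using entries_ge_min_val[OF assms] by (intro val_ge_diff val_ge_mult) (auto simp: entries_ge_def)
  then show ?thesis using assms by (auto simp: val_ge_iff)
qed

lemma min_val_trace:
  fixes A :: "'a::field fls ^ 2 ^ 2"
  assumes "det A \<noteq> 0" "trace A \<noteq> 0" shows "min_val A \<le> fls_subdegree (trace A)"
proof -
  have "val_ge (min_val A) (trace A)" unfolding trace_def sum_2
    using entries_ge_min_val[OF assms(1)] by (intro val_ge_add) (auto simp: entries_ge_def)
  then show ?thesis using assms by (auto simp: val_ge_iff)
qed

text \<open>
  The companion of \<open>min_val_mult_ge\<close>, obtained from it by multiplying \<open>A ** X\<close> by the adjugate of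
  \<open>X\<close>.  Together they control how much right multiplication by an integral \<open>X\<close> can change a lattice.
\<close>

lemma min_val_mult_le:
  fixes A X :: "'a::field fls ^ 2 ^ 2"
  assumes "det A \<noteq> 0" "det X \<noteq> 0"
  shows "min_val (A ** X) + min_val X \<le> min_val A + vdet X"
proof -
  have "min_val (A ** X) + min_val (adj2 X) \<le> min_val ((A ** X) ** adj2 X)"
    using assms by (intro min_val_mult_ge) (auto simp: det_mul)
  also have "(A ** X) ** adj2 X = mat (det X) ** A"
    by (simp add: matrix_mul_assoc[symmetric] adj2_right scalar_commute)
  finally show ?thesis using assms by (simp add: min_val_scalar_mult)
qed

text \<open>
  If the elementary divisors of \<open>A\<close> are \<open>T\<^sup>a\<close> and \<open>T\<^sup>b\<close> with \<open>a \<le> b\<close>, then \<open>min_val A = a\<close> and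
  \<open>vdet A = a + b\<close>.  So this is \<open>b - a\<close>, the distance by which \<open>A\<close> moves the vertex of the standard
  lattice.
\<close>

definition disp :: "'a::field fls ^ 2 ^ 2 \<Rightarrow> int" where
  "disp A = vdet A - 2 * min_val A"

lemma disp_nonneg: "det A \<noteq> 0 \<Longrightarrow> 0 \<le> disp A"
  by (simp add: disp_def min_val_det)

lemma disp_scalar_mult [simp]: "c \<noteq> 0 \<Longrightarrow> det A \<noteq> 0 \<Longrightarrow> disp (mat c ** A) = disp A"
  by (simp add: disp_def min_val_scalar_mult power2_eq_square)

lemma disp_mult_unit:
  assumes "det A \<noteq> 0" "det X \<noteq> 0" "entries_ge 0 X" "vdet X = 0"
  shows "disp (A ** X) = disp A"
proof -
  have "0 \<le> min_val X" using assms by (simp add: min_val_geI)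
  then show ?thesis
    using min_val_mult_le[OF assms(1,2)] min_val_mult_ge[OF assms(1,2)] assms by (simp add: disp_def vdet_mult)
qed

lemma disp_mult_edge:
  assumes "det A \<noteq> 0" "det X \<noteq> 0" "entries_ge 0 X" "vdet X = 1"
  shows "\<bar>disp (A ** X) - disp A\<bar> \<le> 1"
proof -
  have "0 \<le> min_val X" using assms by (simp add: min_val_geI)
  then show ?thesis
    using min_val_mult_le[OF assms(1,2)] min_val_mult_ge[OF assms(1,2)] assms by (simp add: disp_def vdet_mult)
qed

text \<open>
  The distance between the vertices of the lattices spanned by the columns of \<open>A\<close> and of \<open>B\<close>.  As
  \<open>disp\<close> ignores scalars, the adjugate may stand for the inverse.
\<close>

definition lat_dist :: "'a::field fls ^ 2 ^ 2 \<Rightarrow> 'a fls ^ 2 ^ 2 \<Rightarrow> int" where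
  "lat_dist A B = disp (adj2 A ** B)"

lemma lat_dist_nonneg: "det A \<noteq> 0 \<Longrightarrow> det B \<noteq> 0 \<Longrightarrow> 0 \<le> lat_dist A B"
  by (simp add: lat_dist_def disp_nonneg det_mul)

lemma lat_dist_mult_left:
  assumes "det M \<noteq> 0" "det A \<noteq> 0" "det B \<noteq> 0"
  shows "lat_dist (M ** A) (M ** B) = lat_dist A B"
proof -
  have "adj2 (M ** A) ** (M ** B) = adj2 A ** (mat (det M) ** B)"
    by (simp add: adj2_mult matrix_mul_assoc[symmetric] adj2_mult_cancel)
  then show ?thesis using assms by (simp add: lat_dist_def scalar_mult_assoc det_mul)
qed

lemma lat_dist_scalar_left: "c \<noteq> 0 \<Longrightarrow> det A \<noteq> 0 \<Longrightarrow> det B \<noteq> 0 \<Longrightarrow> lat_dist (mat c ** A) B = lat_dist A B"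
  and lat_dist_scalar_right: "c \<noteq> 0 \<Longrightarrow> det A \<noteq> 0 \<Longrightarrow> det B \<noteq> 0 \<Longrightarrow> lat_dist A (mat c ** B) = lat_dist A B"
proof -
  assume *: "c \<noteq> 0" "det A \<noteq> 0" "det B \<noteq> 0"
  have "adj2 (mat c ** A) = mat c ** adj2 A"
    by (cases A rule: mat2_cases) (simp add: mat_eq_mat2)
  then show "lat_dist (mat c ** A) B = lat_dist A B" using *
    by (simp add: lat_dist_def matrix_mul_assoc[symmetric] det_mul)
  show "lat_dist A (mat c ** B) = lat_dist A B" using * by (simp add: lat_dist_def scalar_mult_assoc det_mul)
qed

lemma lat_dist_self [simp]: "det A \<noteq> 0 \<Longrightarrow> lat_dist A A = 0"
proof -
  assume *: "det A \<noteq> 0"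
  have 1: "min_val (mat 1 :: 'a fls ^ 2 ^ 2) = 0"
  proof (rule antisym)
    show "0 \<le> min_val (mat 1 :: 'a fls ^ 2 ^ 2)" by (rule min_val_geI) (auto simp: mat_eq_mat2 val_ge_iff)
    show "min_val (mat 1 :: 'a fls ^ 2 ^ 2) \<le> 0" using min_val_det[of "mat 1 :: 'a fls ^ 2 ^ 2"] by simp
  qed
  have "lat_dist A A = disp (mat (det A) ** mat 1)" by (simp add: lat_dist_def adj2_left)
  also have "\<dots> = disp (mat 1 :: 'a fls ^ 2 ^ 2)" by (rule disp_scalar_mult) (use * in auto)
  finally show ?thesis by (simp add: disp_def 1)
qed

text \<open>
  Conjugation preserves the trace, and the trace of an integral matrix is integral.  Hence a trace of
  small valuation forces \<open>M\<close> to move every vertex far; this gives the lower bound for translation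
  lengths.
\<close>

lemma lat_dist_trace:
  assumes "det M \<noteq> 0" "det B \<noteq> 0" "trace M \<noteq> 0"
  shows "vdet M - 2 * fls_subdegree (trace M) \<le> lat_dist B (M ** B)"
proof -
  have "trace (adj2 B ** (M ** B)) = trace ((M ** B) ** adj2 B)"
    by (rule trace_mul_sym)
  also have "(M ** B) ** adj2 B = mat (det B) ** M"
    by (simp add: matrix_mul_assoc[symmetric] adj2_right scalar_commute)
  also have "trace (mat (det B) ** M) = det B * trace M"
    by (cases M rule: mat2_cases) (simp add: mat_eq_mat2 algebra_simps)
  finally have tr: "trace (adj2 B ** (M ** B)) = det B * trace M" .
  have "min_val (adj2 B ** (M ** B)) \<le> fls_subdegree (trace (adj2 B ** (M ** B)))"
    using assms by (intro min_val_trace) (auto simp: det_mul tr)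
  then show ?thesis using assms by (simp add: lat_dist_def disp_def det_mul tr)
qed

section \<open>Lattices and the vertices of the tree\<close>

definition tpow :: "int \<Rightarrow> 'a::field fls" where
  "tpow k = fls_X_intpow k"

lemma tpow_nonzero [simp]: "tpow k \<noteq> 0"
  and subdegree_tpow [simp]: "fls_subdegree (tpow k :: 'a::field fls) = k"
  unfolding tpow_def by (rule fls_X_intpow_nonzero, rule fls_subdegree_fls_X_intpow)

lemma tpow_mult_X [simp]: "tpow (- 1) * fls_X = (1 :: 'a::field fls)"
  using fls_X_intpow_times_fls_X_intpow[of "-1" 1, where 'a='a]
  by (simp add: tpow_def fls_X_conv_shift_1)

lemma det_scalar [simp]: "det (mat c :: ('r::comm_ring_1) ^ 2 ^ 2) = c\<^sup>2"
  by (simp add: mat_eq_mat2 power2_eq_square)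

lemma adj2_mat [simp]: "adj2 (mat c) = mat c"
  by (simp add: mat_eq_mat2)

lemma subdegree_square [simp]: "fls_subdegree (x\<^sup>2) = 2 * fls_subdegree (x :: 'a::field fls)"
  by (cases "x = 0") (simp_all add: power2_eq_square)

definition lat :: "'a::field fls ^ 2 ^ 2 \<Rightarrow> ('a fls ^ 2) set" where
  "lat B = (\<lambda>x. B *v x) ` {x. \<forall>i. x $ i \<in> range fps_to_fls}"

lemma lattices_eq: "lattices = {lat B | B. det B \<noteq> 0}"
  by (simp add: lattices_def lat_def invertible_det_nz)

lemma matvec_nth: "(A *v x) $ i = A $ i $ 1 * x $ 1 + A $ i $ 2 * x $ 2"
  for A :: "('r::comm_ring_1) ^ 2 ^ 2"
  by (simp add: matrix_vector_mult_def sum_2)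

lemma scalar_matvec: "c *s (A *v x) = (mat c ** A) *v x"
  for A :: "('r::comm_ring_1) ^ 2 ^ 2"
  by (simp add: vec_eq_iff matvec_nth algebra_simps)

lemma lat_mult: "(\<lambda>x. M *v x) ` lat B = lat (M ** B)"
  by (simp add: lat_def image_image matrix_vector_mul_assoc)

lemma scale_lat: "(\<lambda>x. c *s x) ` lat B = lat (mat c ** B)"
  by (simp add: lat_def image_image scalar_matvec)

text \<open>
  The entries of \<open>X\<close> are the coordinates of the columns of \<open>B\<close> in the basis given by \<open>A\<close>.
\<close>

lemma lat_subset_iff:
  assumes "det A \<noteq> 0"
  shows "lat B \<subseteq> lat A \<longleftrightarrow> (\<exists>X. entries_ge 0 X \<and> B = A ** X)"
proof
  assume *: "lat B \<subseteq> lat A"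
  have "\<exists>x. (\<forall>i. val_ge 0 (x $ i)) \<and> B *v axis j 1 = A *v x" for j
  proof -
    have "val_ge 0 ((axis j 1 :: 'a fls ^ 2) $ i)" for i
      by (auto simp: axis_def val_ge_iff)
    then have "B *v axis j 1 \<in> lat B" by (auto simp: lat_def integral_iff)
    then have "B *v axis j 1 \<in> lat A" using * by blast
    then show ?thesis by (auto simp: lat_def integral_iff)
  qed
  then obtain x where x: "\<And>j i. val_ge 0 (x j $ i)" "\<And>j. B *v axis j 1 = A *v x j" by metis
  define X where "X = (\<chi> i j. x j $ i)"
  have "B $ i $ j = (B *v axis j 1) $ i" for i j
    using exhaust_2[of j] by (auto simp: matvec_nth axis_def)
  then have "B = A ** X"
    by (simp add: vec_eq_iff mult_nth X_def x(2) matvec_nth)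
  moreover have "entries_ge 0 X" by (simp add: entries_ge_def X_def x)
  ultimately show "\<exists>X. entries_ge 0 X \<and> B = A ** X" by blast
next
  assume "\<exists>X. entries_ge 0 X \<and> B = A ** X"
  then obtain X where X: "entries_ge 0 X" "B = A ** X" by blast
  have mult: "val_ge 0 (x * y)" if "val_ge 0 x" "val_ge 0 y" for x y :: "'a fls"
    using val_ge_mult[OF that] by simp
  have "val_ge 0 ((X *v x) $ i)" if "\<forall>i. val_ge 0 (x $ i)" for x i
    using X that by (auto simp: matvec_nth entries_ge_def intro!: val_ge_add mult)
  then show "lat B \<subseteq> lat A"
    by (auto simp: lat_def integral_iff X matrix_vector_mul_assoc[symmetric])
qed

lemma vdet_integral: "entries_ge 0 X \<Longrightarrow> det X \<noteq> 0 \<Longrightarrow> 0 \<le> vdet X"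
  using min_val_det[of X] min_val_geI[of X 0] by linarith

lemma inverse_integral:
  assumes "det X \<noteq> 0" "entries_ge 0 X"
  shows "entries_ge (- vdet X) (mat (1 / det X) ** adj2 X)" "X ** (mat (1 / det X) ** adj2 X) = mat 1"
proof -
  have "val_ge (- vdet X + 0) ((1 / det X) * x)" if "val_ge 0 x" for x
    using that assms by (intro val_ge_mult) (auto simp: val_ge_iff fls_divide_subdegree)
  then show "entries_ge (- vdet X) (mat (1 / det X) ** adj2 X)"
    using assms by (cases X rule: mat2_cases) (auto simp: entries_ge_def forall_2)
  show "X ** (mat (1 / det X) ** adj2 X) = mat 1"
    using assms by (simp add: scalar_mult_assoc adj2_right)
qed

lemma lat_eq_iff:
  assumes "det A \<noteq> 0" "det B \<noteq> 0"
  shows "lat B = lat A \<longleftrightarrow> (\<exists>X. entries_ge 0 X \<and> vdet X = 0 \<and> B = A ** X)"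
proof
  assume eq: "lat B = lat A"
  then obtain X Y where X: "entries_ge 0 X" "B = A ** X" and Y: "entries_ge 0 Y" "A = B ** Y"
    using lat_subset_iff[OF assms(1)] lat_subset_iff[OF assms(2)] by (metis order_refl)
  have nz: "det X \<noteq> 0" "det Y \<noteq> 0"
    using arg_cong[OF X(2), of det] arg_cong[OF Y(2), of det] assms by (auto simp: det_mul)
  have "det A = det A * det X * det Y" using X Y by (metis det_mul)
  then have "det X * det Y = 1" using assms by simp
  then have "vdet X + vdet Y = 0" using nz by (metis fls_subdegree_mult fls_one_subdegree)
  then have "vdet X = 0" using vdet_integral[OF X(1) nz(1)] vdet_integral[OF Y(1) nz(2)] by linarith
  with X show "\<exists>X. entries_ge 0 X \<and> vdet X = 0 \<and> B = A ** X" by blast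
next
  assume "\<exists>X. entries_ge 0 X \<and> vdet X = 0 \<and> B = A ** X"
  then obtain X where X: "entries_ge 0 X" "vdet X = 0" "B = A ** X" by blast
  have nz: "det X \<noteq> 0" using X assms by (auto simp: det_mul)
  have "A = B ** (mat (1 / det X) ** adj2 X)"
    using inverse_integral[OF nz X(1)] X by (simp add: matrix_mul_assoc[symmetric])
  moreover have "entries_ge 0 (mat (1 / det X) ** adj2 X)" using inverse_integral[OF nz X(1)] X by simp
  ultimately show "lat B = lat A"
    using X lat_subset_iff[OF assms(1)] lat_subset_iff[OF assms(2)] by (metis subset_antisym)
qed

definition vertex :: "'a::field fls ^ 2 ^ 2 \<Rightarrow> ('a fls ^ 2) set set" where
  "vertex A = homothety_class (lat A)"

lemma vertex_eq: "vertex A = {lat (mat c ** A) | c. c \<noteq> 0}"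
  by (simp add: vertex_def homothety_class_def scale_lat)

lemma vertex_scalar_mult: "c \<noteq> 0 \<Longrightarrow> vertex (mat c ** A) = vertex A"
proof -
  assume c: "c \<noteq> 0"
  have "lat (mat d ** A) = lat (mat (d / c) ** (mat c ** A)) \<and> d / c \<noteq> 0" if "d \<noteq> 0" for d
    using c that by (simp add: matrix_mul_assoc)
  then have "vertex A \<subseteq> vertex (mat c ** A)" unfolding vertex_eq by fast
  moreover have "lat (mat d ** (mat c ** A)) = lat (mat (d * c) ** A) \<and> d * c \<noteq> 0" if "d \<noteq> 0" for d
    using c that by (simp add: matrix_mul_assoc)
  then have "vertex (mat c ** A) \<subseteq> vertex A" unfolding vertex_eq by fast
  ultimately show ?thesis by blast
qed

lemma lat_in_vertex: "lat A \<in> vertex A"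
  unfolding vertex_eq by (rule CollectI, rule exI[of _ 1]) simp

lemma lat_dist_cong_vertex:
  assumes A: "det A \<noteq> 0" and B: "det B \<noteq> 0" and C: "det C \<noteq> 0" and eq: "vertex A = vertex B"
  shows "lat_dist C B = lat_dist C A"
proof -
  have "lat B \<in> vertex A" using eq lat_in_vertex by blast
  then obtain c where c: "c \<noteq> 0" "lat B = lat (mat c ** A)" unfolding vertex_eq by blast
  then obtain X where X: "entries_ge 0 X" "vdet X = 0" "B = (mat c ** A) ** X"
    using lat_eq_iff[of "mat c ** A" B] A B by auto
  have nz: "det X \<noteq> 0" using X B by (auto simp: det_mul)
  have "lat_dist C B = lat_dist C (mat c ** (A ** X))" using X by (simp add: matrix_mul_assoc)
  also have "\<dots> = lat_dist C (A ** X)" using A C c nz by (intro lat_dist_scalar_right) (auto simp: det_mul)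
  also have "\<dots> = disp ((adj2 C ** A) ** X)" by (simp add: lat_dist_def matrix_mul_assoc)
  also have "\<dots> = lat_dist C A" using A C nz X unfolding lat_dist_def by (intro disp_mult_unit) (auto simp: det_mul)
  finally show ?thesis .
qed

text \<open>
  If the distance is \<open>0\<close>, the two elementary divisors of the change of basis agree, so that after
  scaling by their common value it becomes invertible over the valuation ring.
\<close>

lemma vertex_eq_iff:
  assumes "det A \<noteq> 0" "det B \<noteq> 0"
  shows "vertex A = vertex B \<longleftrightarrow> lat_dist A B = 0"
proof
  assume "vertex A = vertex B"
  then have "lat_dist A B = lat_dist A A" by (rule lat_dist_cong_vertex[OF assms assms(1)])
  then show "lat_dist A B = 0" using assms by simp
next
  assume lat_dist: "lat_dist A B = 0"
  define Z where "Z = adj2 A ** B"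
  define X where "X = mat (tpow (- min_val Z)) ** Z"
  have Z: "det Z \<noteq> 0" using assms by (simp add: Z_def det_mul)
  have "min_val X = 0" using Z by (simp add: X_def min_val_scalar_mult)
  moreover have nzX: "det X \<noteq> 0" using Z by (simp add: X_def)
  ultimately have X: "entries_ge 0 X" using entries_ge_min_val[of X] by simp
  have "vdet X = 0" using Z lat_dist by (simp add: X_def lat_dist_def disp_def Z_def[symmetric])
  define c where "c = tpow (- min_val Z) * det A"
  have c: "c \<noteq> 0" using assms by (simp add: c_def)
  have "A ** X = mat c ** B"
    by (simp add: X_def Z_def scalar_mult_assoc[of A] adj2_mult_cancel' c_def)
      (simp add: matrix_mul_assoc)
  moreover have "lat (A ** X) = lat A"
    using lat_eq_iff[of A "A ** X"] assms nzX X \<open>vdet X = 0\<close> by (auto simp: det_mul)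
  ultimately have "vertex A = vertex (mat c ** B)" by (simp add: vertex_def)
  then show "vertex A = vertex B" using c by (simp add: vertex_scalar_mult)
qed

lemma vertex_mult_unit:
  assumes "det A \<noteq> 0" "entries_ge 0 X" "det X \<noteq> 0" "vdet X = 0"
  shows "vertex (A ** X) = vertex A"
  using lat_eq_iff[of A "A ** X"] assms by (auto simp: det_mul vertex_def)

section \<open>Edges\<close>

text \<open>
  The inclusions \<open>T L \<subset> L' \<subset> L\<close> bound the valuation of the determinant of the change of basis
  between \<open>0\<close> and \<open>2\<close>, and strictness excludes both ends.
\<close>

lemma bt_edges_iff:
  "(u, v) \<in> bt_edges \<longleftrightarrow>
     (\<exists>A X. det A \<noteq> 0 \<and> det X \<noteq> 0 \<and> entries_ge 0 X \<and> vdet X = 1 \<and> u = vertex A \<and> v = vertex (A ** X))"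
proof
  assume "(u, v) \<in> bt_edges"
  then obtain A B where A: "det A \<noteq> 0" and B: "det B \<noteq> 0"
    and sub: "lat (mat fls_X ** A) \<subset> lat B" "lat B \<subset> lat A" and uv: "u = vertex A" "v = vertex B"
    unfolding bt_edges_def lattices_eq by (clarsimp simp: scale_lat vertex_def) blast
  obtain X where X: "entries_ge 0 X" "B = A ** X" using iffD1[OF lat_subset_iff[OF A] psubset_imp_subset[OF sub(2)]] by blast
  obtain Y where Y: "entries_ge 0 Y" "mat fls_X ** A = B ** Y" using iffD1[OF lat_subset_iff[OF B] psubset_imp_subset[OF sub(1)]] by blast
  have nzX: "det X \<noteq> 0" using X B by (auto simp: det_mul)
  have TA: "det (mat fls_X ** A) \<noteq> 0" using A by simp
  have nzY: "det Y \<noteq> 0" using Y TA by (auto simp: det_mul)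
  have "vdet X \<noteq> 0" using lat_eq_iff[OF A B] X sub(2) by blast
  moreover have "vdet Y \<noteq> 0" using lat_eq_iff[OF B TA] Y sub(1) by blast
  moreover have "0 \<le> vdet X" "0 \<le> vdet Y" using X Y nzX nzY by (auto intro: vdet_integral)
  moreover have "vdet X + vdet Y = 2"
  proof -
    have "det A * (det X * det Y) = det A * (fls_X * fls_X)"
      using arg_cong[OF Y(2), of det] X(2) by (auto simp: det_mul power2_eq_square mult_ac)
    then have "det X * det Y = fls_X * fls_X" using A by simp
    then have "vdet X + vdet Y = fls_subdegree (fls_X * fls_X :: 'a fls)"
      using nzX nzY by (metis fls_subdegree_mult)
    then show ?thesis by simp
  qed
  ultimately have "vdet X = 1" by linarith
  with A X nzX uv show "\<exists>A X. det A \<noteq> 0 \<and> det X \<noteq> 0 \<and> entries_ge 0 X \<and> vdet X = 1 \<and> u = vertex A \<and> v = vertex (A ** X)"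
    by blast
next
  assume "\<exists>A X. det A \<noteq> 0 \<and> det X \<noteq> 0 \<and> entries_ge 0 X \<and> vdet X = 1 \<and> u = vertex A \<and> v = vertex (A ** X)"
  then obtain A X where A: "det A \<noteq> 0" and X: "det X \<noteq> 0" "entries_ge 0 X" "vdet X = 1"
    and uv: "u = vertex A" "v = vertex (A ** X)" by blast
  let ?B = "A ** X" and ?T = "mat fls_X ** A"
  have B: "det ?B \<noteq> 0" and T: "det ?T \<noteq> 0" using A X by (auto simp: det_mul)
  have v: "vdet ?B = vdet A + 1" "vdet ?T = vdet A + 2"
    using A X by (simp_all add: vdet_mult power2_eq_square)
  have vdet_eq: "vdet C = vdet D" if "lat C = lat D" "det C \<noteq> 0" "det D \<noteq> 0" for C D :: "'a fls ^ 2 ^ 2"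
    using that lat_eq_iff[of D C] by (auto simp: vdet_mult det_mul)
  have ne: "lat ?B \<noteq> lat A" using vdet_eq[OF _ B A] v by auto
  have ne': "lat ?T \<noteq> lat ?B" using vdet_eq[OF _ T B] v by auto
  define Y where "Y = mat fls_X ** (mat (1 / det X) ** adj2 X)"
  have TX: "val_ge 0 (fls_X * x)" if "val_ge (- 1) x" for x :: "'a fls"
  proof -
    have "val_ge (1 + - 1) (fls_X * x)" by (rule val_ge_mult[OF _ that]) (simp add: val_ge_iff)
    then show ?thesis by simp
  qed
  have "val_ge (- 1) ((mat (1 / det X) ** adj2 X) $ i $ j)" for i j
    using inverse_integral(1)[OF X(1,2)] unfolding entries_ge_def X(3) by blast
  then have "entries_ge 0 Y" unfolding entries_ge_def Y_def scalar_mult_nth[of fls_X] by (intro allI TX)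
  moreover have "?T = ?B ** Y"
  proof -
    have "?B ** Y = mat fls_X ** (?B ** (mat (1 / det X) ** adj2 X))"
      unfolding Y_def by (rule scalar_mult_assoc)
    also have "?B ** (mat (1 / det X) ** adj2 X) = A ** (X ** (mat (1 / det X) ** adj2 X))"
      by (rule matrix_mul_assoc[symmetric])
    also have "\<dots> = A" by (simp only: inverse_integral[OF X(1,2)] matrix_mul_rid)
    finally show ?thesis by simp
  qed
  ultimately have "lat ?T \<subseteq> lat ?B" using iffD2[OF lat_subset_iff[OF B]] by blast
  then have TB: "lat ?T \<subset> lat ?B" using ne' by (rule psubsetI)
  have "lat ?B \<subseteq> lat A" using iffD2[OF lat_subset_iff[OF A]] X by blast
  then have BA: "lat ?B \<subset> lat A" using ne by (rule psubsetI)
  have "lat A \<in> lattices" "lat ?B \<in> lattices" using A B unfolding lattices_eq by blast+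
  with TB BA show "(u, v) \<in> bt_edges"
    unfolding bt_edges_def uv vertex_def scale_lat[symmetric] by blast
qed

lemma bt_edgesE:
  assumes "(u, v) \<in> bt_edges"
  obtains A X where "det A \<noteq> 0" "det X \<noteq> 0" "entries_ge 0 X" "vdet X = 1" "u = vertex A" "v = vertex (A ** X)"
  using iffD1[OF bt_edges_iff assms] by (elim exE conjE) (rule that)

lemma lat_dist_edge:
  assumes "det A \<noteq> 0" "det X \<noteq> 0" "entries_ge 0 X" "vdet X = 1"
  shows "lat_dist A (A ** X) = 1"
proof -
  have m: "0 \<le> min_val X" using assms by (simp add: min_val_geI)
  have "lat_dist A (A ** X) = disp (mat (det A) ** X)"
    by (simp add: lat_dist_def adj2_mult_cancel)
  also have "\<dots> = disp X" using assms by simp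
  finally show ?thesis using min_val_det[of X] m assms by (simp add: disp_def)
qed

text \<open>
  A real function on vertices must not depend on the lattice chosen to represent a vertex;
  \<open>lat_dist_cong_vertex\<close> is what makes the choice harmless.
\<close>

definition vdist :: "'a::field fls ^ 2 ^ 2 \<Rightarrow> ('a fls ^ 2) set set \<Rightarrow> int" where
  "vdist C v = lat_dist C (SOME A. det A \<noteq> 0 \<and> v = vertex A)"

lemma vdist_vertex:
  assumes "det C \<noteq> 0" "det A \<noteq> 0"
  shows "vdist C (vertex A) = lat_dist C A"
proof -
  define B where "B = (SOME B. det B \<noteq> 0 \<and> vertex A = vertex B)"
  have B: "det B \<noteq> 0" "vertex A = vertex B"
    using someI[of "\<lambda>B. det B \<noteq> 0 \<and> vertex A = vertex B" A] assms by (auto simp: B_def)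
  show ?thesis unfolding vdist_def B_def[symmetric]
    by (rule lat_dist_cong_vertex[OF assms(2) B(1) assms(1) B(2)])
qed

text \<open>
  Distances in the realisation are bounded below by such functions, and above by explicit paths.
\<close>

lemma vdist_edge:
  assumes "det C \<noteq> 0" "(u, v) \<in> bt_edges"
  shows "\<bar>vdist C u - vdist C v\<bar> \<le> 1"
proof -
  obtain A X where A: "det A \<noteq> 0" and X: "det X \<noteq> 0" "entries_ge 0 X" "vdet X = 1"
    and uv: "u = vertex A" "v = vertex (A ** X)" using assms by (elim bt_edgesE)
  have "\<bar>disp ((adj2 C ** A) ** X) - disp (adj2 C ** A)\<bar> \<le> 1"
    using assms A X by (intro disp_mult_edge) (auto simp: det_mul)
  then show ?thesis using assms A X
    by (simp add: uv vdist_vertex det_mul lat_dist_def matrix_mul_assoc)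
qed

lemma edge_cases:
  assumes "(u, v) \<in> bt_edges"
  obtains A B where "det A \<noteq> 0" "det B \<noteq> 0" "u = vertex A" "v = vertex B" "lat_dist A B = 1" "u \<noteq> v"
proof -
  obtain A X where A: "det A \<noteq> 0" and X: "det X \<noteq> 0" "entries_ge 0 X" "vdet X = 1"
    and uv: "u = vertex A" "v = vertex (A ** X)" using assms by (elim bt_edgesE)
  moreover have "lat_dist A (A ** X) = 1" using A X by (rule lat_dist_edge)
  moreover have "det (A ** X) \<noteq> 0" using A X by (simp add: det_mul)
  ultimately show ?thesis using that[of A "A ** X"] vertex_eq_iff[of A "A ** X"] by auto
qed

section \<open>Paths\<close>

lemma edge_mult:
  assumes "det M \<noteq> 0" "det A \<noteq> 0" "det B \<noteq> 0" "(vertex A, vertex B) \<in> bt_edges"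
  shows "(vertex (M ** A), vertex (M ** B)) \<in> bt_edges"
proof -
  obtain A' X where A: "det A' \<noteq> 0" and X: "det X \<noteq> 0" "entries_ge 0 X" "vdet X = 1"
    and uv: "vertex A = vertex A'" "vertex B = vertex (A' ** X)" using assms by (elim bt_edgesE)
  have B: "det (A' ** X) \<noteq> 0" using A X by (simp add: det_mul)
  have vM: "vertex (M ** C) = vertex (M ** C')"
    if "vertex C = vertex C'" "det C \<noteq> 0" "det C' \<noteq> 0" for C C' :: "'a fls ^ 2 ^ 2"
  proof -
    have "det (M ** C) \<noteq> 0" "det (M ** C') \<noteq> 0" using that assms(1) by (simp_all add: det_mul)
    then show ?thesis using that assms(1)
      by (metis vertex_eq_iff lat_dist_mult_left)
  qed
  have "vertex (M ** A) = vertex (M ** A')" "vertex (M ** B) = vertex (M ** (A' ** X))"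
    by (rule vM[OF uv(1) assms(2) A], rule vM[OF uv(2) assms(3) B])
  then show ?thesis unfolding bt_edges_iff using assms A X
    by (intro exI[of _ "M ** A'"] exI[of _ X]) (auto simp: det_mul matrix_mul_assoc)
qed

text \<open>
  The columns of a matrix that is singular modulo \<open>T\<close> are linearly dependent over the residue field,
  and a column operation with constant coefficients makes the second one vanish modulo \<open>T\<close>.
\<close>

lemma column_divisible:
  fixes A :: "'a::field fls ^ 2 ^ 2"
  assumes "entries_ge 0 A" "det A $$ 0 = 0"
  obtains K where "entries_ge 0 K" "det K \<noteq> 0" "vdet K = 0" "\<And>i. val_ge 1 ((A ** K) $ i $ 2)"
proof -
  have vA: "val_ge 0 (A $ i $ j)" for i j using assms by (simp add: entries_ge_def)
  have vge1: "val_ge 1 x \<longleftrightarrow> val_ge 0 x \<and> x $$ 0 = 0" for x :: "'a fls"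
  proof -
    have "k < 1 \<longleftrightarrow> k < 0 \<or> k = 0" for k :: int by linarith
    then show ?thesis unfolding val_ge_def by blast
  qed
  have mult0: "val_ge 0 (x * y)" "(x * y) $$ 0 = x $$ 0 * y $$ 0" if "val_ge 0 x" "val_ge 0 y" for x y :: "'a fls"
    using val_ge_mult[OF that] val_ge_mult_nth[OF that] by auto
  let ?a = "\<lambda>i j. A $ i $ j $$ 0"
  have det: "?a 1 1 * ?a 2 2 = ?a 1 2 * ?a 2 1"
    using assms(2) by (simp add: det_2 mult0 vA)
  show ?thesis
  proof (cases "?a 1 1 = 0 \<and> ?a 2 1 = 0")
    case True
    define K :: "'a fls ^ 2 ^ 2" where "K = mat2 0 1 1 0"
    have "val_ge 1 ((A ** K) $ i $ 2)" for i
      using True exhaust_2[of i] vA by (auto simp: K_def mult_nth vge1)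
    then show ?thesis by (intro that[of K]) (auto simp: K_def val_ge_iff)
  next
    case False
    define l where "l = (if ?a 1 1 = 0 then ?a 2 2 / ?a 2 1 else ?a 1 2 / ?a 1 1)"
    define K :: "'a fls ^ 2 ^ 2" where "K = mat2 1 (- fls_const l) 0 1"
    have l: "?a i 2 = l * ?a i 1" for i
      using False det exhaust_2[of i] by (auto simp: l_def field_simps)
    have c: "val_ge 0 (fls_const l)" "fls_const l $$ 0 = l" by (auto simp: val_ge_def)
    have "val_ge 1 ((A ** K) $ i $ 2)" for i
      by (simp add: K_def mult_nth vge1 val_ge_diff vA mult0 c l mult.commute)
    then show ?thesis using c by (intro that[of K]) (auto simp: K_def val_ge_iff)
  qed
qed

text \<open>
  Induction on the distance.  Scale \<open>A\<close> so that \<open>min_val A = 0\<close>; then its determinant is divisible by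
  \<open>T\<close>.  Dividing a column by \<open>T\<close>, after a column operation, leads to a neighbouring vertex one step
  closer to the base vertex.
\<close>

lemma path_from_base:
  assumes "det A \<noteq> 0" "lat_dist (mat 1) A = int n"
  shows "(vertex (mat 1), vertex A) \<in> bt_edges ^^ n"
  using assms
proof (induction n arbitrary: A)
  case 0
  then show ?case using vertex_eq_iff[of "mat 1" A] by simp
next
  case (Suc n)
  define B where "B = mat (tpow (- min_val A)) ** A"
  have B: "det B \<noteq> 0" "vertex B = vertex A" "min_val B = 0"
    using Suc.prems by (simp_all add: B_def vertex_scalar_mult min_val_scalar_mult)
  have rd1: "lat_dist (mat 1) C = disp C" for C :: "'a fls ^ 2 ^ 2"
    by (simp add: lat_dist_def)
  have "disp B = int (Suc n)" using Suc.prems by (simp add: B_def rd1)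
  then have vB: "vdet B = int (Suc n)" using B by (simp add: disp_def)
  have "det B $$ 0 = 0" using vB by simp
  moreover have "entries_ge 0 B" using B entries_ge_min_val[of B] by simp
  ultimately obtain K where K: "entries_ge 0 K" "det K \<noteq> 0" "vdet K = 0" "\<And>i. val_ge 1 ((B ** K) $ i $ 2)"
    using column_divisible[of B] by blast
  let ?T = "mat2 1 0 0 fls_X :: 'a fls ^ 2 ^ 2"
  \<comment> \<open>Divide the second column by \<open>T\<close>.\<close>
  define C where "C = (B ** K) ** mat2 1 0 0 (tpow (- 1))"
  have BK: "B ** K = C ** ?T"
    by (simp add: C_def matrix_mul_assoc[symmetric] flip: mat_eq_mat2)
  have dC: "det C \<noteq> 0" using B K by (simp add: C_def det_mul)
  have "entries_ge 0 C" unfolding entries_ge_def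
  proof (intro allI)
    fix i j :: 2
    have "entries_ge (0 + 0) (B ** K)" using \<open>entries_ge 0 B\<close> K by (intro entries_ge_mult)
    moreover have "val_ge (1 + - 1) ((B ** K) $ i $ 2 * tpow (- 1))"
      using K by (intro val_ge_mult) (auto simp: val_ge_iff)
    ultimately show "val_ge 0 (C $ i $ j)"
      using exhaust_2[of j] by (auto simp: C_def mult_nth[of "B ** K"] entries_ge_def)
  qed
  then have m0: "0 \<le> min_val C" using dC by (simp add: min_val_geI)
  have "vdet (B ** K) = vdet C + vdet ?T" unfolding BK using dC by (intro vdet_mult) auto
  then have vC: "vdet C = int n" using vB B K by (simp add: vdet_mult)
  have "min_val C = 0"
  proof -
    have dT: "det ?T \<noteq> 0" by simp
    have "0 \<le> min_val ?T" by (rule min_val_geI) (auto simp: val_ge_iff)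
    then have "min_val C + 0 \<le> min_val (B ** K)" unfolding BK using min_val_mult_ge[OF dC dT] by linarith
    moreover have "min_val (B ** K) \<le> 0"
      using min_val_mult_le[of B K] B K min_val_geI[of K 0] by simp
    ultimately show ?thesis using m0 by simp
  qed
  then have "lat_dist (mat 1) C = int n" by (simp add: rd1 disp_def vC)
  then have "(vertex (mat 1), vertex C) \<in> bt_edges ^^ n" using dC by (rule Suc.IH[rotated])
  moreover have "(vertex C, vertex (C ** ?T)) \<in> bt_edges"
    unfolding bt_edges_iff using dC by (intro exI[of _ C] exI[of _ ?T]) (auto simp: val_ge_iff)
  moreover have "vertex (C ** ?T) = vertex A"
    using B K by (simp add: BK[symmetric] vertex_mult_unit)
  ultimately show ?case by auto
qed

lemma path_mult:
  assumes "det M \<noteq> 0" "det A \<noteq> 0" "det B \<noteq> 0" "(vertex A, vertex B) \<in> bt_edges ^^ n"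
  shows "(vertex (M ** A), vertex (M ** B)) \<in> bt_edges ^^ n"
  using assms(3,4)
proof (induction n arbitrary: B)
  case 0
  then show ?case using assms vertex_eq_iff[of A B] vertex_eq_iff[of "M ** A" "M ** B"]
    by (simp add: det_mul lat_dist_mult_left)
next
  case (Suc n)
  then obtain w where w: "(vertex A, w) \<in> bt_edges ^^ n" "(w, vertex B) \<in> bt_edges" by auto
  then obtain C where C: "det C \<noteq> 0" "w = vertex C" by (metis edge_cases)
  then show ?case using Suc w edge_mult[of M C B] assms by auto
qed

lemma path_exists:
  assumes "det A \<noteq> 0" "det B \<noteq> 0"
  shows "(vertex A, vertex B) \<in> bt_edges ^^ nat (lat_dist A B)"
proof -
  have nz: "det (adj2 A ** B) \<noteq> 0" using assms by (simp add: det_mul)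
  have "lat_dist (mat 1) (adj2 A ** B) = lat_dist (A ** mat 1) (A ** (adj2 A ** B))"
    using assms nz by (intro lat_dist_mult_left[symmetric]) auto
  also have "\<dots> = lat_dist A B" using assms by (simp add: adj2_mult_cancel' lat_dist_scalar_right)
  finally have "lat_dist (mat 1) (adj2 A ** B) = int (nat (lat_dist A B))"
    using lat_dist_nonneg[OF assms] by simp
  then have "(vertex (mat 1), vertex (adj2 A ** B)) \<in> bt_edges ^^ nat (lat_dist A B)"
    using nz by (intro path_from_base)
  then have "(vertex (A ** mat 1), vertex (A ** (adj2 A ** B))) \<in> bt_edges ^^ nat (lat_dist A B)"
    using assms nz by (intro path_mult) auto
  then show ?thesis using assms by (simp add: adj2_mult_cancel' vertex_scalar_mult)
qed

section \<open>The length metric of a connected graph\<close>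

text \<open>
  The lengths over which \<open>tree_dist\<close> takes the infimum.
\<close>

definition chain :: "('v \<times> 'v) set \<Rightarrow> ('v \<Rightarrow> real) \<Rightarrow> ('v \<Rightarrow> real) \<Rightarrow> real \<Rightarrow> bool" where
  "chain E x y s \<longleftrightarrow> (\<exists>(n :: nat) c u v. s = (\<Sum>i<n. \<bar>c i (u i) - c (Suc i) (u i)\<bar>) \<and> c 0 = x \<and> c n = y \<and>
            (\<forall>i<n. (u i, v i) \<in> E \<and> c i \<in> segment (u i) (v i) \<and> c (Suc i) \<in> segment (u i) (v i)))"

lemma tree_dist_chain: "tree_dist E x y = Inf {s. chain E x y s}"
  unfolding tree_dist_def chain_def by simp

lemma chain_nonneg: "chain E x y s \<Longrightarrow> 0 \<le> s"
  by (auto simp: chain_def intro!: sum_nonneg)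

lemma chain_refl: "chain E x x 0"
  unfolding chain_def by (intro exI[of _ "0 :: nat"] exI[of _ "\<lambda>_. x"]) auto

lemma chain_step:
  assumes "chain E x y s" "(u, v) \<in> E" "y \<in> segment u v" "z \<in> segment u v"
  shows "chain E x z (s + \<bar>y u - z u\<bar>)"
proof -
  obtain n :: nat and c us vs where s: "s = (\<Sum>i<n. \<bar>c i (us i) - c (Suc i) (us i)\<bar>)" "c 0 = x" "c n = y"
    and E: "\<forall>i<n. (us i, vs i) \<in> E \<and> c i \<in> segment (us i) (vs i) \<and> c (Suc i) \<in> segment (us i) (vs i)"
    using assms(1) unfolding chain_def by blast
  have "(\<Sum>i<Suc n. \<bar>(c(Suc n := z)) i ((us(n := u)) i) - (c(Suc n := z)) (Suc i) ((us(n := u)) i)\<bar>) =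
      (\<Sum>i<n. \<bar>c i (us i) - c (Suc i) (us i)\<bar>) + \<bar>c n u - z u\<bar>"
    by (auto intro!: sum.cong)
  then show ?thesis unfolding chain_def
    using s E assms
    by (intro exI[of _ "Suc n"] exI[of _ "c(Suc n := z)"] exI[of _ "us(n := u)"] exI[of _ "vs(n := v)"])
      (auto simp: less_Suc_eq)
qed

lemma tree_dist_le: "chain E x y s \<Longrightarrow> tree_dist E x y \<le> s"
  unfolding tree_dist_chain by (rule cInf_lower) (auto intro!: bdd_belowI[of _ 0] chain_nonneg)

definition point :: "'v \<Rightarrow> 'v \<Rightarrow> real" where
  "point v = (\<lambda>w. if w = v then 1 else 0)"

lemma point_segment: "u \<noteq> v \<Longrightarrow> point u \<in> segment u v" "u \<noteq> v \<Longrightarrow> point v \<in> segment u v"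
  by (auto simp: segment_def point_def) 

text \<open>
  The extension of a function on the vertices to the realisation that is affine on every edge.
\<close>

definition bary_ext :: "('v \<Rightarrow> real) \<Rightarrow> ('v \<Rightarrow> real) \<Rightarrow> real" where
  "bary_ext f x = (\<Sum>v | x v \<noteq> 0. x v * f v)"

lemma bary_ext_segment:
  assumes "x \<in> segment u v" "u \<noteq> v"
  shows "bary_ext f x = x u * f u + x v * f v"
proof -
  have "bary_ext f x = (\<Sum>w\<in>{u, v}. x w * f w)" unfolding bary_ext_def
    using assms by (intro sum.mono_neutral_left) (auto simp: segment_def)
  then show ?thesis using assms by simp
qed

lemma bary_ext_point [simp]: "bary_ext f (point v) = f v"
proof -
  have "{w. point v w \<noteq> 0} = {v}" by (auto simp: point_def)
  then show ?thesis by (simp add: bary_ext_def point_def)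
qed

lemma segment_affine_ext:
  assumes "x \<in> segment u v" "u \<noteq> v" "\<phi> u \<noteq> \<phi> v"
  shows "affine_ext \<phi> x \<in> segment (\<phi> u) (\<phi> v)"
    and "affine_ext \<phi> x (\<phi> u) = x u" "affine_ext \<phi> x (\<phi> v) = x v"
proof -
  have x: "0 \<le> x u" "0 \<le> x v" "x u + x v = 1" "\<And>w. x w \<noteq> 0 \<Longrightarrow> w = u \<or> w = v"
    using assms by (auto simp: segment_def)
  have "{w. x w \<noteq> 0 \<and> \<phi> w = \<phi> u} = {w. w = u \<and> x u \<noteq> 0}"
  proof (rule Collect_cong)
    show "x w \<noteq> 0 \<and> \<phi> w = \<phi> u \<longleftrightarrow> w = u \<and> x u \<noteq> 0" for w using x(4)[of w] assms(3) by metis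
  qed
  moreover have "{w. x w \<noteq> 0 \<and> \<phi> w = \<phi> v} = {w. w = v \<and> x v \<noteq> 0}"
  proof (rule Collect_cong)
    show "x w \<noteq> 0 \<and> \<phi> w = \<phi> v \<longleftrightarrow> w = v \<and> x v \<noteq> 0" for w using x(4)[of w] assms(3) by metis
  qed
  ultimately show 1: "affine_ext \<phi> x (\<phi> u) = x u" "affine_ext \<phi> x (\<phi> v) = x v"
    by (simp_all add: affine_ext_def Collect_conv_if)
  have zero: "affine_ext \<phi> x w = 0" if "w \<noteq> \<phi> u" "w \<noteq> \<phi> v" for w
  proof -
    have "{a. x a \<noteq> 0 \<and> \<phi> a = w} = {}" using x(4) that by blast
    then show ?thesis unfolding affine_ext_def by (simp only: sum.empty)
  qed
  have "0 \<le> affine_ext \<phi> x w" for w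
    by (cases "w = \<phi> u"; cases "w = \<phi> v") (use 1 x(1,2) zero in simp_all)
  then show "affine_ext \<phi> x \<in> segment (\<phi> u) (\<phi> v)"
    unfolding segment_def by (intro CollectI conjI allI impI) (use 1 x(3) zero in simp_all)
qed

lemma affine_ext_point: "affine_ext \<phi> (point v) = point (\<phi> v)"
proof
  fix w
  have "{a. point v a \<noteq> 0 \<and> \<phi> a = w} = (if \<phi> v = w then {v} else {})"
    by (auto simp: point_def)
  then show "affine_ext \<phi> (point v) w = point (\<phi> v) w" by (auto simp: affine_ext_def point_def)
qed

locale connected_graph =
  fixes E :: "('v \<times> 'v) set"
  assumes irrefl: "(u, v) \<in> E \<Longrightarrow> u \<noteq> v"
    and connected: "u \<in> Field E \<Longrightarrow> v \<in> Field E \<Longrightarrow> \<exists>n. (u, v) \<in> E ^^ n"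
begin

lemma point_in_segment: "(u, v) \<in> E \<Longrightarrow> point u \<in> segment u v" "(u, v) \<in> E \<Longrightarrow> point v \<in> segment u v"
  by (rule point_segment, erule irrefl)+

lemma chain_path:
  assumes "chain E x (point u) s" "(u, w) \<in> E ^^ n"
  shows "\<exists>s'. s' \<le> s + n \<and> chain E x (point w) s'"
  using assms(2)
proof (induction n arbitrary: w)
  case 0
  then show ?case using assms by auto
next
  case (Suc n)
  then obtain v where "(u, v) \<in> E ^^ n" and e: "(v, w) \<in> E" by auto
  then obtain s' where s': "s' \<le> s + n" "chain E x (point v) s'" using Suc.IH by blast
  have "chain E x (point w) (s' + \<bar>point v v - point w v\<bar>)"
    by (rule chain_step[OF s'(2) e point_in_segment[OF e]])
  moreover have "\<bar>point v v - point w v\<bar> \<le> 1" by (simp add: point_def)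
  ultimately show ?case using s' by (intro exI[of _ "s' + \<bar>point v v - point w v\<bar>"]) auto
qed

lemma tree_dist_path:
  assumes "(u, w) \<in> E ^^ n" shows "tree_dist E (point u) (point w) \<le> n"
proof -
  obtain s where s: "s \<le> 0 + real n" "chain E (point u) (point w) s"
    using chain_path[OF chain_refl assms] by blast
  then show ?thesis using tree_dist_le[OF s(2)] by linarith
qed

lemma chain_exists:
  assumes "x \<in> realisation E" "y \<in> realisation E"
  shows "\<exists>s. chain E x y s"
proof -
  obtain u v where u: "(u, v) \<in> E" "x \<in> segment u v" using assms by (auto simp: realisation_def)
  obtain w z where w: "(w, z) \<in> E" "y \<in> segment w z" using assms by (auto simp: realisation_def)
  obtain n where n: "(u, w) \<in> E ^^ n" using connected[OF FieldI1[OF u(1)] FieldI1[OF w(1)]] by blast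
  obtain s where "chain E x (point u) s"
    using chain_step[OF chain_refl u(1,2) point_in_segment(1)[OF u(1)]] by blast
  then obtain s' where "chain E x (point w) s'" using chain_path[OF _ n] by blast
  then have "chain E x y (s' + \<bar>point w w - y w\<bar>)"
    by (rule chain_step[OF _ w(1) point_in_segment(1)[OF w(1)] w(2)])
  then show ?thesis by blast
qed

definition lipschitz :: "('v \<Rightarrow> real) \<Rightarrow> bool" where
  "lipschitz f \<longleftrightarrow> (\<forall>u v. (u, v) \<in> E \<longrightarrow> \<bar>f u - f v\<bar> \<le> 1)"

lemma lipschitz_segment:
  assumes "lipschitz f" "(u, v) \<in> E" "x \<in> segment u v" "y \<in> segment u v"
  shows "\<bar>bary_ext f x - bary_ext f y\<bar> \<le> \<bar>x u - y u\<bar>"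
proof -
  have v: "x v = 1 - x u" "y v = 1 - y u" using assms by (auto simp: segment_def)
  have "bary_ext f x - bary_ext f y = (x u - y u) * (f u - f v)"
    using assms irrefl[OF assms(2)] by (simp add: bary_ext_segment v algebra_simps)
  moreover have "\<bar>f u - f v\<bar> \<le> 1" using assms by (auto simp: lipschitz_def)
  ultimately show ?thesis
    using mult_left_mono[of "\<bar>f u - f v\<bar>" 1 "\<bar>x u - y u\<bar>"] by (simp add: abs_mult)
qed

text \<open>
  A function with slope at most \<open>1\<close> on the edges varies along a chain by at most its length, so it
  bounds the distance from below.
\<close>

lemma lipschitz_chain:
  assumes "lipschitz f" "chain E x y s"
  shows "\<bar>bary_ext f x - bary_ext f y\<bar> \<le> s"
proof -
  obtain n :: nat and c us vs where s: "s = (\<Sum>i<n. \<bar>c i (us i) - c (Suc i) (us i)\<bar>)" "c 0 = x" "c n = y"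
    and E: "\<forall>i<n. (us i, vs i) \<in> E \<and> c i \<in> segment (us i) (vs i) \<and> c (Suc i) \<in> segment (us i) (vs i)"
    using assms(2) unfolding chain_def by blast
  have "\<bar>bary_ext f (c 0) - bary_ext f (c m)\<bar> \<le> (\<Sum>i<m. \<bar>c i (us i) - c (Suc i) (us i)\<bar>)" if "m \<le> n" for m
    using that
  proof (induction m)
    case (Suc m)
    have "\<bar>bary_ext f (c m) - bary_ext f (c (Suc m))\<bar> \<le> \<bar>c m (us m) - c (Suc m) (us m)\<bar>"
      using E Suc.prems by (intro lipschitz_segment[OF assms(1), of "us m" "vs m"]) auto
    then show ?case using Suc by auto
  qed simp
  then show ?thesis using s by blast
qed

lemma tree_dist_ge:
  assumes "lipschitz f" "x \<in> realisation E" "y \<in> realisation E"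
  shows "\<bar>bary_ext f x - bary_ext f y\<bar> \<le> tree_dist E x y"
  unfolding tree_dist_chain using chain_exists[OF assms(2,3)] lipschitz_chain[OF assms(1)]
  by (intro cInf_greatest) auto

lemma tree_dist_nonneg: "x \<in> realisation E \<Longrightarrow> y \<in> realisation E \<Longrightarrow> 0 \<le> tree_dist E x y"
  using tree_dist_ge[of "\<lambda>_. 0" x y] by (auto simp: lipschitz_def)

lemma point_in_realisation: "v \<in> Field E \<Longrightarrow> point v \<in> realisation E"
proof (unfold Field_def, elim UnE DomainE RangeE)
  show "point v \<in> realisation E" if "(v, w) \<in> E" for w
    using that point_in_segment(1)[OF that] unfolding realisation_def by blast
  show "point v \<in> realisation E" if "(w, v) \<in> E" for w
    using that point_in_segment(2)[OF that] unfolding realisation_def by blast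
qed

lemma tree_dist_self [simp]: "x \<in> realisation E \<Longrightarrow> tree_dist E x x = 0"
  using tree_dist_le[OF chain_refl] tree_dist_nonneg by (metis order_antisym)

lemma openin_ball:
  assumes "x \<in> realisation E" "0 < r"
  shows "openin (cone_topology E) (Inl ` {y \<in> realisation E. tree_dist E x y < r})"
  unfolding cone_topology_def by (rule topology_generated_by_Basis) (use assms in blast)

lemma openin_cone_nbhd:
  assumes "geodesic_ray E c" "0 < r" "0 < \<epsilon>"
  shows "openin (cone_topology E) (cone_nbhd E c r \<epsilon>)"
  unfolding cone_topology_def by (rule topology_generated_by_Basis) (use assms in blast)

lemma closure_of_point:
  assumes "v \<in> Field E"
  shows "Inl (point v) \<in> cone_topology E closure_of (Inl ` {point v})"
proof -
  have "Inl (point v) \<in> Inl ` {y \<in> realisation E. tree_dist E (point v) y < 1}"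
    using assms point_in_realisation by auto
  then have "Inl (point v) \<in> topspace (cone_topology E)"
    using openin_subset[OF openin_ball[OF point_in_realisation[OF assms], of 1]] by auto
  then show ?thesis by (auto simp: in_closure_of)
qed

text \<open>
  A common point of the closures cannot lie in the realisation, where two balls of radius \<open>1/2\<close>
  separate the vertices, nor on the boundary, where a cone neighbourhood of large radius omits any
  given point.
\<close>

lemma closure_of_points_disjoint:
  assumes v: "v \<in> Field E" "w \<in> Field E" and f: "lipschitz f" "1 \<le> \<bar>f v - f w\<bar>"
  shows "cone_topology E closure_of (Inl ` {point v}) \<inter> cone_topology E closure_of (Inl ` {point w}) = {}"
proof (rule ccontr)
  assume "\<not> ?thesis"
  then obtain z where z: "z \<in> cone_topology E closure_of (Inl ` {point v})"
    "z \<in> cone_topology E closure_of (Inl ` {point w})" by blast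
  have top: "z \<in> topspace (cone_topology E)" using z by (simp add: in_closure_of)
  have *: "Inl (point v) \<in> T \<and> Inl (point w) \<in> T" if "openin (cone_topology E) T" "z \<in> T" for T
    using z that by (auto simp: in_closure_of)
  show False
  proof (cases z)
    case (Inl y)
    then have y: "y \<in> realisation E"
      using top by (auto simp: cone_topology_def topology_generated_by_topspace cone_nbhd_def)
    have "tree_dist E y (point v) < 1/2" "tree_dist E y (point w) < 1/2"
      using *[OF openin_ball[OF y, of "1/2"]] y Inl by auto
    then have "\<bar>bary_ext f y - f v\<bar> < 1/2" "\<bar>bary_ext f y - f w\<bar> < 1/2"
      using tree_dist_ge[OF f(1) y point_in_realisation[OF v(1)]]
        tree_dist_ge[OF f(1) y point_in_realisation[OF v(2)]] by auto
    then show False using f(2) by linarith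
  next
    case (Inr \<xi>)
    then have "\<xi> \<in> boundary E"
      using top by (auto simp: cone_topology_def topology_generated_by_topspace cone_nbhd_def)
    then obtain c where c: "geodesic_ray E c" and \<xi>: "\<xi> = {c'. geodesic_ray E c' \<and> asymptotic E c c'}"
      by (auto simp: boundary_def)
    have c0: "tree_dist E (c t) (c t) = 0" if "0 \<le> t" for t using c that by (auto simp: geodesic_ray_def)
    then have "asymptotic E c c" unfolding asymptotic_def by (intro exI[of _ 0]) auto
    then have mem: "c \<in> \<xi>" using c \<xi> by blast
    define r where "r = max 1 (tree_dist E (c 0) (point v))"
    have r: "0 < r" by (simp add: r_def)
    have "z \<in> cone_nbhd E c r 1"
      using \<open>\<xi> \<in> boundary E\<close> mem Inr r c0[of r] by (auto simp: cone_nbhd_def intro!: bexI[of _ c])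
    then have "Inl (point v) \<in> cone_nbhd E c r 1" using *[OF openin_cone_nbhd[OF c r]] by auto
    then have "r < tree_dist E (c 0) (point v)" by (auto simp: cone_nbhd_def)
    then show False by (simp add: r_def)
  qed
qed

lemma bary_ext_affine_ext:
  assumes "(u, v) \<in> E" "x \<in> segment u v" "(\<phi> u, \<phi> v) \<in> E"
  shows "bary_ext f (affine_ext \<phi> x) = bary_ext (f \<circ> \<phi>) x"
  using segment_affine_ext[OF assms(2) irrefl[OF assms(1)] irrefl[OF assms(3)]]
  by (simp add: bary_ext_segment[OF _ irrefl[OF assms(1)]] bary_ext_segment[OF _ irrefl[OF assms(3)]] assms(2))

lemma affine_ext_realisation:
  assumes "(u, v) \<in> E" "x \<in> segment u v" "(\<phi> u, \<phi> v) \<in> E"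
  shows "x \<in> realisation E" "affine_ext \<phi> x \<in> realisation E"
  using segment_affine_ext(1)[OF assms(2) irrefl[OF assms(1)] irrefl[OF assms(3)]] assms
  unfolding realisation_def by blast+

text \<open>
  Apply the Lipschitz bound to \<open>f\<close>, \<open>f \<circ> \<phi>\<close>, \<open>f \<circ> \<phi>\<^sup>2\<close>, \<dots> at the one pair \<open>x\<close>, \<open>\<phi> x\<close>, and add.
  For large \<open>n\<close> the bounded error made by passing from \<open>x\<close> to a nearby vertex becomes negligible.
\<close>

lemma displacement_ge:
  assumes \<phi>: "\<And>u v. (u, v) \<in> E \<Longrightarrow> (\<phi> u, \<phi> v) \<in> E" and f: "lipschitz f"
    and x: "(u, v) \<in> E" "x \<in> segment u v"
  shows "\<bar>bary_ext f x - bary_ext (f \<circ> (\<phi> ^^ n)) x\<bar> \<le> n * tree_dist E x (affine_ext \<phi> x)"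
proof (induction n)
  case (Suc n)
  have pow: "(a, b) \<in> E \<Longrightarrow> ((\<phi> ^^ n) a, (\<phi> ^^ n) b) \<in> E" for a b
    by (induction n) (auto intro: \<phi>)
  have "lipschitz (f \<circ> (\<phi> ^^ n))"
    using f pow unfolding lipschitz_def o_def by blast
  then have "\<bar>bary_ext (f \<circ> (\<phi> ^^ n)) x - bary_ext (f \<circ> (\<phi> ^^ n)) (affine_ext \<phi> x)\<bar> \<le> tree_dist E x (affine_ext \<phi> x)"
    by (rule tree_dist_ge) (rule affine_ext_realisation[OF x \<phi>[OF x(1)]])+
  also have "bary_ext (f \<circ> (\<phi> ^^ n)) (affine_ext \<phi> x) = bary_ext (f \<circ> (\<phi> ^^ Suc n)) x"
    unfolding bary_ext_affine_ext[OF x \<phi>[OF x(1)]] by (simp add: o_assoc funpow_Suc_right del: funpow.simps)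
  finally have step: "\<bar>bary_ext (f \<circ> (\<phi> ^^ n)) x - bary_ext (f \<circ> (\<phi> ^^ Suc n)) x\<bar> \<le> tree_dist E x (affine_ext \<phi> x)" .
  have "real (Suc n) * tree_dist E x (affine_ext \<phi> x) =
      n * tree_dist E x (affine_ext \<phi> x) + tree_dist E x (affine_ext \<phi> x)"
    by (simp add: algebra_simps)
  then show ?case using Suc step by linarith
qed simp

lemma point_inject [simp]: "point v = point w \<longleftrightarrow> v = w"
  unfolding point_def by (metis zero_neq_one)

lemma segment_eq_point: "x \<in> segment u v \<Longrightarrow> x v = 0 \<Longrightarrow> x = point u"
  "x \<in> segment u v \<Longrightarrow> x u = 0 \<Longrightarrow> x = point v"
  by (fastforce simp: segment_def point_def)+

text \<open>
  A fixed point in the interior of an edge makes \<open>\<phi>\<close> either fix both ends or exchange them.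
\<close>

lemma unique_fixed_point:
  assumes \<phi>: "\<And>u v. (u, v) \<in> E \<Longrightarrow> (\<phi> u, \<phi> v) \<in> E" and p: "p \<in> Field E"
    and fixed: "\<And>v. v \<in> Field E \<Longrightarrow> \<phi> v = v \<longleftrightarrow> v = p"
    and no_inversion: "\<And>u v. (u, v) \<in> E \<Longrightarrow> \<not> (\<phi> u = v \<and> \<phi> v = u)"
  shows "{x \<in> realisation E. affine_ext \<phi> x = x} = {point p}"
proof (intro subset_antisym subsetI)
  fix x assume "x \<in> {x \<in> realisation E. affine_ext \<phi> x = x}"
  then obtain u v where uv: "(u, v) \<in> E" and x: "x \<in> segment u v" and fx: "affine_ext \<phi> x = x"
    by (auto simp: realisation_def)
  have F: "u \<in> Field E" "v \<in> Field E" using uv by (auto simp: Field_def)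
  have pt: "x = point p" if "x = point w" "w \<in> Field E" for w
    using fx that by (simp add: affine_ext_point fixed)
  have "x = point p" if nz: "x u \<noteq> 0" "x v \<noteq> 0"
  proof -
    note y = segment_affine_ext[OF x irrefl[OF uv] irrefl[OF \<phi>[OF uv]], unfolded fx]
    have "w = u \<or> w = v" if "x w \<noteq> 0" for w using x that by (auto simp: segment_def)
    then have "\<phi> u = u \<or> \<phi> u = v" "\<phi> v = u \<or> \<phi> v = v" using y nz by auto
    then have "\<phi> u = u \<and> \<phi> v = v" using irrefl[OF \<phi>[OF uv]] no_inversion[OF uv] by auto
    then have "u = p" "v = p" using fixed F by auto
    then show ?thesis using irrefl[OF uv] by simp
  qed
  then show "x \<in> {point p}" using pt segment_eq_point[OF x] F by blast
next
  fix x assume "x \<in> {point p}"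
  then show "x \<in> {x \<in> realisation E. affine_ext \<phi> x = x}"
    using fixed[OF p] p by (simp add: affine_ext_point point_in_realisation)
qed

end

section \<open>The embedding of polynomials into the local field\<close>

lemma poly_emb_0 [simp]: "poly_emb 0 = 0" by (simp add: poly_emb_def)

lemma poly_emb_pCons: "poly_emb (pCons a p) = fls_const a + fls_X_inv * poly_emb p"
  by (simp add: poly_emb_def map_poly_pCons)

lemma poly_emb_nth: "poly_emb p $$ k = (if k \<le> 0 then coeff p (nat (- k)) else 0)"
proof (induction p arbitrary: k)
  case (pCons a p)
  have "(fls_X_inv * poly_emb p) $$ k = poly_emb p $$ (k + 1)"
    by (simp add: fls_X_inv_times_conv_shift)
  moreover have "nat (- k) = Suc (nat (- (k + 1)))" if "k < 0" using that by simp
  ultimately show ?case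
    by (cases "k = 0") (auto simp: poly_emb_pCons pCons.IH coeff_pCons split: nat.splits)
qed simp

lemma poly_emb_add: "poly_emb (p + q) = poly_emb p + poly_emb q"
  by (rule fls_eqI) (simp add: poly_emb_nth)

lemma poly_emb_uminus: "poly_emb (- p) = - poly_emb p"
  by (rule fls_eqI) (simp add: poly_emb_nth)

lemma poly_emb_diff: "poly_emb (p - q) = poly_emb p - poly_emb q"
  by (rule fls_eqI) (simp add: poly_emb_nth)

lemma poly_emb_smult: "poly_emb (smult a q) = fls_const a * poly_emb q"
  by (rule fls_eqI) (simp add: poly_emb_nth)

lemma poly_emb_mult: "poly_emb (p * q) = poly_emb p * poly_emb q"
proof (induction p)
  case (pCons a p)
  then show ?case
    by (simp add: mult_pCons_left poly_emb_add poly_emb_smult poly_emb_pCons algebra_simps)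
qed simp

lemma poly_emb_1 [simp]: "poly_emb 1 = 1"
  by (simp add: one_pCons poly_emb_pCons)

lemma poly_emb_eq_0 [simp]: "poly_emb p = 0 \<longleftrightarrow> p = 0"
proof
  assume "poly_emb p = 0"
  then have "coeff p n = 0" for n using poly_emb_nth[of p "- int n"] by simp
  then show "p = 0" by (simp add: poly_eq_iff)
qed simp

lemma val_ge_poly_emb: "val_ge (- int n) (poly_emb p) \<longleftrightarrow> degree p \<le> n"
proof
  assume *: "val_ge (- int n) (poly_emb p)"
  show "degree p \<le> n"
  proof (rule degree_le, intro allI impI)
    fix i assume "n < i"
    then show "coeff p i = 0" using * poly_emb_nth[of p "- int i"] by (auto simp: val_ge_def)
  qed
next
  assume *: "degree p \<le> n"
  show "val_ge (- int n) (poly_emb p)" unfolding val_ge_def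
    using * by (auto simp: poly_emb_nth intro!: coeff_eq_0)
qed

lemma subdegree_poly_emb: "fls_subdegree (poly_emb p) = - int (degree p)"
proof (cases "p = 0")
  case False
  show ?thesis
  proof (rule antisym)
    show "- int (degree p) \<le> fls_subdegree (poly_emb p)"
      using False val_ge_poly_emb[of "degree p" p] by (simp add: val_ge_iff)
    show "fls_subdegree (poly_emb p) \<le> - int (degree p)"
      using False by (intro fls_subdegree_leI) (simp add: poly_emb_nth)
  qed
qed simp

abbreviation emb :: "'a::field poly ^ 2 ^ 2 \<Rightarrow> 'a fls ^ 2 ^ 2" where
  "emb \<equiv> map_matrix poly_emb"

lemma emb_nth [simp]: "emb A $ i $ j = poly_emb (A $ i $ j)"
  by (simp add: map_matrix_def)

lemma emb_mat2 [simp]: "emb (mat2 a b c d) = mat2 (poly_emb a) (poly_emb b) (poly_emb c) (poly_emb d)"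
  by (simp add: mat2_eq_iff)

lemma emb_mult: "emb (A ** B) = emb A ** emb B"
  by (cases A rule: mat2_cases, cases B rule: mat2_cases) (simp add: poly_emb_add poly_emb_mult)

lemma emb_mat: "emb (mat c) = mat (poly_emb c)"
  by (simp add: mat_eq_mat2)

lemma emb_adj2: "emb (adj2 A) = adj2 (emb A)"
  by (cases A rule: mat2_cases) (simp add: poly_emb_uminus)

lemma det_emb: "det (emb A) = poly_emb (det A)"
  by (cases A rule: mat2_cases) (simp add: poly_emb_diff poly_emb_mult)

lemma trace_emb: "trace (emb A) = poly_emb (trace A)"
  by (cases A rule: mat2_cases) (simp add: poly_emb_add)

text \<open>
  For invertible \<open>A\<close> this is \<open>- min_val (emb A)\<close>, see \<open>min_val_emb\<close>.
\<close>

definition mdeg :: "'a::field poly ^ 2 ^ 2 \<Rightarrow> nat" where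
  "mdeg A = Max {degree (A $ 1 $ 1), degree (A $ 1 $ 2), degree (A $ 2 $ 1), degree (A $ 2 $ 2)}"

lemma mdeg_le_iff: "mdeg A \<le> n \<longleftrightarrow> (\<forall>i j. degree (A $ i $ j) \<le> n)"
  by (auto simp: mdeg_def forall_2)

lemma entries_ge_emb: "entries_ge (- int n) (emb A) \<longleftrightarrow> mdeg A \<le> n"
  by (simp add: entries_ge_def val_ge_poly_emb mdeg_le_iff)

lemma unit_poly: "c dvd 1 \<Longrightarrow> degree c = 0 \<and> c \<noteq> 0" for c :: "'a::field poly"
  by (auto simp: is_unit_poly_iff)

lemma det_emb_unit:
  assumes "det A dvd 1" shows "det (emb A) \<noteq> 0" "vdet (emb A) = 0"
  using unit_poly[OF assms] by (auto simp: det_emb subdegree_poly_emb)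

lemma min_val_emb:
  assumes "det A dvd 1" shows "min_val (emb A) = - int (mdeg A)"
proof (rule antisym)
  note A = det_emb_unit[OF assms]
  show "- int (mdeg A) \<le> min_val (emb A)" using A by (intro min_val_geI) (simp_all add: entries_ge_emb)
  have "min_val (emb A) \<le> 0" using min_val_det[OF A(1)] A(2) by simp
  then have "entries_ge (- int (nat (- min_val (emb A)))) (emb A)" using entries_ge_min_val[OF A(1)] by simp
  then have "mdeg A \<le> nat (- min_val (emb A))" unfolding entries_ge_emb .
  then show "min_val (emb A) \<le> - int (mdeg A)" using \<open>min_val (emb A) \<le> 0\<close> by linarith
qed

text \<open>
  A unit of the polynomial ring has valuation \<open>0\<close>, so the determinant contributes nothing.
\<close>

lemma disp_emb: "det A dvd 1 \<Longrightarrow> disp (emb A) = 2 * int (mdeg A)"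
  by (simp add: disp_def min_val_emb det_emb_unit)

section \<open>The group \<open>PGL\<^sub>2\<close>\<close>

lemma carrier_GL2: "carrier GL2 = {A :: ('r::comm_ring_1) ^ 2 ^ 2. det A dvd 1}"
  and mult_GL2: "A \<otimes>\<^bsub>GL2\<^esub> B = A ** B"
  and one_GL2: "\<one>\<^bsub>GL2\<^esub> = mat 1"
  by (simp_all add: GL2_def invertible_iff_det)

lemma unit_mult_iff: "a * b dvd 1 \<longleftrightarrow> a dvd 1 \<and> b dvd 1" for a b :: "'r::comm_ring_1"
  using mult_dvd_mono[of a 1 b 1] by (auto dest: dvd_mult_left dvd_mult_right)

lemma det_mult_dvd_1: "det (A ** B) dvd 1 \<longleftrightarrow> det A dvd 1 \<and> det B dvd 1"
  for A :: "('r::comm_ring_1) ^ 2 ^ 2"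
  by (simp add: det_mul unit_mult_iff)

lemma group_GL2: "group (GL2 :: (('r::comm_ring_1) ^ 2 ^ 2) monoid)"
proof (rule groupI)
  fix A :: "'r ^ 2 ^ 2" assume "A \<in> carrier GL2"
  then have "invertible A" by (simp add: GL2_def)
  then obtain B where B: "A ** B = mat 1" "B ** A = mat 1" unfolding invertible_def by blast
  then have "det B dvd 1" using det_mult_dvd_1[of A B] by simp
  then show "\<exists>B\<in>carrier GL2. B \<otimes>\<^bsub>GL2\<^esub> A = \<one>\<^bsub>GL2\<^esub>"
    using B by (auto simp: carrier_GL2 mult_GL2 one_GL2)
qed (auto simp: carrier_GL2 mult_GL2 one_GL2 matrix_mul_assoc det_mult_dvd_1 simp del: det_scalar)

lemma normal_scalars2: "scalars2 \<lhd> (GL2 :: (('r::comm_ring_1) ^ 2 ^ 2) monoid)"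
proof -
  interpret group "GL2 :: ('r ^ 2 ^ 2) monoid" by (rule group_GL2)
  have sub: "subgroup (scalars2 :: ('r ^ 2 ^ 2) set) GL2"
  proof (rule subgroupI)
    show "scalars2 \<subseteq> carrier (GL2 :: ('r ^ 2 ^ 2) monoid)"
      by (auto simp: scalars2_def carrier_GL2 power2_eq_square unit_mult_iff)
    show "(scalars2 :: ('r ^ 2 ^ 2) set) \<noteq> {}" by (auto simp: scalars2_def intro!: exI[of _ 1])
  next
    fix A :: "'r ^ 2 ^ 2" assume "A \<in> scalars2"
    then obtain c where c: "A = mat c" "c dvd 1" by (auto simp: scalars2_def)
    then obtain d where d: "c * d = 1" by (metis dvdE)
    have "d dvd 1" using d by (metis dvd_triv_right)
    moreover have "inv\<^bsub>GL2\<^esub> A = mat d"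
      using c d \<open>d dvd 1\<close> by (intro inv_equality)
        (auto simp: mult_GL2 one_GL2 carrier_GL2 power2_eq_square unit_mult_iff mult.commute)
    ultimately show "inv\<^bsub>GL2\<^esub> A \<in> scalars2" by (auto simp: scalars2_def)
  next
    fix A B :: "'r ^ 2 ^ 2" assume "A \<in> scalars2" "B \<in> scalars2"
    then show "A \<otimes>\<^bsub>GL2\<^esub> B \<in> scalars2"
      by (auto simp: scalars2_def mult_GL2 unit_mult_iff)
  qed
  show ?thesis
  proof (rule normalI[OF sub], intro ballI)
    fix A :: "'r ^ 2 ^ 2" assume "A \<in> carrier GL2"
    show "scalars2 #>\<^bsub>GL2\<^esub> A = A <#\<^bsub>GL2\<^esub> scalars2"
      unfolding r_coset_def l_coset_def scalars2_def mult_GL2 by (auto simp: scalar_commute)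
  qed
qed

lemma group_PGL2: "group (PGL2 :: ('r::comm_ring_1 ^ 2 ^ 2) set monoid)"
  unfolding PGL2_def by (rule normal.factorgroup_is_group[OF normal_scalars2])

interpretation PGL: group "PGL2 :: ('a::field poly ^ 2 ^ 2) set monoid"
  by (rule group_PGL2)

abbreviation proj :: "('r::comm_ring_1) ^ 2 ^ 2 \<Rightarrow> ('r ^ 2 ^ 2) set" where
  "proj A \<equiv> scalars2 #>\<^bsub>GL2\<^esub> A"

lemma proj_eq: "proj A = {mat c ** A | c. c dvd 1}"
  unfolding r_coset_def scalars2_def mult_GL2 by blast

lemma carrier_PGL2: "carrier PGL2 = proj ` {A :: ('r::comm_ring_1) ^ 2 ^ 2. det A dvd 1}"
  unfolding PGL2_def FactGroup_def RCOSETS_def carrier_GL2 by auto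

lemma proj_in_carrier: "det A dvd 1 \<Longrightarrow> proj A \<in> carrier PGL2"
  by (auto simp: carrier_PGL2)

lemma proj_mult:
  assumes "det A dvd 1" "det B dvd 1"
  shows "proj A \<otimes>\<^bsub>PGL2\<^esub> proj B = proj (A ** B)"
  using normal.rcos_sum[OF normal_scalars2, of A B] assms
  by (simp add: PGL2_def FactGroup_def carrier_GL2 mult_GL2)

lemma proj_one: "\<one>\<^bsub>PGL2\<^esub> = proj (mat 1)"
  unfolding PGL2_def FactGroup_def proj_eq by (auto simp: scalars2_def)

lemma proj_eq_iff:
  "proj A = proj B \<longleftrightarrow> (\<exists>c. c dvd 1 \<and> B = mat c ** A)" for A B :: "('r::comm_ring_1) ^ 2 ^ 2"
proof
  assume "proj A = proj B"
  moreover have "B \<in> proj B" unfolding proj_eq by (rule CollectI, rule exI[of _ 1]) simp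
  ultimately show "\<exists>c. c dvd 1 \<and> B = mat c ** A" unfolding proj_eq by blast
next
  assume "\<exists>c. c dvd 1 \<and> B = mat c ** A"
  then obtain c where c: "c dvd 1" "B = mat c ** A" by blast
  then obtain d where d: "c * d = 1" by (metis dvdE)
  have "d dvd 1" using d by (metis dvd_triv_right)
  have 1: "mat e ** B = mat (e * c) ** A" for e using c by (simp add: matrix_mul_assoc)
  have 2: "mat e ** A = mat (e * d) ** B" for e
    using d by (simp add: 1 mult.assoc mult.commute[of d])
  show "proj A = proj B"
  proof (rule subset_antisym; rule subsetI)
    fix X assume "X \<in> proj A"
    then obtain e where "e dvd 1" "X = mat (e * d) ** B" unfolding proj_eq 2 by blast
    moreover have "e * d dvd 1" using \<open>e dvd 1\<close> \<open>d dvd 1\<close> by (simp add: unit_mult_iff)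
    ultimately show "X \<in> proj B" unfolding proj_eq by blast
  next
    fix X assume "X \<in> proj B"
    then obtain e where "e dvd 1" "X = mat (e * c) ** A" unfolding proj_eq 1 by blast
    moreover have "e * c dvd 1" using \<open>e dvd 1\<close> \<open>c dvd 1\<close> by (simp add: unit_mult_iff)
    ultimately show "X \<in> proj A" unfolding proj_eq by blast
  qed
qed

lemma proj_scalar_mult: "c dvd 1 \<Longrightarrow> proj (mat c ** A) = proj A"
  using proj_eq_iff[of A "mat c ** A"] by blast

lemma proj_inv:
  fixes A :: "'a::field poly ^ 2 ^ 2"
  assumes "det A dvd 1" shows "inv\<^bsub>PGL2\<^esub> (proj A) = proj (adj2 A)"
proof (rule PGL.inv_equality)
  have "proj (adj2 A) \<otimes>\<^bsub>PGL2\<^esub> proj A = proj (mat (det A) ** mat 1)"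
    using assms by (simp add: proj_mult adj2_left)
  then show "proj (adj2 A) \<otimes>\<^bsub>PGL2\<^esub> proj A = \<one>\<^bsub>PGL2\<^esub>"
    using assms by (simp only: proj_scalar_mult proj_one)
qed (use assms in \<open>simp_all add: proj_in_carrier\<close>)

lemma PGL2_cases:
  assumes "g \<in> carrier PGL2" obtains A where "det A dvd 1" "g = proj A"
  using assms by (auto simp: carrier_PGL2)

section \<open>The action on the tree\<close>

lemma vertex_act_proj:
  assumes "det A dvd 1" shows "vertex_act (proj A) (vertex B) = vertex (emb A ** B)"
proof -
  have eq: "(\<lambda>x. emb (mat c ** A) *v x) ` lat (mat d ** B) = lat (mat (poly_emb c * d) ** (emb A ** B))" for c d
  proof -
    have "emb (mat c ** A) ** (mat d ** B) = mat (poly_emb c) ** (emb A ** (mat d ** B))"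
      by (simp only: emb_mult emb_mat matrix_mul_assoc)
    also have "emb A ** (mat d ** B) = mat d ** (emb A ** B)" by (rule scalar_mult_assoc)
    also have "mat (poly_emb c) ** (mat d ** (emb A ** B)) = mat (poly_emb c * d) ** (emb A ** B)"
      by (simp only: matrix_mul_assoc scalar_mult_scalar)
    finally show ?thesis by (simp only: lat_mult)
  qed
  have "vertex_act (proj A) (vertex B) =
      {lat (mat (poly_emb c * d) ** (emb A ** B)) | c d. c dvd 1 \<and> d \<noteq> 0}"
    unfolding vertex_act_def proj_eq vertex_eq eq[symmetric] by blast
  also have "\<dots> = {lat (mat e ** (emb A ** B)) | e. e \<noteq> 0}"
  proof (rule subset_antisym; rule subsetI)
    fix L assume "L \<in> {lat (mat (poly_emb c * d) ** (emb A ** B)) | c d. c dvd 1 \<and> d \<noteq> 0}"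
    then obtain c d where cd: "c dvd 1" "d \<noteq> 0" "L = lat (mat (poly_emb c * d) ** (emb A ** B))" by blast
    then have "poly_emb c * d \<noteq> 0" using unit_poly[of c] by simp
    then show "L \<in> {lat (mat e ** (emb A ** B)) | e. e \<noteq> 0}" using cd by blast
  next
    fix L assume "L \<in> {lat (mat e ** (emb A ** B)) | e. e \<noteq> 0}"
    then obtain e where "e \<noteq> 0" "L = lat (mat (poly_emb 1 * e) ** (emb A ** B))" by auto
    then show "L \<in> {lat (mat (poly_emb c * d) ** (emb A ** B)) | c d. c dvd 1 \<and> d \<noteq> 0}"
      using one_dvd by blast
  qed
  finally show ?thesis unfolding vertex_eq .
qed

lemma Field_bt_edges: "v \<in> Field bt_edges \<longleftrightarrow> (\<exists>A. det A \<noteq> 0 \<and> v = vertex A)"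
proof
  assume "v \<in> Field bt_edges"
  then show "\<exists>A. det A \<noteq> 0 \<and> v = vertex A"
    by (auto simp: Field_def elim!: edge_cases)
next
  assume "\<exists>A. det A \<noteq> 0 \<and> v = vertex A"
  then obtain A where A: "det A \<noteq> 0" "v = vertex A" by blast
  let ?T = "mat2 1 0 0 fls_X :: 'a fls ^ 2 ^ 2"
  have "(vertex A, vertex (A ** ?T)) \<in> bt_edges"
    unfolding bt_edges_iff using A by (intro exI[of _ A] exI[of _ ?T]) (auto simp: val_ge_iff)
  then show "v \<in> Field bt_edges" using A by (auto intro: FieldI1)
qed

interpretation tree: connected_graph "bt_edges :: (('a::field fls ^ 2) set set \<times> _) set"
proof
  show "u \<noteq> v" if "(u, v) \<in> bt_edges" for u v :: "('a fls ^ 2) set set"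
    using that by (auto elim: edge_cases)
  show "\<exists>n. (u, v) \<in> bt_edges ^^ n" if "u \<in> Field bt_edges" "v \<in> Field bt_edges"
    for u v :: "('a fls ^ 2) set set"
    using that path_exists unfolding Field_bt_edges by blast
qed

lemma lipschitz_vdist: "det C \<noteq> 0 \<Longrightarrow> tree.lipschitz (\<lambda>v. real_of_int (vdist C v))"
  unfolding tree.lipschitz_def using vdist_edge by (metis of_int_abs of_int_diff of_int_le_1_iff)

lemma vertex_act_edge:
  assumes "det A dvd 1" "(u, v) \<in> bt_edges"
  shows "(vertex_act (proj A) u, vertex_act (proj A) v) \<in> bt_edges"
  using assms(2)
proof (rule edge_cases)
  fix B C assume "det B \<noteq> 0" "det C \<noteq> 0" "u = vertex B" "v = vertex C"
  then show ?thesis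
    using edge_mult[of "emb A" B C] assms by (simp add: vertex_act_proj det_emb_unit)
qed

section \<open>Degrees in \<open>PGL\<^sub>2\<close> of a polynomial ring\<close>

lemma mdeg_nth: "degree (A $ i $ j) \<le> mdeg A"
  using mdeg_le_iff by blast

lemma mdeg_mult_le: "mdeg (A ** B) \<le> mdeg A + mdeg B"
  unfolding mdeg_le_iff mult_nth
  by (intro allI degree_add_le order_trans[OF degree_mult_le] add_mono mdeg_nth)

lemma mdeg_adj2 [simp]: "mdeg (adj2 A) = mdeg A"
  by (cases A rule: mat2_cases) (simp add: mdeg_def insert_commute)

lemma mdeg_scalar_mult: assumes "c dvd 1" shows "mdeg (mat c ** A) = mdeg A"
proof -
  obtain k where "c = [:k:]" "k \<noteq> 0" using unit_poly[OF assms] by (metis degree_eq_zeroE pCons_0_0)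
  then show ?thesis by (simp add: mdeg_def)
qed

text \<open>
  The representatives of an element differ by nonzero constants, which do not affect degrees.
\<close>

definition pdeg :: "('a::field poly ^ 2 ^ 2) set \<Rightarrow> nat" where
  "pdeg g = mdeg (SOME A. A \<in> g)"

lemma pdeg_proj: "pdeg (proj A) = mdeg A"
proof -
  have "A \<in> proj A" unfolding proj_eq by (rule CollectI, rule exI[of _ 1]) simp
  then have "(SOME B. B \<in> proj A) \<in> proj A" by (rule someI)
  then obtain c where "c dvd 1" "(SOME B. B \<in> proj A) = mat c ** A" unfolding proj_eq by blast
  then show ?thesis by (simp add: pdeg_def mdeg_scalar_mult)
qed

lemma pdeg_mult_le:
  "g \<in> carrier PGL2 \<Longrightarrow> h \<in> carrier PGL2 \<Longrightarrow> pdeg (g \<otimes>\<^bsub>PGL2\<^esub> h) \<le> pdeg g + pdeg h"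
  by (elim PGL2_cases) (simp add: proj_mult pdeg_proj mdeg_mult_le)

lemma pdeg_inv: "g \<in> carrier PGL2 \<Longrightarrow> pdeg (inv\<^bsub>PGL2\<^esub> g) = pdeg g"
  by (elim PGL2_cases) (simp add: proj_inv pdeg_proj)

lemma pdeg_one: "pdeg (\<one>\<^bsub>PGL2\<^esub>) = 0"
  by (simp add: proj_one pdeg_proj mdeg_def mat_eq_mat2)

section \<open>The involutions\<close>

definition J :: "'r::comm_ring_1 ^ 2 ^ 2" where "J = mat2 0 1 (-1) 0"

lemma det_J [simp]: "det J = 1" by (simp add: J_def)

lemma mdeg_J [simp]: "mdeg J = 0" by (simp add: J_def mdeg_def)

lemma emb_J: "emb J = J" by (simp add: J_def poly_emb_uminus)

definition alpha :: "('a::field poly ^ 2 ^ 2) set" where "alpha = proj J"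

lemma alpha_eq: "pgl2_of 0 1 (-1) 0 = alpha"
  by (simp add: pgl2_of_def alpha_def J_def mat2_def)

lemma alpha_carrier [simp]: "alpha \<in> carrier PGL2"
  by (simp add: alpha_def proj_in_carrier)

lemma alpha_square: "alpha \<otimes>\<^bsub>PGL2\<^esub> alpha = \<one>\<^bsub>PGL2\<^esub>"
proof -
  have "J ** J = mat (- 1) ** (mat 1 :: 'a poly ^ 2 ^ 2)" by (simp add: J_def mat_eq_mat2)
  then have "alpha \<otimes>\<^bsub>PGL2\<^esub> alpha = (proj (mat (- 1) ** mat 1) :: ('a poly ^ 2 ^ 2) set)"
    by (simp add: alpha_def proj_mult)
  also have "\<dots> = proj (mat 1)" by (rule proj_scalar_mult) simp
  finally show ?thesis by (simp only: proj_one)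
qed

text \<open>
  A representative of the conjugate of \<open>alpha\<close> by the class of \<open>A\<close>: up to a scalar, \<open>adj2 A\<close> is the
  inverse of \<open>A\<close>.
\<close>

definition half_turn :: "'a::field poly ^ 2 ^ 2 \<Rightarrow> 'a poly ^ 2 ^ 2" where
  "half_turn A = A ** (J ** adj2 A)"

lemma det_half_turn: "det A dvd 1 \<Longrightarrow> det (half_turn A) dvd 1"
  by (simp add: half_turn_def det_mult_dvd_1)

lemma conj_act_alpha:
  assumes "det A dvd 1" shows "conj_act PGL2 (proj A) alpha = proj (half_turn A)"
  using assms by (simp add: conj_act_def alpha_def proj_inv proj_mult det_mult_dvd_1 half_turn_def matrix_mul_assoc)

text \<open>
  The form \<open>x\<^sup>2 + y\<^sup>2\<close> is anisotropic, that is, \<open>-1\<close> is not a square.  Then \<open>J\<close> generates an unramified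
  quadratic extension of the local field, which is why it fixes a single vertex.
\<close>

locale anisotropic =
  fixes F :: "'a::field itself"
  assumes aniso: "x * x + y * y = 0 \<Longrightarrow> x = (0 :: 'a)"
begin

lemma aniso_iff: "x * x + y * y = 0 \<longleftrightarrow> x = 0 \<and> y = (0 :: 'a)"
  using aniso[of x y] aniso[of y x] by (auto simp: add.commute)

text \<open>
  The off-diagonal entries of \<open>adj2 B ** J ** B\<close> are, up to sign, the sums of the squares of the
  entries of a column of \<open>B\<close>.  Leading terms of squares cannot cancel, so one of these sums has
  valuation exactly \<open>2 * min_val B\<close>.
\<close>

lemma lat_dist_J:
  fixes B :: "'a fls ^ 2 ^ 2"
  assumes B: "det B \<noteq> 0" shows "2 * disp B \<le> lat_dist B (J ** B)"
proof -
  obtain a b c d where Bm: "B = mat2 a b c d" by (rule mat2_cases)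
  let ?m = "min_val B"
  have m: "val_ge ?m a" "val_ge ?m b" "val_ge ?m c" "val_ge ?m d" using entries_ge_min_val[OF B] by (simp_all add: Bm)
  have eq: "adj2 B ** (J ** B) = mat2 (a * b + c * d) (b * b + d * d) (- (a * a + c * c)) (- (a * b + c * d))"
    by (simp add: Bm J_def algebra_simps)
  have dB: "det (adj2 B ** (J ** B)) = det B * det B" by (simp add: det_mul)
  have dB0: "det (adj2 B ** (J ** B)) \<noteq> 0" unfolding dB using B by simp
  have "min_val (adj2 B ** (J ** B)) \<le> ?m + ?m"
  proof (rule ccontr)
    assume "\<not> ?thesis"
    then have gt: "?m + ?m < min_val (adj2 B ** (J ** B))" by simp
    have "entries_ge (min_val (adj2 B ** (J ** B))) (adj2 B ** (J ** B))" by (rule entries_ge_min_val[OF dB0])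
    then have "val_ge (min_val (adj2 B ** (J ** B))) (b * b + d * d)"
      "val_ge (min_val (adj2 B ** (J ** B))) (- (a * a + c * c))" unfolding eq entries_ge_mat2 by blast+
    then have "(b * b + d * d) $$ (?m + ?m) = 0" "(a * a + c * c) $$ (?m + ?m) = 0"
      using gt unfolding val_ge_uminus unfolding val_ge_def by blast+
    then have "b $$ ?m * b $$ ?m + d $$ ?m * d $$ ?m = 0" "a $$ ?m * a $$ ?m + c $$ ?m * c $$ ?m = 0"
      unfolding fls_plus_nth val_ge_mult_nth[OF m(1,1)] val_ge_mult_nth[OF m(2,2)] val_ge_mult_nth[OF m(3,3)]
        val_ge_mult_nth[OF m(4,4)] .
    then have "a $$ ?m = 0" "b $$ ?m = 0" "c $$ ?m = 0" "d $$ ?m = 0"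
      unfolding aniso_iff by blast+
    moreover have "val_ge (?m + 1) x" if "val_ge ?m x" "x $$ ?m = 0" for x :: "'a fls"
    proof -
      have "k < ?m + 1 \<longleftrightarrow> k < ?m \<or> k = ?m" for k by linarith
      then show ?thesis using that unfolding val_ge_def by blast
    qed
    ultimately have "entries_ge (?m + 1) B" using m by (simp add: Bm)
    then show False using min_val_geI[OF B] by fastforce
  qed
  then show ?thesis unfolding lat_dist_def disp_def using B by (simp add: dB)
qed

lemma lat_dist_half_turn:
  fixes A :: "'a poly ^ 2 ^ 2"
  assumes A: "det A dvd 1" and B: "det B \<noteq> 0"
  shows "2 * lat_dist (emb A) B \<le> lat_dist B (emb (half_turn A) ** B)"
proof -
  let ?C = "adj2 (emb A) ** B"
  note nz = det_emb_unit(1)[OF A]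
  have C: "det ?C \<noteq> 0" using nz B by (simp add: det_mul)
  have "2 * lat_dist (emb A) B \<le> lat_dist ?C (J ** ?C)" using lat_dist_J[OF C] by (simp add: lat_dist_def)
  also have "\<dots> = lat_dist (emb A ** ?C) (emb A ** (J ** ?C))"
    using nz C by (intro lat_dist_mult_left[symmetric]) (auto simp: det_mul)
  also have "emb A ** ?C = mat (det (emb A)) ** B" by (rule adj2_mult_cancel')
  also have "emb A ** (J ** ?C) = emb (half_turn A) ** B"
    by (simp add: half_turn_def emb_mult emb_adj2 emb_J matrix_mul_assoc)
  also have "lat_dist (mat (det (emb A)) ** B) (emb (half_turn A) ** B) = lat_dist B (emb (half_turn A) ** B)"
    using nz B det_emb_unit(1)[OF det_half_turn[OF A]] by (intro lat_dist_scalar_left) (auto simp: det_mul)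
  finally show ?thesis .
qed

lemma half_turn_fixed_vertex:
  fixes A :: "'a poly ^ 2 ^ 2"
  assumes A: "det A dvd 1" shows "vertex (emb (half_turn A) ** emb A) = vertex (emb A)"
proof -
  note nz = det_emb_unit(1)[OF A]
  have "emb (half_turn A) ** emb A = emb A ** (J ** (adj2 (emb A) ** emb A))"
    by (simp add: half_turn_def emb_mult emb_adj2 emb_J matrix_mul_assoc)
  also have "\<dots> = mat (det (emb A)) ** (emb A ** J)"
    by (simp add: adj2_left scalar_commute[of J] scalar_mult_assoc)
  finally have "vertex (emb (half_turn A) ** emb A) = vertex (emb A ** J)"
    using nz by (simp add: vertex_scalar_mult)
  also have "\<dots> = vertex (emb A)"
    using nz by (intro vertex_mult_unit) (auto simp: J_def val_ge_iff)
  finally show ?thesis .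
qed

text \<open>
  By \<open>lat_dist_half_turn\<close> no other vertex is fixed.  No edge is inverted either, because a matrix
  with unit determinant moves each vertex by an even distance.
\<close>

lemma fixed_set_half_turn:
  fixes A :: "'a poly ^ 2 ^ 2"
  assumes A: "det A dvd 1"
  shows "fixed_set (proj (half_turn A)) = {point (vertex (emb A))}"
  unfolding fixed_set_def invariants_def tree_act_def
proof (rule tree.unique_fixed_point)
  note nz = det_emb_unit(1)[OF A]
  note R = det_half_turn[OF A]
  show "(vertex_act (proj (half_turn A)) u, vertex_act (proj (half_turn A)) v) \<in> bt_edges"
    if "(u, v) \<in> bt_edges" for u v using that by (rule vertex_act_edge[OF R])
  show "vertex (emb A) \<in> Field bt_edges" unfolding Field_bt_edges using nz by blast
  show "vertex_act (proj (half_turn A)) v = v \<longleftrightarrow> v = vertex (emb A)" if v: "v \<in> Field bt_edges" for v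
  proof
    obtain B where B: "det B \<noteq> 0" "v = vertex B" using v unfolding Field_bt_edges by blast
    have nzB: "det (emb (half_turn A) ** B) \<noteq> 0" using B det_emb_unit(1)[OF R] by (simp add: det_mul)
    assume "vertex_act (proj (half_turn A)) v = v"
    then have "vertex B = vertex (emb (half_turn A) ** B)" using B R by (simp add: vertex_act_proj)
    then have "lat_dist B (emb (half_turn A) ** B) = 0" using vertex_eq_iff[OF B(1) nzB] by simp
    then have "lat_dist (emb A) B = 0" using lat_dist_half_turn[OF A B(1)] lat_dist_nonneg[OF nz B(1)] by linarith
    then show "v = vertex (emb A)" using vertex_eq_iff[OF nz B(1)] B by simp
  next
    assume "v = vertex (emb A)"
    then show "vertex_act (proj (half_turn A)) v = v" using R half_turn_fixed_vertex[OF A] by (simp add: vertex_act_proj)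
  qed
  \<comment> \<open>The square of the determinant of \<open>B\<close> has even valuation, whereas neighbours have distance \<open>1\<close>.\<close>
  show "\<not> (vertex_act (proj (half_turn A)) u = v \<and> vertex_act (proj (half_turn A)) v = u)"
    if e: "(u, v) \<in> bt_edges" for u v
  proof
    assume *: "vertex_act (proj (half_turn A)) u = v \<and> vertex_act (proj (half_turn A)) v = u"
    from e obtain B C where B: "det B \<noteq> 0" and C: "det C \<noteq> 0" and uv: "u = vertex B" "v = vertex C"
      and 1: "lat_dist B C = 1" by (rule edge_cases)
    have nzB: "det (emb (half_turn A) ** B) \<noteq> 0" using B det_emb_unit(1)[OF R] by (simp add: det_mul)
    have "vertex (emb (half_turn A) ** B) = vertex C" using * uv R by (simp add: vertex_act_proj)
    then have "lat_dist B (emb (half_turn A) ** B) = lat_dist B C"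
      using vdist_vertex[OF B nzB] vdist_vertex[OF B C] by simp
    moreover have "vdet (adj2 B ** (emb (half_turn A) ** B)) = 2 * vdet B"
      using B det_emb_unit[OF R] by (simp add: det_mul)
    ultimately have "2 * vdet B - 2 * min_val (adj2 B ** (emb (half_turn A) ** B)) = 1"
      using 1 by (simp add: lat_dist_def disp_def)
    then show False by presburger
  qed
qed

lemma vertex_emb_eq_iff:
  fixes A B :: "'a poly ^ 2 ^ 2"
  assumes "det A dvd 1" "det B dvd 1"
  shows "vertex (emb A) = vertex (emb B) \<longleftrightarrow> mdeg (adj2 A ** B) = 0"
proof -
  have "lat_dist (emb A) (emb B) = disp (emb (adj2 A ** B))" by (simp add: lat_dist_def emb_mult emb_adj2)
  also have "\<dots> = 2 * int (mdeg (adj2 A ** B))" using assms by (intro disp_emb) (simp add: det_mult_dvd_1)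
  finally show ?thesis
    using vertex_eq_iff[OF det_emb_unit(1)[OF assms(1)] det_emb_unit(1)[OF assms(2)]] by simp
qed

lemma fixed_set_stabiliser_half_turn:
  assumes h: "h \<in> carrier PGL2"
  shows "fixed_set_stabiliser (conj_act PGL2 h (alpha :: ('a poly ^ 2 ^ 2) set)) =
    {g \<in> carrier PGL2. pdeg (inv\<^bsub>PGL2\<^esub> h \<otimes>\<^bsub>PGL2\<^esub> g \<otimes>\<^bsub>PGL2\<^esub> h) = 0}"
  using h
proof (rule PGL2_cases)
  fix H :: "'a poly ^ 2 ^ 2" assume H: "det H dvd 1" "h = proj H"
  have "tree_act g ` fixed_set (conj_act PGL2 h alpha) = fixed_set (conj_act PGL2 h alpha) \<longleftrightarrow>
      pdeg (inv\<^bsub>PGL2\<^esub> h \<otimes>\<^bsub>PGL2\<^esub> g \<otimes>\<^bsub>PGL2\<^esub> h) = 0" if "g \<in> carrier PGL2" for g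
    using that
  proof (rule PGL2_cases)
    fix A :: "'a poly ^ 2 ^ 2" assume A: "det A dvd 1" "g = proj A"
    have AH: "det (A ** H) dvd 1" using A H by (simp add: det_mult_dvd_1)
    have "tree_act g (point (vertex (emb H))) = point (vertex (emb (A ** H)))"
      using A by (simp add: tree_act_def affine_ext_point vertex_act_proj emb_mult)
    then have "tree_act g ` fixed_set (conj_act PGL2 h alpha) = fixed_set (conj_act PGL2 h alpha) \<longleftrightarrow>
        vertex (emb H) = vertex (emb (A ** H))"
      using H by (auto simp: conj_act_alpha fixed_set_half_turn)
    also have "\<dots> \<longleftrightarrow> mdeg (adj2 H ** (A ** H)) = 0" by (rule vertex_emb_eq_iff[OF H(1) AH])
    finally show ?thesis
      using A H by (simp add: proj_inv proj_mult det_mult_dvd_1 pdeg_proj matrix_mul_assoc)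
  qed
  then show ?thesis unfolding fixed_set_stabiliser_def stabilizer_def by blast
qed

lemma closures_disjoint_iff:
  assumes g: "g \<in> carrier PGL2" and h: "h \<in> carrier PGL2"
  shows "(cone_topology bt_edges closure_of (Inl ` fixed_set (conj_act PGL2 g (alpha :: ('a poly ^ 2 ^ 2) set)))) \<inter>
      (cone_topology bt_edges closure_of (Inl ` fixed_set (conj_act PGL2 h alpha))) = {} \<longleftrightarrow>
      pdeg (inv\<^bsub>PGL2\<^esub> g \<otimes>\<^bsub>PGL2\<^esub> h) \<noteq> 0"
proof -
  obtain A :: "'a poly ^ 2 ^ 2" where A: "det A dvd 1" "g = proj A" by (rule PGL2_cases[OF g])
  obtain B :: "'a poly ^ 2 ^ 2" where B: "det B dvd 1" "h = proj B" by (rule PGL2_cases[OF h])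
  note nz = det_emb_unit(1)[OF A(1)] det_emb_unit(1)[OF B(1)]
  have p: "pdeg (inv\<^bsub>PGL2\<^esub> g \<otimes>\<^bsub>PGL2\<^esub> h) = mdeg (adj2 A ** B)"
    using A B by (simp add: proj_inv proj_mult det_mult_dvd_1 pdeg_proj)
  have F: "vertex (emb A) \<in> Field bt_edges" "vertex (emb B) \<in> Field bt_edges"
    unfolding Field_bt_edges using nz by blast+
  have fs: "fixed_set (conj_act PGL2 g alpha) = {point (vertex (emb A))}"
    "fixed_set (conj_act PGL2 h alpha) = {point (vertex (emb B))}"
    using A B by (simp_all add: conj_act_alpha fixed_set_half_turn)
  show ?thesis unfolding p fs
  proof
    assume "mdeg (adj2 A ** B) \<noteq> 0"
    then have "lat_dist (emb A) (emb B) \<noteq> 0"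
      using vertex_emb_eq_iff[OF A(1) B(1)] vertex_eq_iff[OF nz] by simp
    then have "1 \<le> lat_dist (emb A) (emb B)" using lat_dist_nonneg[OF nz] by linarith
    then have "1 \<le> \<bar>real_of_int (vdist (emb A) (vertex (emb A))) - real_of_int (vdist (emb A) (vertex (emb B)))\<bar>"
      using nz by (simp add: vdist_vertex)
    then show "(cone_topology bt_edges closure_of (Inl ` {point (vertex (emb A))})) \<inter>
      (cone_topology bt_edges closure_of (Inl ` {point (vertex (emb B))})) = {}"
      by (rule tree.closure_of_points_disjoint[OF F lipschitz_vdist[OF nz(1)]])
  next
    assume *: "(cone_topology bt_edges closure_of (Inl ` {point (vertex (emb A))})) \<inter>
      (cone_topology bt_edges closure_of (Inl ` {point (vertex (emb B))})) = {}"
    have "vertex (emb A) \<noteq> vertex (emb B)"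
    proof
      assume "vertex (emb A) = vertex (emb B)"
      then show False using * tree.closure_of_point[OF F(1)] by auto
    qed
    then show "mdeg (adj2 A ** B) \<noteq> 0" using vertex_emb_eq_iff[OF A(1) B(1)] by simp
  qed
qed

text \<open>
  An element that commutes with \<open>alpha\<close> preserves its fixed set, the base vertex, and the stabiliser
  of that vertex consists of the constant matrices.
\<close>

lemma centraliser_alpha:
  assumes "z \<in> centraliser PGL2 (alpha :: ('a poly ^ 2 ^ 2) set)"
  shows "z \<in> carrier PGL2 \<and> pdeg z = 0"
proof -
  have z: "z \<in> carrier PGL2" "z \<otimes>\<^bsub>PGL2\<^esub> alpha = alpha \<otimes>\<^bsub>PGL2\<^esub> z"
    using assms by (auto simp: centraliser_def)
  obtain A :: "'a poly ^ 2 ^ 2" where A: "det A dvd 1" "z = proj A" by (rule PGL2_cases[OF z(1)])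
  have "proj (half_turn A) = alpha"
    using z A conj_act_alpha[OF A(1)] by (simp add: conj_act_def PGL.m_assoc PGL.r_inv)
  moreover have "proj (half_turn (mat 1)) = (alpha :: ('a poly ^ 2 ^ 2) set)"
    by (simp add: half_turn_def alpha_def)
  ultimately have "{point (vertex (emb A))} = {point (vertex (emb (mat 1 :: 'a poly ^ 2 ^ 2)))}"
    using fixed_set_half_turn[OF A(1)] fixed_set_half_turn[of "mat 1"] by simp
  then have "vertex (emb (mat 1 :: 'a poly ^ 2 ^ 2)) = vertex (emb A)" by simp
  then have "mdeg A = 0" using vertex_emb_eq_iff[of "mat 1" A] A by simp
  then show ?thesis using A z by (simp add: pdeg_proj)
qed

end

section \<open>Translation lengths\<close>

lemma coeff_mult_top:
  fixes p r :: "'a::comm_semiring_0 poly"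
  assumes "degree p \<le> m" "degree r \<le> n"
  shows "coeff (p * r) (m + n) = coeff p m * coeff r n"
proof -
  have "coeff p i * coeff r (m + n - i) = 0" if "i \<noteq> m" for i
    using that assms by (cases "i < m") (simp_all add: coeff_eq_0)
  then have "coeff (p * r) (m + n) = (\<Sum>i\<in>{m}. coeff p i * coeff r (m + n - i))"
    unfolding coeff_mult by (intro sum.mono_neutral_right) auto
  then show ?thesis by simp
qed

text \<open>
  Powers of the form \<open>2\<^sup>k\<close> suffice for the limiting argument, and for them the trace is easy to
  follow: \<open>tr (N\<^sup>2) = (tr N)\<^sup>2 - 2 det N\<close>, so squaring doubles its degree.
\<close>

lemma vertex_act_funpow_vertex:
  assumes "det M dvd 1"
  shows "\<exists>N. det N dvd 1 \<and> (\<forall>B. (vertex_act (proj M) ^^ (2 ^ k)) (vertex B) = vertex (emb N ** B)) \<and>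
     (0 < degree (trace M) \<longrightarrow> degree (trace N) = 2 ^ k * degree (trace M))"
proof (induction k)
  case 0
  show ?case by (rule exI[of _ M]) (simp add: assms vertex_act_proj)
next
  case (Suc k)
  then obtain N where N: "det N dvd 1" "\<forall>B. (vertex_act (proj M) ^^ (2 ^ k)) (vertex B) = vertex (emb N ** B)"
    "0 < degree (trace M) \<longrightarrow> degree (trace N) = 2 ^ k * degree (trace M)" by (elim exE conjE)
  have "(vertex_act (proj M) ^^ (2 ^ Suc k)) (vertex B) = vertex (emb (N ** N) ** B)" for B
    by (simp add: mult_2 funpow_add N(2)[rule_format] emb_mult matrix_mul_assoc)
  moreover have "det (N ** N) dvd 1" using N by (simp add: det_mult_dvd_1)
  moreover have "degree (trace (N ** N)) = 2 ^ Suc k * degree (trace M)" if pos: "0 < degree (trace M)"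
  proof -
    have tr: "trace (N ** N) = trace N * trace N + (- (2 * det N))"
      by (cases N rule: mat2_cases) (simp add: algebra_simps)
    have pos': "0 < degree (trace N)" using N(3) pos by simp
    have "degree (- (2 * det N)) \<le> degree (2 :: 'a poly) + degree (det N)"
      using degree_mult_le[of 2 "det N"] by simp
    then have "degree (- (2 * det N)) = 0" using unit_poly[OF N(1)] by simp
    moreover have "degree (trace N * trace N) = 2 * degree (trace N)"
      using pos' by (subst degree_mult_eq) auto
    ultimately have "degree (trace (N ** N)) = 2 * degree (trace N)"
      unfolding tr using pos' by (subst degree_add_eq_left) auto
    then show ?thesis using N(3) pos by simp
  qed
  ultimately show ?case by (intro exI[of _ "N ** N"] conjI allI impI)
qed

text \<open>
  A point inside an edge is compared with an end \<open>u\<close> of the edge.  The \<open>2\<^sup>k\<close>-th power moves \<open>u\<close> by at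
  least \<open>2\<^sup>k\<close> times the asserted bound, the comparison costs at most \<open>2\<close>, and dividing by \<open>2\<^sup>k\<close> removes
  this error in the limit.
\<close>

lemma tree_dist_displacement_ge:
  assumes M: "det M dvd 1" and x: "x \<in> bt_tree" and pos: "0 < degree (trace M)"
  shows "2 * real (degree (trace M)) \<le> tree_dist bt_edges x (tree_act (proj M) x)"
proof -
  obtain u v where uv: "(u, v) \<in> bt_edges" and x: "x \<in> segment u v" using x by (auto simp: realisation_def)
  from uv obtain B C where B: "det B \<noteq> 0" and C: "det C \<noteq> 0" and eq: "u = vertex B" "v = vertex C"
    and 1: "lat_dist B C = 1" by (rule edge_cases)
  let ?f = "\<lambda>v. real_of_int (vdist B v)" and ?d = "tree_dist bt_edges x (tree_act (proj M) x)"
  let ?L = "2 * real (degree (trace M))"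
  have xs: "0 \<le> x u" "0 \<le> x v" "x u + x v = 1" using x by (auto simp: segment_def)
  have "2 ^ k * (?L - ?d) \<le> 2" for k :: nat
  proof -
    obtain N where N: "det N dvd 1" "\<forall>B. (vertex_act (proj M) ^^ (2 ^ k)) (vertex B) = vertex (emb N ** B)"
      "0 < degree (trace M) \<longrightarrow> degree (trace N) = 2 ^ k * degree (trace M)"
      using vertex_act_funpow_vertex[OF M, of k] by (elim exE conjE)
    have degN: "degree (trace N) = 2 ^ k * degree (trace M)" using N(3) pos by simp
    note nz = det_emb_unit[OF N(1)]
    let ?\<phi> = "vertex_act (proj M) ^^ (2 ^ k)"
    have nzB: "det (emb N ** B) \<noteq> 0" using B nz by (simp add: det_mul)
    have "trace (emb N) \<noteq> 0" using degN pos by (auto simp: trace_emb)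
    then have "2 * int (degree (trace N)) \<le> lat_dist B (emb N ** B)"
      using lat_dist_trace[of "emb N" B] nz B by (simp add: trace_emb subdegree_poly_emb)
    also have "lat_dist B (emb N ** B) = vdist B (?\<phi> u)"
      using B nzB by (simp add: eq N(2)[rule_format] vdist_vertex)
    finally have "real_of_int (2 * int (degree (trace N))) \<le> ?f (?\<phi> u)" by (rule iffD2[OF of_int_le_iff])
    then have fu: "2 ^ k * ?L \<le> ?f (?\<phi> u)" by (simp add: degN mult_ac)
    have pow: "((vertex_act (proj M) ^^ n) u, (vertex_act (proj M) ^^ n) v) \<in> bt_edges" for n
      using uv by (induction n) (auto intro: vertex_act_edge[OF M])
    have fv: "2 ^ k * ?L - 1 \<le> ?f (?\<phi> v)"
      using lipschitz_vdist[OF B] pow[of "2 ^ k"] fu unfolding tree.lipschitz_def by (smt (verit))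
    have "\<bar>bary_ext ?f x - bary_ext (?f \<circ> ?\<phi>) x\<bar> \<le> (2 ^ k :: nat) * tree_dist bt_edges x (affine_ext (vertex_act (proj M)) x)"
      by (rule tree.displacement_ge[OF vertex_act_edge[OF M] lipschitz_vdist[OF B] uv x])
    then have d: "bary_ext (?f \<circ> ?\<phi>) x - bary_ext ?f x \<le> 2 ^ k * ?d" by (simp add: tree_act_def)
    have ne: "u \<noteq> v" using tree.irrefl[OF uv] .
    have "bary_ext ?f x = x v" using B C 1 by (simp add: bary_ext_segment[OF x ne]) (simp add: eq vdist_vertex)
    moreover have "bary_ext (?f \<circ> ?\<phi>) x \<ge> 2 ^ k * ?L - 1"
    proof -
      have "x u * (2 ^ k * ?L - 1) + x v * (2 ^ k * ?L - 1) \<le> x u * ?f (?\<phi> u) + x v * ?f (?\<phi> v)"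
        using xs fu fv by (intro add_mono mult_left_mono) auto
      moreover have "x u * (2 ^ k * ?L - 1) + x v * (2 ^ k * ?L - 1) = 2 ^ k * ?L - 1"
        using xs by (simp add: distrib_right[symmetric])
      ultimately show ?thesis by (simp add: bary_ext_segment[OF x ne])
    qed
    ultimately have "2 ^ k * ?L - 1 - 1 \<le> 2 ^ k * ?d" using d xs by linarith
    then show ?thesis by (simp add: algebra_simps)
  qed
  show ?thesis
  proof (rule ccontr)
    assume "\<not> ?thesis"
    then have "0 < ?L - ?d" by simp
    then obtain k :: nat where "2 / (?L - ?d) < 2 ^ k" using real_arch_pow[of 2] by auto
    then have "2 < 2 ^ k * (?L - ?d)" using \<open>0 < ?L - ?d\<close> by (simp add: field_simps)
    then show False using \<open>2 ^ k * (?L - ?d) \<le> 2\<close> by simp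
  qed
qed

lemma tree_dist_vertices_le:
  assumes "det A \<noteq> 0" "det B \<noteq> 0"
  shows "tree_dist bt_edges (point (vertex A)) (point (vertex B)) \<le> lat_dist A B"
  using tree.tree_dist_path[OF path_exists[OF assms]] lat_dist_nonneg[OF assms] by simp

context anisotropic
begin

text \<open>
  The matrix of top coefficients has determinant \<open>0\<close> since the determinant is constant, so it has the
  form \<open>u v\<^sup>T\<close>, and the sum of its squared entries is \<open>|u|\<^sup>2 |v|\<^sup>2\<close>, which is nonzero by anisotropy.
\<close>

lemma degree_sum_squares:
  fixes a b c d :: "'a poly"
  assumes det: "a * d - b * c dvd 1" and n: "n = mdeg (mat2 a b c d)" "0 < n"
  shows "degree (a * a + b * b + c * c + d * d) = 2 * n"
proof -
  have le: "degree a \<le> n" "degree b \<le> n" "degree c \<le> n" "degree d \<le> n"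
    using mdeg_nth[of "mat2 a b c d"] unfolding n(1) by (metis mat2_nth)+
  note cf = coeff_mult_top[where m = n and n = n]
  let ?a = "coeff a n" and ?b = "coeff b n" and ?c = "coeff c n" and ?d = "coeff d n"
  have "coeff (a * d - b * c) (n + n) = 0"
    using unit_poly[OF det] n by (intro coeff_eq_0) simp
  then have sing: "?a * ?d = ?b * ?c" using le by (simp add: cf)
  have nz: "?a \<noteq> 0 \<or> ?b \<noteq> 0 \<or> ?c \<noteq> 0 \<or> ?d \<noteq> 0"
  proof -
    have "n \<in> {degree a, degree b, degree c, degree d}"
      unfolding n(1) mdeg_def using Max_in[of "{degree a, degree b, degree c, degree d}"] by simp
    moreover have "coeff p n \<noteq> 0" if "n = degree p" for p :: "'a poly" using that n(2) by auto
    ultimately show ?thesis by blast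
  qed
  have "?a * ?a + ?b * ?b + ?c * ?c + ?d * ?d \<noteq> 0"
  proof
    assume 0: "?a * ?a + ?b * ?b + ?c * ?c + ?d * ?d = 0"
    have "(?a * ?a + ?b * ?b) * (?a * ?a + ?c * ?c) =
        ?a * ?a * (?a * ?a + ?b * ?b + ?c * ?c) + (?b * ?c) * (?b * ?c)"
      by (simp add: algebra_simps)
    also have "\<dots> = ?a * ?a * (?a * ?a + ?b * ?b + ?c * ?c + ?d * ?d)"
      unfolding sing[symmetric] by (simp add: algebra_simps)
    finally have "(?a * ?a + ?b * ?b) * (?a * ?a + ?c * ?c) = 0" using 0 by simp
    then have a: "?a = 0" by (auto simp: aniso_iff)
    then have "?b = 0 \<or> ?c = 0" using sing by simp
    then have "?b = 0 \<and> ?c = 0 \<and> ?d = 0" using 0 a by (auto simp: aniso_iff)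
    then show False using nz a by simp
  qed
  then have "coeff (a * a + b * b + c * c + d * d) (n + n) \<noteq> 0" using le by (simp add: cf)
  then have "n + n \<le> degree (a * a + b * b + c * c + d * d)" by (rule le_degree)
  moreover have "degree (a * a + b * b + c * c + d * d) \<le> n + n"
    by (intro degree_add_le order_trans[OF degree_mult_le] add_mono le)
  ultimately show ?thesis by simp
qed

text \<open>
  With \<open>X = adj2 A ** B\<close>, the trace of the product is \<open>-(a\<^sup>2 + b\<^sup>2 + c\<^sup>2 + d\<^sup>2)\<close> for the entries of \<open>X\<close>,
  which gives the lower bound.  The vertex fixed by the first factor attains it: the product moves
  this vertex by twice its distance from the vertex fixed by the second factor.
\<close>

lemma translation_length_half_turns:
  fixes A B :: "'a poly ^ 2 ^ 2"
  assumes A: "det A dvd 1" and B: "det B dvd 1"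
  shows "translation_length (proj (half_turn B ** half_turn A)) = 4 * real (mdeg (adj2 A ** B))"
proof -
  define M where "M = half_turn B ** half_turn A"
  define X where "X = adj2 A ** B"
  have M: "det M dvd 1" using A B by (simp add: M_def det_mult_dvd_1 det_half_turn)
  have X: "det X dvd 1" using A B by (simp add: X_def det_mult_dvd_1)
  let ?S = "(\<lambda>x. tree_dist bt_edges x (tree_act (proj M) x)) ` bt_tree"
  note nzA = det_emb_unit(1)[OF A] and nzM = det_emb_unit(1)[OF M]
  have real_act: "tree_act (proj M) x \<in> bt_tree" if x: "x \<in> bt_tree" for x :: "('a fls ^ 2) set set \<Rightarrow> real"
  proof -
    obtain u v where "(u, v) \<in> bt_edges" "x \<in> segment u v" using x by (auto simp: realisation_def)
    then show ?thesis unfolding tree_act_def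
      using tree.affine_ext_realisation(2) vertex_act_edge[OF M] by blast
  qed
  have nonneg: "0 \<le> s" if "s \<in> ?S" for s using that tree.tree_dist_nonneg real_act by auto
  let ?p = "point (vertex (emb A))"
  have p: "?p \<in> bt_tree"
    using tree.point_in_realisation[of "vertex (emb A)"] nzA unfolding Field_bt_edges by blast
  have ge: "4 * real (mdeg X) \<le> s" if s: "s \<in> ?S" for s
  proof (cases "mdeg X = 0")
    case False
    obtain a b c d where Xm: "X = mat2 a b c d" by (rule mat2_cases)
    have "trace M = trace (B ** (J ** adj2 B ** half_turn A))"
      by (simp add: M_def half_turn_def matrix_mul_assoc)
    also have "\<dots> = trace ((J ** adj2 B ** half_turn A) ** B)" by (rule trace_mul_sym)
    also have "(J ** adj2 B ** half_turn A) ** B = (J ** adj2 X) ** (J ** X)"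
      by (simp add: half_turn_def X_def adj2_mult matrix_mul_assoc)
    also have "trace \<dots> = - (a * a + b * b + c * c + d * d)"
      by (simp add: Xm J_def)
    finally have "degree (trace M) = degree (a * a + b * b + c * c + d * d)" by (simp only: degree_minus)
    also have "\<dots> = 2 * mdeg X"
      using X False by (intro degree_sum_squares) (auto simp: Xm)
    finally have "degree (trace M) = 2 * mdeg X" .
    then show ?thesis using tree_dist_displacement_ge[OF M] s False by auto
  qed (use nonneg[OF s] in simp)
  have "tree_dist bt_edges ?p (tree_act (proj M) ?p) \<le> 4 * real (mdeg X)"
  proof -
    have nz: "det (emb (M ** A)) \<noteq> 0" using A M by (intro det_emb_unit(1)) (simp add: det_mult_dvd_1)
    have act: "tree_act (proj M) ?p = point (vertex (emb (M ** A)))"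
      using M by (simp add: tree_act_def affine_ext_point vertex_act_proj emb_mult)
    have "lat_dist (emb A) (emb (M ** A)) = disp (emb (adj2 A ** (M ** A)))"
      by (simp add: lat_dist_def emb_mult emb_adj2)
    also have "\<dots> = 2 * int (mdeg (adj2 A ** (M ** A)))"
      using A M by (intro disp_emb) (simp add: det_mult_dvd_1)
    also have "adj2 A ** (M ** A) = X ** (J ** adj2 X) ** (J ** (adj2 A ** A))"
      by (simp add: M_def half_turn_def X_def adj2_mult matrix_mul_assoc)
    also have "\<dots> = mat (det A) ** (X ** (J ** adj2 X) ** J)"
      by (simp add: adj2_left scalar_commute[of J] scalar_mult_assoc)
    also have "mdeg \<dots> = mdeg (X ** (J ** adj2 X) ** J)" by (rule mdeg_scalar_mult[OF A])
    finally have "lat_dist (emb A) (emb (M ** A)) = 2 * int (mdeg (X ** (J ** adj2 X) ** J))" .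
    moreover have "mdeg (X ** (J ** adj2 X) ** J) \<le> 2 * mdeg X"
      using mdeg_mult_le[of "X ** (J ** adj2 X)" J] mdeg_mult_le[of X "J ** adj2 X"] mdeg_mult_le[of J "adj2 X"]
      by simp
    ultimately have "lat_dist (emb A) (emb (M ** A)) \<le> 4 * int (mdeg X)" by simp
    then have "real_of_int (lat_dist (emb A) (emb (M ** A))) \<le> real_of_int (4 * int (mdeg X))" by (rule iffD2[OF of_int_le_iff])
    then show ?thesis unfolding act using tree_dist_vertices_le[OF nzA nz] by simp
  qed
  moreover have "translation_length (proj M) \<le> tree_dist bt_edges ?p (tree_act (proj M) ?p)"
    unfolding translation_length_def by (rule cINF_lower[OF bdd_belowI[of _ 0] p]) (rule nonneg)
  moreover have "4 * real (mdeg X) \<le> translation_length (proj M)"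
    unfolding translation_length_def by (rule cINF_greatest) (use p ge in auto)
  ultimately show ?thesis by (simp add: M_def X_def)
qed

lemma translation_length_product:
  assumes g: "g \<in> carrier PGL2" and h: "h \<in> carrier PGL2"
  shows "translation_length (conj_act PGL2 h alpha \<otimes>\<^bsub>PGL2\<^esub> conj_act PGL2 g (alpha :: ('a poly ^ 2 ^ 2) set))
     = 4 * real (pdeg (inv\<^bsub>PGL2\<^esub> g \<otimes>\<^bsub>PGL2\<^esub> h))"
proof -
  obtain A :: "'a poly ^ 2 ^ 2" where A: "det A dvd 1" "g = proj A" by (rule PGL2_cases[OF g])
  obtain B :: "'a poly ^ 2 ^ 2" where B: "det B dvd 1" "h = proj B" by (rule PGL2_cases[OF h])
  show ?thesis using A B translation_length_half_turns[OF A(1) B(1)]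
    by (simp add: conj_act_alpha proj_mult det_half_turn proj_inv pdeg_proj)
qed

end

section \<open>Counting matrices by degree\<close>

lemma card_degree_le:
  "finite {p :: 'a::{finite, field} poly. degree p \<le> n} \<and>
   card {p :: 'a poly. degree p \<le> n} = CARD('a) ^ Suc n"
proof (induction n)
  case 0
  have "{p :: 'a poly. degree p \<le> 0} = (\<lambda>a. [:a:]) ` UNIV"
    by (auto elim: degree_eq_zeroE)
  then show ?case by (simp add: card_image inj_on_def)
next
  case (Suc n)
  have "{p :: 'a poly. degree p \<le> Suc n} = (\<lambda>(a, p). pCons a p) ` (UNIV \<times> {p. degree p \<le> n})"
  proof (rule subset_antisym; rule subsetI)
    fix p :: "'a poly" assume "p \<in> {p. degree p \<le> Suc n}"
    moreover obtain a r where "p = pCons a r" by (rule pCons_cases)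
    ultimately have "p = (\<lambda>(a, p). pCons a p) (a, r)" "degree r \<le> n" by (auto split: if_splits)
    then show "p \<in> (\<lambda>(a, p). pCons a p) ` (UNIV \<times> {p. degree p \<le> n})" by blast
  next
    fix p :: "'a poly" assume "p \<in> (\<lambda>(a, p). pCons a p) ` (UNIV \<times> {p. degree p \<le> n})"
    then show "p \<in> {p. degree p \<le> Suc n}" by auto
  qed
  moreover have "inj_on (\<lambda>(a, p). pCons a p) (UNIV \<times> {p :: 'a poly. degree p \<le> n})"
    by (auto simp: inj_on_def)
  ultimately show ?case using Suc by (simp add: card_image card_cartesian_product)
qed

type_synonym 'a row = "'a poly \<times> 'a poly"

definition row_deg :: "'a::field row \<Rightarrow> nat" where
  "row_deg r = max (degree (fst r)) (degree (snd r))"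

definition row_det :: "'a::field row \<Rightarrow> 'a row \<Rightarrow> 'a poly" where
  "row_det r s = fst r * snd s - snd r * fst s"

text \<open>
  The pairs of rows of the matrices with unit determinant, sorted by the degrees of the two rows.
\<close>

definition row_pairs :: "nat \<Rightarrow> nat \<Rightarrow> ('a::field row \<times> 'a row) set" where
  "row_pairs N M = {(r, s). row_deg r = N \<and> row_deg s = M \<and> row_det r s dvd 1}"

lemma finite_row_deg_le: "finite {r :: 'a::{finite, field} row. row_deg r \<le> n}"
proof -
  have "{r :: 'a row. row_deg r \<le> n} = {p. degree p \<le> n} \<times> {p. degree p \<le> n}"
    by (auto simp: row_deg_def)
  then show ?thesis using card_degree_le[of n, where 'a = 'a] by simp
qed

lemma finite_row_pairs: "finite (row_pairs N M :: ('a::{finite, field} row \<times> 'a row) set)"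
  by (rule finite_subset[OF _ finite_cartesian_product[OF finite_row_deg_le[of N] finite_row_deg_le[of M]]])
    (auto simp: row_pairs_def)

lemma row_pairsD: "x \<in> row_pairs N M \<Longrightarrow> row_deg (fst x) = N \<and> row_deg (snd x) = M"
  by (auto simp: row_pairs_def)

lemma card_row_pairs_sym: "card (row_pairs N M :: ('a::field row \<times> 'a row) set) = card (row_pairs M N :: ('a row \<times> 'a row) set)"
proof -
  have "row_det s r = - row_det r s" for r s :: "'a row" by (simp add: row_det_def)
  then have "row_det s r dvd 1 \<longleftrightarrow> row_det r s dvd 1" for r s :: "'a row" by (metis minus_dvd_iff)
  then have "prod.swap ` row_pairs M N = (row_pairs N M :: ('a row \<times> 'a row) set)"
    by (auto simp: row_pairs_def image_iff)
  moreover have "card (prod.swap ` row_pairs M N :: ('a row \<times> 'a row) set) = card (row_pairs M N :: ('a row \<times> 'a row) set)"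
    by (rule card_image) simp
  ultimately show ?thesis by simp
qed

text \<open>
  The coefficients of degree \<open>n\<close>, the leading ones when the row has degree \<open>n\<close>.
\<close>

definition tops :: "nat \<Rightarrow> 'a::zero row \<Rightarrow> 'a \<times> 'a" where
  "tops n r = (coeff (fst r) n, coeff (snd r) n)"

lemma tops_nonzero:
  assumes "row_deg r = n" "r \<noteq> (0, 0)" shows "tops n r \<noteq> (0, 0)"
proof (cases "degree (fst r) = n")
  case True
  show ?thesis
  proof
    assume "tops n r = (0, 0)"
    then have "fst r = 0" "coeff (snd r) n = 0" using True by (auto simp: tops_def)
    moreover from this have "n = 0" using True by simp
    moreover have "degree (snd r) = 0" using assms \<open>n = 0\<close> by (simp add: row_deg_def)
    ultimately show False using assms by (metis leading_coeff_0_iff prod.collapse)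
  qed
next
  case False
  then have 2: "degree (snd r) = n" "degree (fst r) < n" using assms by (auto simp: row_deg_def max_def split: if_splits)
  then have "snd r \<noteq> 0" by auto
  then show ?thesis using 2 by (auto simp: tops_def)
qed

lemma row_deg_less_iff:
  assumes "0 < n" shows "row_deg r < n \<longleftrightarrow> row_deg r \<le> n \<and> tops n r = (0, 0)"
proof
  assume "row_deg r < n"
  then show "row_deg r \<le> n \<and> tops n r = (0, 0)" by (auto simp: row_deg_def tops_def coeff_eq_0)
next
  assume *: "row_deg r \<le> n \<and> tops n r = (0, 0)"
  show "row_deg r < n"
  proof (rule ccontr)
    assume "\<not> row_deg r < n"
    then have "row_deg r = n" using * by simp
    moreover have "r \<noteq> (0, 0)" using \<open>row_deg r = n\<close> assms by (auto simp: row_deg_def)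
    ultimately show False using tops_nonzero[of r n] * by simp
  qed
qed

lemma row_deg_eqI: "row_deg r \<le> n \<Longrightarrow> tops n r \<noteq> (0, 0) \<Longrightarrow> row_deg r = n"
proof -
  assume *: "row_deg r \<le> n" "tops n r \<noteq> (0, 0)"
  show "row_deg r = n"
  proof (rule ccontr)
    assume "row_deg r \<noteq> n"
    then have "degree (fst r) < n" "degree (snd r) < n" using * by (auto simp: row_deg_def)
    then show False using * by (simp add: tops_def coeff_eq_0)
  qed
qed

definition addrow :: "'a::field \<Rightarrow> nat \<Rightarrow> 'a row \<Rightarrow> 'a row \<Rightarrow> 'a row" where
  "addrow l k s r = (fst r + monom l k * fst s, snd r + monom l k * snd s)"

lemma row_det_addrow [simp]: "row_det (addrow l k s r) s = row_det r s"
  by (simp add: row_det_def addrow_def algebra_simps)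

lemma addrow_uminus [simp]: "addrow l k s (addrow (- l) k s r) = r" "addrow (- l) k s (addrow l k s r) = r"
  by (simp_all add: addrow_def prod_eq_iff) (simp_all add: algebra_simps flip: minus_monom)

lemma addrow_props:
  assumes "row_deg s \<le> M" "M \<le> N" "row_deg r \<le> N"
  shows "row_deg (addrow l (N - M) s r) \<le> N"
    and "tops N (addrow l (N - M) s r) =
      (fst (tops N r) + l * fst (tops M s), snd (tops N r) + l * snd (tops M s))"
proof -
  have d: "degree (monom l (N - M) * p) \<le> N" if "degree p \<le> M" for p
    using that assms(2) degree_mult_le[of "monom l (N - M)" p] degree_monom_le[of l "N - M"] by linarith
  then show "row_deg (addrow l (N - M) s r) \<le> N"
    using assms by (auto simp: row_deg_def addrow_def intro!: degree_add_le)
  show "tops N (addrow l (N - M) s r) =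
      (fst (tops N r) + l * fst (tops M s), snd (tops N r) + l * snd (tops M s))"
    using assms(2) by (simp add: tops_def addrow_def coeff_monom_mult)
qed

lemma row_det_nonzero: "row_det r s dvd 1 \<Longrightarrow> r \<noteq> (0, 0) \<and> s \<noteq> (0, 0)"
  by (auto simp: row_det_def)

text \<open>
  One step of the Euclidean algorithm: the top coefficients of the two rows are proportional because
  the determinant is constant, so subtracting a unique nonzero multiple \<open>l Y\<^sup>N\<^sup>-\<^sup>M\<close> of the second row
  from the first lowers the degree of the first.  Conversely \<open>l\<close> can be chosen freely.
\<close>

lemma card_row_pairs_rec:
  assumes "M \<le> N" "0 < N"
  shows "card (row_pairs N M :: ('a::{finite, field} row \<times> 'a row) set) =
    (CARD('a) - 1) * (\<Sum>N'<N. card (row_pairs N' M :: ('a row \<times> 'a row) set))"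
proof -
  let ?U = "\<Union>N'<N. row_pairs N' M :: ('a row \<times> 'a row) set"
  have U: "(r, s) \<in> ?U \<longleftrightarrow> row_deg r < N \<and> row_deg s = M \<and> row_det r s dvd 1" for r s :: "'a row"
    by (auto simp: row_pairs_def)
  let ?f = "\<lambda>(l :: 'a, r, s). (addrow l (N - M) s r, s)"
  have "bij_betw ?f ((UNIV - {0}) \<times> ?U) (row_pairs N M)"
  proof (rule bij_betwI')
    fix x y :: "'a \<times> 'a row \<times> 'a row" assume "x \<in> (UNIV - {0}) \<times> ?U" "y \<in> (UNIV - {0}) \<times> ?U"
    then obtain l r s l' r' s' where x: "x = (l, r, s)" "l \<noteq> 0" "(r, s) \<in> ?U"
      and y: "y = (l', r', s')" "l' \<noteq> 0" "(r', s') \<in> ?U" by (cases x; cases y) auto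
    show "?f x = ?f y \<longleftrightarrow> x = y"
    proof
      assume "?f x = ?f y"
      then have s: "s' = s" and eq: "addrow l (N - M) s r = addrow l' (N - M) s r'" by (auto simp: x y)
      have r: "row_deg r < N" "row_deg s = M" "row_det r s dvd 1" "row_deg r' < N" using x(3) y(3) unfolding U by auto
      have "tops N r = (0, 0)" "tops N r' = (0, 0)" using r assms(2) row_deg_less_iff by blast+
      then have "l * fst (tops M s) = l' * fst (tops M s)" "l * snd (tops M s) = l' * snd (tops M s)"
        using addrow_props(2)[OF _ assms(1), of s r l] addrow_props(2)[OF _ assms(1), of s r' l'] eq r by auto
      moreover have "tops M s \<noteq> (0, 0)" using r row_det_nonzero[of r s] by (intro tops_nonzero) auto
      ultimately have l: "l = l'" by (metis mult_cancel_right prod.collapse)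
      then have "r = r'" using eq by (metis addrow_uminus(2))
      with l s show "x = y" by (simp add: x y)
    qed simp
  next
    fix x :: "'a \<times> 'a row \<times> 'a row" assume "x \<in> (UNIV - {0}) \<times> ?U"
    then obtain l r s where x: "x = (l, r, s)" "l \<noteq> 0" "(r, s) \<in> ?U" by (cases x) auto
    have r: "row_deg r < N" "row_deg s = M" "row_det r s dvd 1" using x(3) unfolding U by auto
    have "tops M s \<noteq> (0, 0)" using r row_det_nonzero[of r s] by (intro tops_nonzero) auto
    moreover have "tops N r = (0, 0)" using r assms(2) row_deg_less_iff by blast
    ultimately have "tops N (addrow l (N - M) s r) \<noteq> (0, 0)"
      using addrow_props(2)[OF _ assms(1), of s r l] r x(2) by (auto simp: prod_eq_iff)
    then have "row_deg (addrow l (N - M) s r) = N"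
      using addrow_props(1)[OF _ assms(1), of s r l] r by (intro row_deg_eqI) auto
    then show "?f x \<in> row_pairs N M" using r by (simp add: x row_pairs_def)
  next
    fix y :: "'a row \<times> 'a row" assume "y \<in> row_pairs N M"
    then obtain r s where y: "y = (r, s)" and r: "row_deg r = N" "row_deg s = M" "row_det r s dvd 1"
      by (auto simp: row_pairs_def)
    have nz: "tops N r \<noteq> (0, 0)" "tops M s \<noteq> (0, 0)"
      using tops_nonzero[OF r(1)] tops_nonzero[OF r(2)] row_det_nonzero[OF r(3)] by simp_all
    have d: "degree (fst r) \<le> N" "degree (snd r) \<le> N" "degree (fst s) \<le> M" "degree (snd s) \<le> M"
      using r by (auto simp: row_deg_def)
    have "coeff (row_det r s) (N + M) = 0" using unit_poly[OF r(3)] assms(2) by (intro coeff_eq_0) simp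
    then have sing: "fst (tops N r) * snd (tops M s) = snd (tops N r) * fst (tops M s)"
      using d by (simp add: row_det_def tops_def coeff_mult_top)
    \<comment> \<open>The tops of \<open>r\<close> and \<open>s\<close> are proportional; \<open>l\<close> is their ratio, read off a nonzero coordinate.\<close>
    obtain l where l: "l \<noteq> 0" "fst (tops N r) = l * fst (tops M s)" "snd (tops N r) = l * snd (tops M s)"
    proof (cases "fst (tops M s) = 0")
      case True
      then have "snd (tops M s) \<noteq> 0" using nz(2) by (simp add: prod_eq_iff)
      then show ?thesis using that[of "snd (tops N r) / snd (tops M s)"] True sing nz(1) by (auto simp: prod_eq_iff)
    next
      case False
      then have "fst (tops N r) \<noteq> 0" using sing nz(1) by (auto simp: prod_eq_iff)
      then show ?thesis using that[of "fst (tops N r) / fst (tops M s)"] sing False by (simp add: field_simps)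
    qed
    let ?r = "addrow (- l) (N - M) s r"
    have "tops N ?r = (0, 0)" "row_deg ?r \<le> N"
      using addrow_props[OF _ assms(1), of s r "- l"] r l by auto
    then have "row_deg ?r < N" using row_deg_less_iff[OF assms(2)] by blast
    then have "(?r, s) \<in> ?U" unfolding U using r by simp
    moreover have "y = ?f (l, ?r, s)" by (simp add: y)
    ultimately show "\<exists>x\<in>(UNIV - {0}) \<times> ?U. y = ?f x" using l(1) by blast
  qed
  then have "card (row_pairs N M :: ('a row \<times> 'a row) set) = card ((UNIV - {0 :: 'a}) \<times> ?U)"
    by (simp add: bij_betw_same_card)
  also have "\<dots> = (CARD('a) - 1) * card ?U" by (simp add: card_cartesian_product card_Diff_singleton)
  also have "card ?U = (\<Sum>N'<N. card (row_pairs N' M :: ('a row \<times> 'a row) set))"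
    by (intro card_UN_disjoint) (auto simp: finite_row_pairs dest!: row_pairsD)
  finally show ?thesis .
qed

text \<open>
  Write \<open>T N = (\<Sum>M<N. c M N)\<close>.  The recursion says that \<open>c N N = (q - 1) T N\<close> and that
  \<open>c (N + 1) M = q c N M\<close> for \<open>M \<le> N\<close>, whence \<open>T (N + 1) = q (T N + c N N) = q\<^sup>2 T N\<close> for \<open>N \<ge> 1\<close>.
\<close>

lemma symmetric_recursion:
  fixes c :: "nat \<Rightarrow> nat \<Rightarrow> real" and q :: real
  assumes sym: "\<And>N M. c N M = c M N"
    and rec: "\<And>N M. M \<le> N \<Longrightarrow> 0 < N \<Longrightarrow> c N M = (q - 1) * (\<Sum>N'<N. c N' M)"
  shows "(\<Sum>M<Suc N. c M (Suc N)) = (q - 1) * q ^ (2 * N) * c 0 0"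
proof (induction N)
  case 0
  show ?case using sym[of 0 1] rec[of 0 1] by simp
next
  case (Suc N)
  let ?n = "Suc N"
  have "(\<Sum>M<Suc ?n. c M (Suc ?n)) = (\<Sum>M<Suc ?n. q * c ?n M)"
  proof (rule sum.cong[OF refl])
    fix M assume "M \<in> {..<Suc ?n}"
    then have M: "M \<le> ?n" by simp
    have "c M (Suc ?n) = (q - 1) * ((\<Sum>N'<?n. c N' M) + c ?n M)"
      using sym rec[of M "Suc ?n"] M by simp
    also have "\<dots> = (q - 1) * (\<Sum>N'<?n. c N' M) + (q - 1) * c ?n M" by (simp only: distrib_left)
    also have "(q - 1) * (\<Sum>N'<?n. c N' M) = c ?n M" using rec[OF M] by simp
    finally show "c M (Suc ?n) = q * c ?n M" by (simp add: algebra_simps)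
  qed
  also have "\<dots> = q * ((\<Sum>M<?n. c M ?n) + c ?n ?n)"
    using sym by (simp add: sum_distrib_left[symmetric] distrib_left)
  also have "c ?n ?n = (q - 1) * (\<Sum>M<?n. c M ?n)" using rec[of ?n ?n] by simp
  finally show ?case unfolding Suc by (simp add: algebra_simps power_add power2_eq_square)
qed

definition rows_of :: "'a poly ^ 2 ^ 2 \<Rightarrow> 'a row \<times> 'a row" where
  "rows_of H = ((H $ 1 $ 1, H $ 1 $ 2), (H $ 2 $ 1, H $ 2 $ 2))"

lemma mdeg_mat2: "mdeg (mat2 a b c d) = max (row_deg (a, b)) (row_deg (c, d))"
  by (simp add: mdeg_def row_deg_def)

lemma max_eq_cases: "{x. max (f x) (g x) = n \<and> P x} =
    {x. f x = n \<and> g x = n \<and> P x} \<union> ((\<Union>m<n. {x. f x = n \<and> g x = m \<and> P x}) \<union>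
      (\<Union>m<n. {x. f x = m \<and> g x = n \<and> P x}))" for n :: nat
  by (auto simp: max_def)

text \<open>
  A matrix of degree \<open>N = n + 1\<close> has both rows of degree \<open>N\<close> or exactly one of them.  In the notation of
  \<open>symmetric_recursion\<close> there are \<open>c N N + 2 T N = (q + 1) T N\<close> such matrices.
\<close>

lemma card_mdeg:
  shows "finite {H :: 'a::{finite, field} poly ^ 2 ^ 2. det H dvd 1 \<and> mdeg H = n}"
    and "real (card {H :: 'a poly ^ 2 ^ 2. det H dvd 1 \<and> mdeg H = Suc n}) =
      (real CARD('a) ^ 2 - 1) * real CARD('a) ^ (2 * n) * real (card {H :: 'a poly ^ 2 ^ 2. det H dvd 1 \<and> mdeg H = 0})"
proof -
  let ?S = "\<lambda>n. {H :: 'a poly ^ 2 ^ 2. det H dvd 1 \<and> mdeg H = n}"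
  let ?R = "row_pairs :: nat \<Rightarrow> nat \<Rightarrow> ('a row \<times> 'a row) set"
  define c where "c N M = real (card (?R N M))" for N M
  have q: "1 \<le> CARD('a)" by (simp add: Suc_leI)
  have inj: "inj rows_of" by (auto simp: inj_def rows_of_def mat2_eq_iff)
  have img: "rows_of ` ?S n = ?R n n \<union> ((\<Union>m<n. ?R n m) \<union> (\<Union>m<n. ?R m n))" for n
  proof -
    have "rows_of ` ?S n = {x. max (row_deg (fst x)) (row_deg (snd x)) = n \<and> row_det (fst x) (snd x) dvd 1}"
    proof (rule subset_antisym; rule subsetI)
      fix x :: "'a row \<times> 'a row" assume "x \<in> rows_of ` ?S n"
      then obtain H where H: "x = rows_of H" "det H dvd 1" "mdeg H = n" by blast
      obtain a b c d where Hm: "H = mat2 a b c d" by (rule mat2_cases)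
      show "x \<in> {x. max (row_deg (fst x)) (row_deg (snd x)) = n \<and> row_det (fst x) (snd x) dvd 1}"
        using H(2,3) by (simp add: H(1) Hm rows_of_def mdeg_mat2 row_det_def)
    next
      fix x :: "'a row \<times> 'a row" assume x: "x \<in> {x. max (row_deg (fst x)) (row_deg (snd x)) = n \<and> row_det (fst x) (snd x) dvd 1}"
      obtain a b c d :: "'a poly" where abcd: "x = ((a, b), (c, d))" by (metis surj_pair)
      have "x = rows_of (mat2 a b c d)" by (simp add: abcd rows_of_def)
      moreover have "mat2 a b c d \<in> ?S n" using x by (simp add: abcd mdeg_mat2 row_det_def)
      ultimately show "x \<in> rows_of ` ?S n" by blast
    qed
    also have "\<dots> = ?R n n \<union> ((\<Union>m<n. ?R n m) \<union> (\<Union>m<n. ?R m n))"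
      unfolding max_eq_cases row_pairs_def case_prod_beta ..
    finally show ?thesis .
  qed
  have "finite (rows_of ` ?S n)" for n unfolding img by (auto simp: finite_row_pairs)
  then show "finite (?S n)" for n by (rule finite_imageD) (rule inj_on_subset[OF inj subset_UNIV])
  have card: "card (?S n) = card (?R n n) + ((\<Sum>m<n. card (?R n m)) + (\<Sum>m<n. card (?R m n)))" for n
  proof -
    have "card (?S n) = card (rows_of ` ?S n)" by (rule card_image[symmetric], rule inj_on_subset[OF inj subset_UNIV])
    also have "\<dots> = card (?R n n) + card ((\<Union>m<n. ?R n m) \<union> (\<Union>m<n. ?R m n))"
      unfolding img by (intro card_Un_disjoint) (auto simp: finite_row_pairs dest!: row_pairsD)
    also have "card ((\<Union>m<n. ?R n m) \<union> (\<Union>m<n. ?R m n)) = card (\<Union>m<n. ?R n m) + card (\<Union>m<n. ?R m n)"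
      by (intro card_Un_disjoint) (auto simp: finite_row_pairs dest!: row_pairsD)
    also have "card (\<Union>m<n. ?R n m) = (\<Sum>m<n. card (?R n m))"
      by (intro card_UN_disjoint) (auto simp: finite_row_pairs dest!: row_pairsD)
    also have "card (\<Union>m<n. ?R m n) = (\<Sum>m<n. card (?R m n))"
      by (intro card_UN_disjoint) (auto simp: finite_row_pairs dest!: row_pairsD)
    finally show ?thesis .
  qed
  have sym: "c N M = c M N" for N M unfolding c_def by (metis card_row_pairs_sym)
  have rec: "c N M = (real CARD('a) - 1) * (\<Sum>N'<N. c N' M)" if "M \<le> N" "0 < N" for N M
    using q unfolding c_def card_row_pairs_rec[OF that] by (simp add: of_nat_diff)
  have T: "(\<Sum>i<Suc n. c i (Suc n)) = (real CARD('a) - 1) * real CARD('a) ^ (2 * n) * c 0 0"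
    by (rule symmetric_recursion[OF sym rec])
  have cards: "real (card (?S m)) = c m m + 2 * (\<Sum>i<m. c i m)" for m
    unfolding card using sym by (simp add: c_def)
  have "c (Suc n) (Suc n) = (real CARD('a) - 1) * (\<Sum>i<Suc n. c i (Suc n))" by (rule rec) auto
  then have "real (card (?S (Suc n))) = (real CARD('a) + 1) * (\<Sum>i<Suc n. c i (Suc n))"
    unfolding cards by (simp only: distrib_right left_diff_distrib)
  also have "\<dots> = (real CARD('a) ^ 2 - 1) * real CARD('a) ^ (2 * n) * c 0 0"
    unfolding T by (simp only: power2_eq_square) (simp add: algebra_simps)
  also have "c 0 0 = real (card (?S 0))" unfolding cards by simp
  finally show "real (card (?S (Suc n))) = (real CARD('a) ^ 2 - 1) * real CARD('a) ^ (2 * n) * real (card (?S 0))" .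
qed

text \<open>
  If \<open>a \<noteq> 0\<close>, the entry \<open>d\<close> is determined by the determinant; if \<open>a = 0\<close>, it is free.
\<close>

lemma card_mdeg_0:
  "card {H :: 'a::{finite, field} poly ^ 2 ^ 2. det H dvd 1 \<and> mdeg H = 0} =
    (CARD('a) - 1) * ((CARD('a) - 1) * (CARD('a) * (CARD('a) + 1)))"
proof -
  let ?q = "CARD('a)"
  let ?Q = "{(a, b, c, d). a * d - b * c \<noteq> (0 :: 'a)}"
  have "bij_betw (\<lambda>(a, b, c, d). mat2 [:a:] [:b:] [:c:] [:d:]) ?Q
      {H :: 'a poly ^ 2 ^ 2. det H dvd 1 \<and> mdeg H = 0}"
  proof (rule bij_betwI')
    fix H :: "'a poly ^ 2 ^ 2" assume H: "H \<in> {H. det H dvd 1 \<and> mdeg H = 0}"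
    have "\<exists>a. H $ i $ j = [:a:]" for i j
      using mdeg_nth[of H i j] H by (auto elim: degree_eq_zeroE)
    then obtain f where f: "\<And>i j. H $ i $ j = [:f i j:]" by metis
    have Hm: "H = mat2 [:f 1 1:] [:f 1 2:] [:f 2 1:] [:f 2 2:]" by (simp add: mat2_eq_iff f)
    then have D: "f 1 1 * f 2 2 - f 1 2 * f 2 1 \<noteq> 0" using H by (auto simp: is_unit_pCons_iff mult.commute)
    show "\<exists>x\<in>?Q. H = (case x of (a, b, c, d) \<Rightarrow> mat2 [:a:] [:b:] [:c:] [:d:])"
      by (rule bexI[of _ "(f 1 1, f 1 2, f 2 1, f 2 2)"])
        (use Hm D in \<open>simp_all only: case_prod_conv mem_Collect_eq not_False_eq_True\<close>)
  qed (auto simp: mdeg_def is_unit_pCons_iff mult.commute)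
  then have "card {H :: 'a poly ^ 2 ^ 2. det H dvd 1 \<and> mdeg H = 0} = card ?Q"
    by (simp add: bij_betw_same_card)
  also have "?Q = (\<lambda>(a, b, c, e). (a, b, c, (e + b * c) / a)) ` ((UNIV - {0}) \<times> UNIV \<times> UNIV \<times> (UNIV - {0}))
      \<union> {0} \<times> (UNIV - {0}) \<times> (UNIV - {0}) \<times> UNIV" (is "_ = ?f ` ?A \<union> ?B")
  proof (rule subset_antisym; rule subsetI)
    fix x assume x: "x \<in> ?Q"
    obtain a b c d where abcd: "x = (a, b, c, d)" by (metis surj_pair)
    show "x \<in> ?f ` ?A \<union> ?B"
    proof (cases "a = 0")
      case False
      then have "x = ?f (a, b, c, a * d - b * c)" "(a, b, c, a * d - b * c) \<in> ?A"
        using x by (auto simp: abcd)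
      then show ?thesis by blast
    qed (use x abcd in auto)
  qed auto
  also have "card (?f ` ?A \<union> ?B) = card (?f ` ?A) + card ?B"
    by (intro card_Un_disjoint) auto
  also have "card (?f ` ?A) = card ?A" by (intro card_image) (auto simp: inj_on_def)
  finally have "card {H :: 'a poly ^ 2 ^ 2. det H dvd 1 \<and> mdeg H = 0} = card ?A + card ?B" .
  moreover obtain p where "?q = Suc p" using zero_less_card_finite[where 'a = 'a] gr0_implies_Suc by blast
  ultimately show ?thesis
    by (simp add: card_cartesian_product card_Diff_singleton) (simp add: algebra_simps)
qed

section \<open>Matrices intertwining constant matrices\<close>

lemma finite_units: "finite {c :: 'a::{finite, field} poly. c dvd 1}"
  and card_units_le: "card {c :: 'a poly. c dvd 1} \<le> CARD('a)"
proof -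
  have sub: "{c :: 'a poly. c dvd 1} \<subseteq> {c. degree c \<le> 0}" using unit_poly by auto
  then show "finite {c :: 'a poly. c dvd 1}" using card_degree_le[of 0, where 'a = 'a] finite_subset by blast
  show "card {c :: 'a poly. c dvd 1} \<le> CARD('a)"
    using card_mono[OF _ sub] card_degree_le[of 0, where 'a = 'a] by simp
qed

text \<open>
  For given \<open>x\<close> this is an equation of degree at most \<open>2\<close> for \<open>y\<close>.  It can hold identically in \<open>y\<close> only
  if \<open>x\<close> divides the unit \<open>c\<close>, which leaves boundedly many \<open>x\<close>.
\<close>

lemma card_quadratic_values:
  fixes b1 b2 b3 c :: "'a::{finite, field} poly"
  assumes c: "c dvd 1"
  shows "finite {(x, y). degree x \<le> k \<and> degree y \<le> k \<and> b1 * x * x + b2 * x * y + b3 * y * y = c} \<and>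
    card {(x, y). degree x \<le> k \<and> degree y \<le> k \<and> b1 * x * x + b2 * x * y + b3 * y * y = c}
     \<le> (2 * CARD('a) + CARD('a) ^ 2) * CARD('a) ^ k"
proof -
  let ?q = "CARD('a)" and ?D = "{x :: 'a poly. degree x \<le> k}"
  let ?Y = "\<lambda>x. {y \<in> ?D. b1 * x * x + b2 * x * y + b3 * y * y = c}"
  have D: "finite ?D" "card ?D = ?q ^ Suc k" using card_degree_le[of k, where 'a = 'a] by auto
  have eq: "{(x, y). degree x \<le> k \<and> degree y \<le> k \<and> b1 * x * x + b2 * x * y + b3 * y * y = c} = Sigma ?D ?Y"
    by auto
  have Y: "card (?Y x) \<le> 2 + (if x dvd 1 then ?q ^ Suc k else 0)" for x
  proof (cases "[: b1 * x * x - c, b2 * x, b3 :] = 0")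
    case True
    then have "c = x * (b1 * x)" by (simp add: mult_ac)
    then have "x dvd 1" using c dvd_trans dvd_triv_left by metis
    moreover have "card (?Y x) \<le> card ?D" using D by (intro card_mono) auto
    ultimately show ?thesis using D(2) by simp
  next
    case False
    have "?Y x \<subseteq> {y. poly [: b1 * x * x - c, b2 * x, b3 :] y = 0}"
      by (auto simp: algebra_simps)
    then have "card (?Y x) \<le> card {y. poly [: b1 * x * x - c, b2 * x, b3 :] y = 0}"
      using poly_roots_finite[OF False] by (intro card_mono)
    also have "\<dots> \<le> degree [: b1 * x * x - c, b2 * x, b3 :]"
      using False by (rule card_poly_roots_bound)
    also have "\<dots> \<le> 2" by (auto simp: degree_pCons_eq_if)
    finally show ?thesis by simp
  qed
  have "card (Sigma ?D ?Y) = (\<Sum>x\<in>?D. card (?Y x))" using D by (intro card_SigmaI) auto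
  also have "\<dots> \<le> (\<Sum>x\<in>?D. 2 + (if x dvd 1 then ?q ^ Suc k else 0))" by (intro sum_mono Y)
  also have "\<dots> = 2 * ?q ^ Suc k + (\<Sum>x\<in>?D. if x dvd 1 then ?q ^ Suc k else 0)"
    unfolding sum.distrib using D by simp
  also have "(\<Sum>x\<in>?D. if x dvd 1 then ?q ^ Suc k else 0) = card {x \<in> ?D. x dvd 1} * ?q ^ Suc k"
    using D by (simp add: sum.inter_filter[symmetric])
  also have "card {x \<in> ?D. x dvd 1} \<le> ?q"
    by (rule order_trans[OF card_mono[OF finite_units] card_units_le]) auto
  finally have "card (Sigma ?D ?Y) \<le> 2 * ?q ^ Suc k + ?q * ?q ^ Suc k" by (simp add: mult_right_mono)
  moreover have "finite (Sigma ?D ?Y)" using D by (intro finite_SigmaI) auto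
  ultimately show ?thesis unfolding eq by (simp add: algebra_simps power2_eq_square)
qed

text \<open>
  Since \<open>A\<close> is not scalar, some row vector \<open>(v, w)\<close> is cyclic for it.  Then \<open>H\<close> is determined by the row
  \<open>(x, y) = (v, w) ** H\<close>, because \<open>(v, w) ** A ** H = (x, y) ** B\<close>, and the determinant of \<open>H\<close> becomes a
  binary quadratic form in \<open>x\<close> and \<open>y\<close>.
\<close>

lemma card_intertwiners_le:
  fixes A B :: "'a::{finite, field} poly ^ 2 ^ 2"
  assumes A: "mdeg A = 0" "\<And>c. A \<noteq> mat c"
  shows "card {H. det H dvd 1 \<and> mdeg H \<le> k \<and> A ** H = H ** B}
     \<le> CARD('a) * ((2 * CARD('a) + CARD('a) ^ 2) * CARD('a) ^ k)"
proof -
  obtain a b c d where Am: "A = mat2 a b c d" by (rule mat2_cases)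
  obtain a' b' c' d' where Bm: "B = mat2 a' b' c' d'" by (rule mat2_cases)
  have deg0: "degree a = 0" "degree b = 0" "degree c = 0" "degree d = 0"
    using mdeg_nth[of A] A(1) unfolding Am by (metis le_zero_eq mat2_nth)+
  \<comment> \<open>The last condition says that the rows \<open>(v, w)\<close> and \<open>(v, w) ** A\<close> are linearly independent.\<close>
  obtain v w :: "'a poly" where vw: "degree v = 0" "degree w = 0" "v * v * b + v * w * (d - a) - w * w * c \<noteq> 0"
  proof -
    consider "b \<noteq> 0" | "c \<noteq> 0" | "b = 0" "c = 0" "d - a \<noteq> 0"
      using A(2)[of a] by (auto simp: Am mat_eq_mat2)
    then show ?thesis
    proof cases
      case 1 then show ?thesis using that[of 1 0] by simp
    next
      case 2 then show ?thesis using that[of 0 1] by simp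
    next
      case 3 then show ?thesis using that[of 1 1] by simp
    qed
  qed
  define M where "M = mat2 v w (v * a + w * c) (v * b + w * d)"
  have detM: "det M = v * v * b + v * w * (d - a) - w * w * c" by (simp add: M_def algebra_simps)
  have dm: "degree (x * y) = 0" if "degree x = 0" "degree y = 0" for x y :: "'a poly"
    using degree_mult_le[of x y] that by simp
  have da: "degree (x + y) = 0" if "degree x = 0" "degree y = 0" for x y :: "'a poly"
    using degree_add_le[of x 0 y] that by simp
  have dd: "degree (x - y) = 0" if "degree x = 0" "degree y = 0" for x y :: "'a poly"
    using degree_diff_le[of x 0 y] that by simp
  have "degree (v * v * b + v * w * (d - a) - w * w * c) = 0"
    by (intro dd da dm deg0 vw)
  then have M: "det M dvd 1" using vw(3) unfolding detM by (simp add: is_unit_iff_degree)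
  let ?S = "{H. det H dvd 1 \<and> mdeg H \<le> k \<and> A ** H = H ** B}"
  let ?f = "\<lambda>H :: 'a poly ^ 2 ^ 2. ((M ** H) $ 1 $ 1, (M ** H) $ 1 $ 2)"
  let ?T = "\<lambda>e. {(x, y). degree x \<le> k \<and> degree y \<le> k \<and> b' * x * x + (d' - a') * x * y + (- c') * y * y = e}"
  have MH: "M ** H = mat2 x y (x * a' + y * c') (x * b' + y * d')"
    if H: "A ** H = H ** B" and xy: "?f H = (x, y)" for H x y
  proof -
    obtain h1 h2 h3 h4 where Hm: "H = mat2 h1 h2 h3 h4" by (rule mat2_cases)
    have AH: "a * h1 + b * h3 = h1 * a' + h2 * c'" "a * h2 + b * h4 = h1 * b' + h2 * d'"
      "c * h1 + d * h3 = h3 * a' + h4 * c'" "c * h2 + d * h4 = h3 * b' + h4 * d'"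
      using H by (simp_all add: Am Bm Hm)
    have x: "x = v * h1 + w * h3" "y = v * h2 + w * h4" using xy by (auto simp: M_def Hm)
    have "(v * a + w * c) * h1 + (v * b + w * d) * h3 = v * (a * h1 + b * h3) + w * (c * h1 + d * h3)"
      "(v * a + w * c) * h2 + (v * b + w * d) * h4 = v * (a * h2 + b * h4) + w * (c * h2 + d * h4)"
      by (simp_all add: algebra_simps)
    then have "(v * a + w * c) * h1 + (v * b + w * d) * h3 = x * a' + y * c'"
      "(v * a + w * c) * h2 + (v * b + w * d) * h4 = x * b' + y * d'"
      unfolding AH x by (simp_all add: algebra_simps)
    then show ?thesis by (simp add: M_def Hm x)
  qed
  have sub: "?f ` ?S \<subseteq> (\<Union>e\<in>{e. e dvd 1}. ?T e)"
  proof
    fix p assume "p \<in> ?f ` ?S"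
    then obtain H where H: "H \<in> ?S" "p = ?f H" by blast
    obtain x y where p: "p = (x, y)" by (cases p)
    have eq: "M ** H = mat2 x y (x * a' + y * c') (x * b' + y * d')" using MH[of H x y] H p by simp
    have "det (M ** H) dvd 1" using H M by (simp add: det_mult_dvd_1)
    moreover have "det (M ** H) = b' * x * x + (d' - a') * x * y + (- c') * y * y"
      unfolding eq by (simp add: algebra_simps)
    moreover have "mdeg M = 0"
    proof -
      have "degree (v * a + w * c) = 0" "degree (v * b + w * d) = 0"
        by (intro da dm deg0 vw)+
      then show ?thesis using vw by (simp add: M_def mdeg_def)
    qed
    then have "mdeg (M ** H) \<le> k" using mdeg_mult_le[of M H] H by simp
    then have "degree x \<le> k" "degree y \<le> k" using p H mdeg_nth[of "M ** H" 1 1] mdeg_nth[of "M ** H" 1 2] by auto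
    ultimately show "p \<in> (\<Union>e\<in>{e. e dvd 1}. ?T e)" unfolding p by auto
  qed
  have "inj_on ?f ?S"
  proof (rule inj_onI)
    fix H H' assume H: "H \<in> ?S" "H' \<in> ?S" "?f H = ?f H'"
    have "M ** H = M ** H'"
      using MH[of H "(M ** H) $ 1 $ 1" "(M ** H) $ 1 $ 2"] MH[of H' "(M ** H) $ 1 $ 1" "(M ** H) $ 1 $ 2"] H by simp
    then have "mat (det M) ** H = mat (det M) ** H'" by (metis adj2_mult_cancel)
    then have "det M * H $ i $ j = det M * H' $ i $ j" for i j by (metis scalar_mult_nth)
    then have "H $ i $ j = H' $ i $ j" for i j using vw(3) unfolding detM by simp
    then show "H = H'" by (simp add: vec_eq_iff)
  qed
  then have "card ?S = card (?f ` ?S)" by (rule card_image[symmetric])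
  also have "\<dots> \<le> card (\<Union>e\<in>{e. e dvd 1}. ?T e)"
    using card_quadratic_values by (intro card_mono[OF finite_UN_I[OF finite_units] sub]) blast
  also have "\<dots> \<le> (\<Sum>e\<in>{e. e dvd 1}. card (?T e))" by (rule card_UN_le[OF finite_units])
  also have "\<dots> \<le> (\<Sum>e\<in>{e :: 'a poly. e dvd 1}. (2 * CARD('a) + CARD('a) ^ 2) * CARD('a) ^ k)"
    using card_quadratic_values by (intro sum_mono) blast
  also have "\<dots> \<le> CARD('a) * ((2 * CARD('a) + CARD('a) ^ 2) * CARD('a) ^ k)"
    using card_units_le[where 'a = 'a] by (simp only: sum_constant of_nat_id) (rule mult_right_mono, simp_all)
  finally show ?thesis .
qed

section \<open>Counting in \<open>PGL\<^sub>2\<close>\<close>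

text \<open>
  Equivalently, the elements that move the base vertex by the distance \<open>2 n\<close>.
\<close>

definition deg_sphere :: "nat \<Rightarrow> ('a::field poly ^ 2 ^ 2) set set" where
  "deg_sphere n = {g \<in> carrier PGL2. pdeg g = n}"

lemma deg_sphere_eq: "deg_sphere n = proj ` {H :: 'a::field poly ^ 2 ^ 2. det H dvd 1 \<and> mdeg H = n}"
  unfolding deg_sphere_def carrier_PGL2 by (auto simp: pdeg_proj)

lemma finite_deg_sphere: "finite (deg_sphere n :: ('a::{finite, field} poly ^ 2 ^ 2) set set)"
  unfolding deg_sphere_eq using card_mdeg(1) by (rule finite_imageI)

lemma card_proj:
  fixes H :: "'a::{finite, field} poly ^ 2 ^ 2"
  assumes "det H dvd 1" shows "card (proj H) = CARD('a) - 1"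
proof -
  have "{c :: 'a poly. c dvd 1} = (\<lambda>a. [:a:]) ` (UNIV - {0})"
    by (auto simp: is_unit_poly_iff dvd_field_iff)
  moreover have "inj_on (\<lambda>a :: 'a. [:a:]) (UNIV - {0})" by (auto simp: inj_on_def)
  ultimately have "card {c :: 'a poly. c dvd 1} = CARD('a) - 1"
    by (simp add: card_image card_Diff_singleton)
  moreover have "proj H = (\<lambda>c. mat c ** H) ` {c. c dvd 1}" unfolding proj_eq by blast
  moreover have "inj_on (\<lambda>c. mat c ** H) {c. c dvd 1}"
  proof (rule inj_onI)
    fix c d assume "mat c ** H = mat d ** H"
    then have *: "c * H $ i $ j = d * H $ i $ j" for i j by (metis scalar_mult_nth)
    have "H \<noteq> 0" using unit_poly[OF assms] det_nonzero by blast
    then obtain i j where "H $ i $ j \<noteq> 0" by (auto simp: vec_eq_iff)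
    then show "c = d" using *[of i j] by simp
  qed
  ultimately show ?thesis by (simp add: card_image)
qed

lemma card_deg_sphere_lift:
  "(CARD('a) - 1) * card (deg_sphere n :: ('a::{finite, field} poly ^ 2 ^ 2) set set) =
    card {H :: 'a poly ^ 2 ^ 2. det H dvd 1 \<and> mdeg H = n}"
proof -
  have U: "\<Union> (deg_sphere n :: ('a poly ^ 2 ^ 2) set set) = {H. det H dvd 1 \<and> mdeg H = n}"
  proof (rule subset_antisym; rule subsetI)
    fix X assume "X \<in> \<Union> (deg_sphere n :: ('a poly ^ 2 ^ 2) set set)"
    then obtain H c where "det H dvd 1" "mdeg H = n" "c dvd 1" "X = mat c ** H"
      unfolding deg_sphere_eq proj_eq by blast
    then show "X \<in> {H. det H dvd 1 \<and> mdeg H = n}"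
      by (simp add: mdeg_scalar_mult unit_mult_iff power2_eq_square)
  next
    fix X :: "'a poly ^ 2 ^ 2" assume "X \<in> {H. det H dvd 1 \<and> mdeg H = n}"
    moreover have "X \<in> proj X" unfolding proj_eq by (rule CollectI, rule exI[of _ 1]) simp
    ultimately show "X \<in> \<Union> (deg_sphere n)" unfolding deg_sphere_eq by blast
  qed
  have "(CARD('a) - 1) * card (deg_sphere n :: ('a poly ^ 2 ^ 2) set set) = card (\<Union> (deg_sphere n :: ('a poly ^ 2 ^ 2) set set))"
  proof (rule card_partition[OF finite_deg_sphere])
    show "finite (\<Union> (deg_sphere n :: ('a poly ^ 2 ^ 2) set set))" unfolding U by (rule card_mdeg(1))
    show "card c = CARD('a) - 1" if "c \<in> deg_sphere n" for c :: "('a poly ^ 2 ^ 2) set"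
      using that card_proj unfolding deg_sphere_eq by blast
    show "c1 \<inter> c2 = {}" if c12: "c1 \<in> deg_sphere n" "c2 \<in> deg_sphere n" "c1 \<noteq> c2" for c1 c2 :: "('a poly ^ 2 ^ 2) set"
    proof (rule ccontr)
      assume "c1 \<inter> c2 \<noteq> {}"
      then obtain X where X: "X \<in> c1" "X \<in> c2" by blast
      obtain A B where AB: "c1 = proj A" "c2 = proj B" using c12(1,2) unfolding deg_sphere_eq by blast
      have XH: "proj H = proj X" if X: "X \<in> proj H" for H :: "'a poly ^ 2 ^ 2"
      proof -
        obtain c where "c dvd 1" "X = mat c ** H" using X unfolding proj_eq[of H] by (elim CollectE exE conjE)
        then show ?thesis by (simp only: proj_scalar_mult)
      qed
      have "proj A = proj X" using X(1) unfolding AB(1) by (rule XH)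
      moreover have "proj B = proj X" using X(2) unfolding AB(2) by (rule XH)
      ultimately show False using c12(3) AB by simp
    qed
  qed
  then show ?thesis unfolding U .
qed

lemma card_deg_sphere_0:
  assumes "2 \<le> CARD('a)"
  shows "card (deg_sphere 0 :: ('a::{finite, field} poly ^ 2 ^ 2) set set) = (CARD('a) - 1) * (CARD('a) * (CARD('a) + 1))"
  using card_deg_sphere_lift[of 0, where 'a = 'a] assms unfolding card_mdeg_0 by simp

lemma card_deg_sphere_Suc:
  assumes "2 \<le> CARD('a)"
  shows "real (card (deg_sphere (Suc n) :: ('a::{finite, field} poly ^ 2 ^ 2) set set)) =
    (real CARD('a) ^ 2 - 1) * real CARD('a) ^ (2 * n) * real (card (deg_sphere 0 :: ('a poly ^ 2 ^ 2) set set))"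
proof -
  have "real (CARD('a) - 1) * real (card (deg_sphere (Suc n) :: ('a poly ^ 2 ^ 2) set set)) =
    (real CARD('a) ^ 2 - 1) * real CARD('a) ^ (2 * n) *
      (real (CARD('a) - 1) * real (card (deg_sphere 0 :: ('a poly ^ 2 ^ 2) set set)))"
    using card_mdeg(2)[of n, where 'a = 'a]
    unfolding card_deg_sphere_lift[symmetric] of_nat_mult .
  then have "real (CARD('a) - 1) * real (card (deg_sphere (Suc n) :: ('a poly ^ 2 ^ 2) set set)) =
    real (CARD('a) - 1) * ((real CARD('a) ^ 2 - 1) * real CARD('a) ^ (2 * n) *
      real (card (deg_sphere 0 :: ('a poly ^ 2 ^ 2) set set)))"
    by (simp only: mult_ac)
  moreover have "real (CARD('a) - 1) \<noteq> 0" using assms by simp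
  ultimately show ?thesis by (metis mult_left_cancel)
qed

text \<open>
  Such an \<open>h\<close> intertwines two elements of the finite group of constant matrices, the first one not
  scalar, so the bound for intertwiners applies to each of finitely many pairs.
\<close>

lemma card_nongeneric_le:
  "\<exists>C. \<forall>n. card {h \<in> deg_sphere n. \<exists>g \<in> deg_sphere 0. g \<noteq> \<one>\<^bsub>PGL2\<^esub> \<and>
      inv\<^bsub>PGL2\<^esub> h \<otimes>\<^bsub>PGL2\<^esub> g \<otimes>\<^bsub>PGL2\<^esub> h \<in> (deg_sphere 0 :: ('a::{finite, field} poly ^ 2 ^ 2) set set)} \<le> C * CARD('a) ^ n"
proof -
  let ?K = "{A :: 'a poly ^ 2 ^ 2. det A dvd 1 \<and> mdeg A = 0}"
  let ?K' = "{A \<in> ?K. \<forall>c. A \<noteq> mat c}"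
  let ?S = "\<lambda>A B n. {H :: 'a poly ^ 2 ^ 2. det H dvd 1 \<and> mdeg H = n \<and> A ** H = H ** B}"
  let ?L = "CARD('a) * (2 * CARD('a) + CARD('a) ^ 2)"
  have fin: "finite ?K" by (rule card_mdeg(1))
  have bound: "card (?S A B n) \<le> ?L * CARD('a) ^ n" if "A \<in> ?K'" for A B n
  proof -
    have "finite {H :: 'a poly ^ 2 ^ 2. det H dvd 1 \<and> mdeg H \<le> n \<and> A ** H = H ** B}"
    proof (rule finite_subset)
      show "{H :: 'a poly ^ 2 ^ 2. det H dvd 1 \<and> mdeg H \<le> n \<and> A ** H = H ** B} \<subseteq>
          (\<Union>m\<le>n. {H. det H dvd 1 \<and> mdeg H = m})" by auto
    qed (simp add: card_mdeg(1))
    then have "card (?S A B n) \<le> card {H :: 'a poly ^ 2 ^ 2. det H dvd 1 \<and> mdeg H \<le> n \<and> A ** H = H ** B}"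
      by (rule card_mono) auto
    also have "\<dots> \<le> ?L * CARD('a) ^ n"
      using card_intertwiners_le[of A n B] that by (simp add: mult.assoc)
    finally show ?thesis .
  qed
  have "card {h \<in> deg_sphere n. \<exists>g \<in> deg_sphere 0. g \<noteq> \<one>\<^bsub>PGL2\<^esub> \<and>
      inv\<^bsub>PGL2\<^esub> h \<otimes>\<^bsub>PGL2\<^esub> g \<otimes>\<^bsub>PGL2\<^esub> h \<in> (deg_sphere 0 :: ('a poly ^ 2 ^ 2) set set)} \<le>
      card (?K' \<times> ?K) * ?L * CARD('a) ^ n" (is "card ?B \<le> _") for n
  proof -
    have sub: "?B \<subseteq> proj ` (\<Union>(A, B)\<in>?K' \<times> ?K. ?S A B n)"
    proof
      fix h assume "h \<in> ?B"
      then obtain g where h: "h \<in> deg_sphere n" and g: "g \<in> deg_sphere 0" "g \<noteq> \<one>\<^bsub>PGL2\<^esub>"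
        and hg: "inv\<^bsub>PGL2\<^esub> h \<otimes>\<^bsub>PGL2\<^esub> g \<otimes>\<^bsub>PGL2\<^esub> h \<in> deg_sphere 0" by blast
      obtain H where H: "h = proj H" "det H dvd 1" "mdeg H = n" using h unfolding deg_sphere_eq by blast
      obtain A where A: "g = proj A" "det A dvd 1" "mdeg A = 0" using g unfolding deg_sphere_eq by blast
      let ?A = "mat (det H) ** A" and ?B = "adj2 H ** A ** H"
      have "pdeg (inv\<^bsub>PGL2\<^esub> h \<otimes>\<^bsub>PGL2\<^esub> g \<otimes>\<^bsub>PGL2\<^esub> h) = mdeg ?B"
        using H A by (simp add: proj_inv proj_mult det_mult_dvd_1 pdeg_proj)
      then have "mdeg ?B = 0" using hg by (simp add: deg_sphere_def)
      then have B: "?B \<in> ?K" using H A by (simp add: det_mult_dvd_1)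
      have "?A \<noteq> mat c" for c
      proof
        assume eq: "?A = mat c"
        have "det ?A dvd 1" using H A by (simp add: unit_mult_iff power2_eq_square)
        then have "c dvd 1" unfolding eq by (simp add: unit_mult_iff power2_eq_square)
        have "g = proj ?A" using A H by (simp add: proj_scalar_mult)
        also have "\<dots> = proj (mat c ** mat 1)" unfolding eq by simp
        also have "\<dots> = \<one>\<^bsub>PGL2\<^esub>" unfolding proj_one using \<open>c dvd 1\<close> by (rule proj_scalar_mult)
        finally show False using g by simp
      qed
      then have A': "?A \<in> ?K'" using A H by (simp add: mdeg_scalar_mult unit_mult_iff power2_eq_square)
      have "H ** ?B = (H ** adj2 H) ** (A ** H)" by (simp add: matrix_mul_assoc)
      also have "\<dots> = ?A ** H" by (simp add: adj2_right matrix_mul_assoc)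
      finally have "H \<in> ?S ?A ?B n" using H by simp
      then show "h \<in> proj ` (\<Union>(A, B)\<in>?K' \<times> ?K. ?S A B n)" using A' B H(1) by blast
    qed
    have finS: "finite (?S A B n)" for A B by (rule finite_subset[OF _ card_mdeg(1)[of n]]) auto
    have "finite ?K'" using fin by (rule rev_finite_subset) auto
    then have fin2: "finite (?K' \<times> ?K)" using fin by (rule finite_cartesian_product)
    then have finU: "finite (\<Union>(A, B)\<in>?K' \<times> ?K. ?S A B n)" using finS by (intro finite_UN_I) auto
    have "card ?B \<le> card (proj ` (\<Union>(A, B)\<in>?K' \<times> ?K. ?S A B n))"
      using finU by (intro card_mono[OF _ sub]) auto
    also have "\<dots> \<le> card (\<Union>(A, B)\<in>?K' \<times> ?K. ?S A B n)" by (rule card_image_le[OF finU])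
    also have "\<dots> \<le> (\<Sum>p\<in>?K' \<times> ?K. card (case p of (A, B) \<Rightarrow> ?S A B n))"
      by (rule card_UN_le[OF fin2])
    also have "\<dots> \<le> (\<Sum>p\<in>?K' \<times> ?K. ?L * CARD('a) ^ n)"
      using bound by (intro sum_mono) auto
    finally show ?thesis by (simp only: sum_constant of_nat_id mult.assoc)
  qed
  then show ?thesis by blast
qed

section \<open>Conjugation in a group\<close>

context group
begin

lemma cancel_inv: "x \<in> carrier G \<Longrightarrow> y \<in> carrier G \<Longrightarrow> x \<otimes> (inv x \<otimes> y) = y"
  "x \<in> carrier G \<Longrightarrow> y \<in> carrier G \<Longrightarrow> inv x \<otimes> (x \<otimes> y) = y"
  by (simp_all add: m_assoc[symmetric])

lemma conj_act_closed [simp]: "x \<in> carrier G \<Longrightarrow> a \<in> carrier G \<Longrightarrow> conj_act G x a \<in> carrier G"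
  by (simp add: conj_act_def)

lemma conj_act_one [simp]: "a \<in> carrier G \<Longrightarrow> conj_act G \<one> a = a"
  by (simp add: conj_act_def)

lemma conj_act_unit [simp]: "x \<in> carrier G \<Longrightarrow> conj_act G x \<one> = \<one>"
  by (simp add: conj_act_def)

lemma conj_act_comp:
  "x \<in> carrier G \<Longrightarrow> y \<in> carrier G \<Longrightarrow> a \<in> carrier G \<Longrightarrow> conj_act G x (conj_act G y a) = conj_act G (x \<otimes> y) a"
  by (simp add: conj_act_def m_assoc inv_mult_group)

lemma conj_act_mult:
  "x \<in> carrier G \<Longrightarrow> a \<in> carrier G \<Longrightarrow> b \<in> carrier G \<Longrightarrow> conj_act G x (a \<otimes> b) = conj_act G x a \<otimes> conj_act G x b"
  by (simp add: conj_act_def m_assoc cancel_inv)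

lemma conj_act_cancel [simp]:
  "x \<in> carrier G \<Longrightarrow> a \<in> carrier G \<Longrightarrow> conj_act G (inv x) (conj_act G x a) = a"
  "x \<in> carrier G \<Longrightarrow> a \<in> carrier G \<Longrightarrow> conj_act G x (conj_act G (inv x) a) = a"
  by (simp_all add: conj_act_comp)

lemma conj_act_inv:
  "x \<in> carrier G \<Longrightarrow> a \<in> carrier G \<Longrightarrow> conj_act G x (inv a) = inv (conj_act G x a)"
  by (simp add: conj_act_def m_assoc inv_mult_group)

lemma inj_conj_act: "x \<in> carrier G \<Longrightarrow> A \<subseteq> carrier G \<Longrightarrow> inj_on (conj_act G x) A"
  by (rule inj_on_inverseI[of _ "conj_act G (inv x)"]) auto

lemma centraliser_iff:
  "a \<in> carrier G \<Longrightarrow> x \<in> centraliser G a \<longleftrightarrow> x \<in> carrier G \<and> conj_act G x a = a"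
proof -
  assume a: "a \<in> carrier G"
  have "x \<otimes> a = a \<otimes> x \<longleftrightarrow> x \<otimes> a \<otimes> inv x = a" if x: "x \<in> carrier G" for x
  proof
    assume "x \<otimes> a = a \<otimes> x"
    then show "x \<otimes> a \<otimes> inv x = a" using x a by (simp add: m_assoc)
  next
    assume e: "x \<otimes> a \<otimes> inv x = a"
    have "x \<otimes> a = (x \<otimes> a \<otimes> inv x) \<otimes> x" using x a by (simp add: m_assoc)
    then show "x \<otimes> a = a \<otimes> x" unfolding e .
  qed
  then show ?thesis by (auto simp: centraliser_def conj_act_def)
qed

lemma conj_act_eq_iff:
  assumes "x \<in> carrier G" "y \<in> carrier G" "a \<in> carrier G"
  shows "conj_act G x a = conj_act G y a \<longleftrightarrow> inv x \<otimes> y \<in> centraliser G a"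
proof
  assume "conj_act G x a = conj_act G y a"
  then have "conj_act G (inv x) (conj_act G x a) = conj_act G (inv x) (conj_act G y a)" by simp
  then show "inv x \<otimes> y \<in> centraliser G a" using assms by (simp add: centraliser_iff conj_act_comp)
next
  assume "inv x \<otimes> y \<in> centraliser G a"
  then have "conj_act G x (conj_act G (inv x \<otimes> y) a) = conj_act G x a" using assms by (simp add: centraliser_iff)
  then show "conj_act G x a = conj_act G y a" using assms by (simp add: conj_act_comp cancel_inv)
qed

lemma subgroup_centraliser: "a \<in> carrier G \<Longrightarrow> subgroup (centraliser G a) G"
proof (rule subgroupI)
  assume a: "a \<in> carrier G"
  show "centraliser G a \<subseteq> carrier G" by (auto simp: centraliser_def)
  have "\<one> \<in> centraliser G a" using a by (simp add: centraliser_iff)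
  then show "centraliser G a \<noteq> {}" by blast
  show "inv x \<in> centraliser G a" if "x \<in> centraliser G a" for x
    using that a conj_act_cancel(1)[of x a] by (simp add: centraliser_iff)
  show "x \<otimes> y \<in> centraliser G a" if "x \<in> centraliser G a" "y \<in> centraliser G a" for x y
    using that a by (simp add: centraliser_iff conj_act_comp[symmetric])
qed

definition conj_sub :: "'a \<Rightarrow> 'a set \<Rightarrow> 'a set" where
  "conj_sub h H = {g \<in> carrier G. conj_act G (inv h) g \<in> H}"

lemma conj_sub_eq: "h \<in> carrier G \<Longrightarrow> H \<subseteq> carrier G \<Longrightarrow> conj_sub h H = conj_act G h ` H"
proof (rule subset_antisym; rule subsetI)
  fix x assume "h \<in> carrier G" "H \<subseteq> carrier G" "x \<in> conj_sub h H"
  then have "x = conj_act G h (conj_act G (inv h) x)" "conj_act G (inv h) x \<in> H" by (auto simp: conj_sub_def)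
  then show "x \<in> conj_act G h ` H" by (rule image_eqI)
qed (auto simp: conj_sub_def)

lemma card_conj_sub: "h \<in> carrier G \<Longrightarrow> H \<subseteq> carrier G \<Longrightarrow> card (conj_sub h H) = card H"
  by (simp add: conj_sub_eq card_image inj_conj_act)

lemma subgroup_conj_sub:
  assumes h: "h \<in> carrier G" and H: "subgroup H G" shows "subgroup (conj_sub h H) G"
proof (rule subgroupI)
  show "conj_sub h H \<subseteq> carrier G" by (auto simp: conj_sub_def)
  show "conj_sub h H \<noteq> {}"
    using h subgroup.one_closed[OF H] by (auto simp: conj_sub_def intro!: exI[of _ "\<one>"])
  show "inv x \<in> conj_sub h H" if "x \<in> conj_sub h H" for x
    using that h subgroup.m_inv_closed[OF H] by (simp add: conj_sub_def conj_act_inv)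
  show "x \<otimes> y \<in> conj_sub h H" if "x \<in> conj_sub h H" "y \<in> conj_sub h H" for x y
    using that h subgroup.m_closed[OF H] by (simp add: conj_sub_def conj_act_mult)
qed

lemma centraliser_conj_act:
  assumes "h \<in> carrier G" "a \<in> carrier G"
  shows "centraliser G (conj_act G h a) = conj_sub h (centraliser G a)"
proof -
  have "conj_act G g (conj_act G h a) = conj_act G h a \<longleftrightarrow> conj_act G (conj_act G (inv h) g) a = a"
    if g: "g \<in> carrier G" for g
  proof -
    have "conj_act G (conj_act G (inv h) g) a = conj_act G (inv h) (conj_act G g (conj_act G h a))"
      using g assms by (simp add: conj_act_comp) (simp add: conj_act_def m_assoc)
    then show ?thesis using g assms
      by (metis conj_act_cancel conj_act_closed)
  qed
  then show ?thesis using assms by (auto simp: conj_sub_def centraliser_iff)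
qed

text \<open>
  Lagrange's theorem inside a finite subgroup of a possibly infinite group.
\<close>

lemma card_lcosets_subgroup:
  assumes "subgroup K G" "subgroup H G" "K \<subseteq> H" "finite H"
  shows "card (lcosets\<^bsub>G\<lparr>carrier := H\<rparr>\<^esub> K) * card K = card H"
proof -
  interpret H: group "G\<lparr>carrier := H\<rparr>" by (rule subgroup_imp_group[OF assms(2)])
  have "subgroup K (G\<lparr>carrier := H\<rparr>)" using assms by (intro subgroup_incl) auto
  then show ?thesis using H.l_lagrange[of K] assms by (simp add: order_def)
qed

lemma conj_class_mem: "a \<in> conj_class G h \<longleftrightarrow> (\<exists>x\<in>carrier G. a = conj_act G x h)"
  by (auto simp: conj_class_def orbit_def)

lemma conj_class_conj_act:
  assumes "h \<in> carrier G" "x \<in> carrier G" shows "conj_class G (conj_act G x h) = conj_class G h"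
proof (rule subset_antisym; rule subsetI)
  fix a assume "a \<in> conj_class G (conj_act G x h)"
  then obtain y where "y \<in> carrier G" "a = conj_act G y (conj_act G x h)" unfolding conj_class_mem by blast
  then show "a \<in> conj_class G h" using assms unfolding conj_class_mem
    by (intro bexI[of _ "y \<otimes> x"]) (simp_all add: conj_act_comp)
next
  fix a assume "a \<in> conj_class G h"
  then obtain y where "y \<in> carrier G" "a = conj_act G y h" unfolding conj_class_mem by blast
  then show "a \<in> conj_class G (conj_act G x h)" using assms unfolding conj_class_mem
    by (intro bexI[of _ "y \<otimes> inv x"]) (simp_all add: conj_act_comp m_assoc)
qed

lemma conj_class_eqI:
  assumes "h \<in> carrier G" "h' \<in> carrier G" "a \<in> conj_class G h" "a \<in> conj_class G h'"
  shows "conj_class G h = conj_class G h'"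
proof -
  obtain x y where "x \<in> carrier G" "a = conj_act G x h" "y \<in> carrier G" "a = conj_act G y h'"
    using assms(3,4) unfolding conj_class_mem by blast
  then show ?thesis using conj_class_conj_act assms(1,2) by metis
qed

end

section \<open>Orbits of pairs of involutions\<close>

locale finite_anisotropic = anisotropic F for F :: "'a::{finite, field} itself"
begin

abbreviation G :: "('a poly ^ 2 ^ 2) set monoid" where "G \<equiv> PGL2"
abbreviation al :: "('a poly ^ 2 ^ 2) set" where "al \<equiv> alpha"
abbreviation I :: "('a poly ^ 2 ^ 2) set set" where "I \<equiv> conj_class G al"
abbreviation mulG (infixl \<open>\<cdot>\<close> 70) where "x \<cdot> y \<equiv> x \<otimes>\<^bsub>G\<^esub> y"
abbreviation \<Gamma>\<^sub>0 :: "('a poly ^ 2 ^ 2) set set" where "\<Gamma>\<^sub>0 \<equiv> deg_sphere 0"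
abbreviation Z :: "('a poly ^ 2 ^ 2) set set" where "Z \<equiv> centraliser G al"

lemma subgroup_const: "subgroup \<Gamma>\<^sub>0 G"
proof (rule PGL.subgroupI)
  show "\<Gamma>\<^sub>0 \<subseteq> carrier G" by (auto simp: deg_sphere_def)
  show "\<Gamma>\<^sub>0 \<noteq> {}" using pdeg_one PGL.one_closed by (auto simp: deg_sphere_def)
  show "inv\<^bsub>G\<^esub> x \<in> \<Gamma>\<^sub>0" if "x \<in> \<Gamma>\<^sub>0" for x using that by (simp add: deg_sphere_def pdeg_inv)
  show "x \<cdot> y \<in> \<Gamma>\<^sub>0" if "x \<in> \<Gamma>\<^sub>0" "y \<in> \<Gamma>\<^sub>0" for x y
    using that pdeg_mult_le[of x y] by (simp add: deg_sphere_def)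
qed

lemma const_carrier: "\<Gamma>\<^sub>0 \<subseteq> carrier G" by (auto simp: deg_sphere_def)

lemma Z_const: "Z \<subseteq> \<Gamma>\<^sub>0"
  using centraliser_alpha by (auto simp: deg_sphere_def)

lemma subgroup_Z: "subgroup Z G" by (rule PGL.subgroup_centraliser) simp

lemma finite_Z: "finite Z" using Z_const finite_deg_sphere finite_subset by blast

lemma card_Z_pos: "0 < card Z"
  using finite_Z subgroup.one_closed[OF subgroup_Z] by (auto simp: card_gt_0_iff)

lemma stabiliser_eq:
  assumes "h \<in> carrier G" shows "fixed_set_stabiliser (conj_act G h al) = PGL.conj_sub h \<Gamma>\<^sub>0"
proof -
  have "pdeg (inv\<^bsub>G\<^esub> h \<cdot> g \<cdot> h) = 0 \<longleftrightarrow> conj_act G (inv\<^bsub>G\<^esub> h) g \<in> \<Gamma>\<^sub>0" if "g \<in> carrier G" for g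
    using that assms PGL.conj_act_closed[of "inv\<^bsub>G\<^esub> h" g]
    by (simp add: deg_sphere_def conj_act_def)
  then show ?thesis unfolding fixed_set_stabiliser_half_turn[OF assms] PGL.conj_sub_def by blast
qed

lemma stabiliser_index_eq:
  assumes h: "h \<in> carrier G" shows "stabiliser_index (conj_act G h al) * card Z = card \<Gamma>\<^sub>0"
proof -
  have sub: "PGL.conj_sub h Z \<subseteq> PGL.conj_sub h \<Gamma>\<^sub>0" using Z_const by (auto simp: PGL.conj_sub_def)
  have "finite (PGL.conj_sub h \<Gamma>\<^sub>0)"
    using h by (simp add: PGL.conj_sub_eq[OF h const_carrier] finite_deg_sphere)
  then have "stabiliser_index (conj_act G h al) * card (PGL.conj_sub h Z) = card (PGL.conj_sub h \<Gamma>\<^sub>0)"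
    unfolding stabiliser_index_def stabiliser_eq[OF h] PGL.centraliser_conj_act[OF h alpha_carrier]
    using h subgroup_Z subgroup_const sub
    by (intro PGL.card_lcosets_subgroup PGL.subgroup_conj_sub)
  moreover have "Z \<subseteq> carrier G" by (auto simp: centraliser_def)
  ultimately show ?thesis using h const_carrier by (simp add: PGL.card_conj_sub)
qed

text \<open>
  The weight of the pair \<open>(alpha, k alpha k\<^sup>-\<^sup>1)\<close>.  Both indices equal \<open>card \<Gamma>\<^sub>0 / card Z\<close>, and the set in
  the denominator is \<open>\<Gamma>\<^sub>0 \<inter> k \<Gamma>\<^sub>0 k\<^sup>-\<^sup>1\<close>.
\<close>

definition orbit_weight :: "('a poly ^ 2 ^ 2) set \<Rightarrow> real" where
  "orbit_weight k = (real (card Z) / real (card \<Gamma>\<^sub>0)) ^ 2 / real (card {x \<in> \<Gamma>\<^sub>0. conj_act G (inv\<^bsub>G\<^esub> k) x \<in> \<Gamma>\<^sub>0})"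

lemma pair_weight_eq:
  assumes g: "g \<in> carrier G" and k: "k \<in> carrier G"
  shows "pair_weight (conj_act G g al, conj_act G (g \<cdot> k) al) = orbit_weight k"
proof -
  have gk: "g \<cdot> k \<in> carrier G" using g k by simp
  have "conj_act G (inv\<^bsub>G\<^esub> (g \<cdot> k)) (conj_act G g x) = conj_act G (inv\<^bsub>G\<^esub> k) x" if "x \<in> carrier G" for x
    using that g k by (simp add: PGL.conj_act_comp PGL.inv_mult_group PGL.m_assoc)
  then have "PGL.conj_sub g \<Gamma>\<^sub>0 \<inter> PGL.conj_sub (g \<cdot> k) \<Gamma>\<^sub>0
      = conj_act G g ` {x \<in> \<Gamma>\<^sub>0. conj_act G (inv\<^bsub>G\<^esub> k) x \<in> \<Gamma>\<^sub>0}"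
    unfolding PGL.conj_sub_eq[OF g const_carrier]
    using const_carrier gk g unfolding PGL.conj_sub_def by auto
  moreover have "inj_on (conj_act G g) {x \<in> \<Gamma>\<^sub>0. conj_act G (inv\<^bsub>G\<^esub> k) x \<in> \<Gamma>\<^sub>0}"
    using g const_carrier by (intro PGL.inj_conj_act) auto
  ultimately have 1: "card (fixed_set_stabiliser (conj_act G g al) \<inter> fixed_set_stabiliser (conj_act G (g \<cdot> k) al))
      = card {x \<in> \<Gamma>\<^sub>0. conj_act G (inv\<^bsub>G\<^esub> k) x \<in> \<Gamma>\<^sub>0}"
    by (simp add: stabiliser_eq[OF g] stabiliser_eq[OF gk] card_image)
  have 2: "real (stabiliser_index (conj_act G h al)) = real (card \<Gamma>\<^sub>0) / real (card Z)" if "h \<in> carrier G" for h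
    unfolding stabiliser_index_eq[OF that, symmetric] using card_Z_pos by simp
  show ?thesis unfolding pair_weight_def case_prod_conv 1 2[OF g] 2[OF gk] orbit_weight_def
    by (simp add: power2_eq_square divide_simps)
qed

abbreviation diag :: "('a poly ^ 2 ^ 2) set \<Rightarrow> _" where
  "diag \<equiv> \<lambda>g. map_prod (conj_act G g) (conj_act G g)"

text \<open>
  The orbit of \<open>(alpha, k alpha k\<^sup>-\<^sup>1)\<close> under diagonal conjugation.  Every orbit of pairs of conjugates
  of \<open>alpha\<close> is of this form.
\<close>

definition pair_orbit :: "('a poly ^ 2 ^ 2) set \<Rightarrow> (('a poly ^ 2 ^ 2) set \<times> ('a poly ^ 2 ^ 2) set) set" where
  "pair_orbit k = {(conj_act G x al, conj_act G (x \<cdot> k) al) | x. x \<in> carrier G}"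

lemma orbit_pair:
  assumes g: "g \<in> carrier G" and h: "h \<in> carrier G"
  shows "orbit G diag (conj_act G g al, conj_act G h al) = pair_orbit (inv\<^bsub>G\<^esub> g \<cdot> h)"
proof (rule subset_antisym; rule subsetI)
  fix p assume "p \<in> orbit G diag (conj_act G g al, conj_act G h al)"
  then obtain x where x: "x \<in> carrier G" "p = (conj_act G (x \<cdot> g) al, conj_act G (x \<cdot> h) al)"
    using g h by (auto simp: orbit_def PGL.conj_act_comp)
  moreover have "x \<cdot> h = (x \<cdot> g) \<cdot> (inv\<^bsub>G\<^esub> g \<cdot> h)"
    using x g h by (simp add: PGL.m_assoc PGL.cancel_inv)
  ultimately show "p \<in> pair_orbit (inv\<^bsub>G\<^esub> g \<cdot> h)" unfolding pair_orbit_def using g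
    by (intro CollectI exI[of _ "x \<cdot> g"]) simp
next
  fix p assume "p \<in> pair_orbit (inv\<^bsub>G\<^esub> g \<cdot> h)"
  then obtain x where x: "x \<in> carrier G" "p = (conj_act G x al, conj_act G (x \<cdot> (inv\<^bsub>G\<^esub> g \<cdot> h)) al)"
    unfolding pair_orbit_def by blast
  then have "p = diag (x \<cdot> inv\<^bsub>G\<^esub> g) (conj_act G g al, conj_act G h al)"
    using g h by (simp add: PGL.conj_act_comp PGL.m_assoc)
  then show "p \<in> orbit G diag (conj_act G g al, conj_act G h al)"
    unfolding orbit_def using x g by blast
qed

lemma orbits_eq: "orbits G (disjoint_pairs I) diag = pair_orbit ` {k \<in> carrier G. pdeg k \<noteq> 0}"
proof (rule subset_antisym; rule subsetI)
  fix P assume "P \<in> orbits G (disjoint_pairs I) diag"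
  then obtain a b where P: "P = orbit G diag (a, b)" "(a, b) \<in> disjoint_pairs I" by (auto simp: orbits_def)
  then have "a \<in> I" "b \<in> I" by (auto simp: disjoint_pairs_def)
  then obtain g h where g: "g \<in> carrier G" "a = conj_act G g al" and h: "h \<in> carrier G" "b = conj_act G h al"
    unfolding PGL.conj_class_mem by blast
  have "pdeg (inv\<^bsub>G\<^esub> g \<cdot> h) \<noteq> 0"
    using P(2) closures_disjoint_iff[OF g(1) h(1)] unfolding disjoint_pairs_def g h by simp
  then show "P \<in> pair_orbit ` {k \<in> carrier G. pdeg k \<noteq> 0}"
    unfolding P g h orbit_pair[OF g(1) h(1)] using g h by (intro imageI) simp
next
  fix P assume "P \<in> pair_orbit ` {k \<in> carrier G. pdeg k \<noteq> 0}"
  then obtain k where k: "k \<in> carrier G" "pdeg k \<noteq> 0" "P = pair_orbit k" by blast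
  have one: "conj_act G \<one>\<^bsub>G\<^esub> al = al" by simp
  have "al \<in> I" "conj_act G k al \<in> I" unfolding PGL.conj_class_mem using k one PGL.one_closed by metis+
  moreover have "(cone_topology bt_edges closure_of (Inl ` fixed_set al)) \<inter>
      (cone_topology bt_edges closure_of (Inl ` fixed_set (conj_act G k al))) = {}"
    using closures_disjoint_iff[OF PGL.one_closed k(1)] k unfolding one by simp
  ultimately have "(al, conj_act G k al) \<in> disjoint_pairs I" by (simp add: disjoint_pairs_def)
  moreover have "P = orbit G diag (al, conj_act G k al)"
    using orbit_pair[OF PGL.one_closed k(1)] k unfolding one by simp
  ultimately show "P \<in> orbits G (disjoint_pairs I) diag" unfolding orbits_def by blast
qed

lemma weight_pair_orbit: "k \<in> carrier G \<Longrightarrow> the_elem (pair_weight ` pair_orbit k) = orbit_weight k"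
proof -
  assume k: "k \<in> carrier G"
  have "pair_weight p = orbit_weight k" if "p \<in> pair_orbit k" for p
    using that pair_weight_eq[OF _ k] unfolding pair_orbit_def by auto
  moreover have "pair_orbit k \<noteq> {}" unfolding pair_orbit_def using PGL.one_closed by blast
  ultimately have "pair_weight ` pair_orbit k = {orbit_weight k}" by (simp add: image_constant_conv cong: image_cong)
  then show ?thesis by simp
qed

text \<open>
  The products \<open>b a\<close> over an orbit of pairs \<open>(a, b)\<close> form a whole conjugacy class.
\<close>

definition product_class where "product_class P = (\<lambda>(a, b). b \<cdot> a) ` P"

definition turn_product :: "('a poly ^ 2 ^ 2) set \<Rightarrow> ('a poly ^ 2 ^ 2) set" where
  "turn_product k = conj_act G k al \<cdot> al"

lemma turn_product_closed [simp]: "k \<in> carrier G \<Longrightarrow> turn_product k \<in> carrier G"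
  by (simp add: turn_product_def)

lemma conj_turn_product:
  "k \<in> carrier G \<Longrightarrow> x \<in> carrier G \<Longrightarrow>
    conj_act G x (turn_product k) = conj_act G (x \<cdot> k) al \<cdot> conj_act G x al"
  by (simp add: turn_product_def PGL.conj_act_mult PGL.conj_act_comp)

lemma product_class_pair_orbit: "k \<in> carrier G \<Longrightarrow> product_class (pair_orbit k) = conj_class G (turn_product k)"
proof -
  assume k: "k \<in> carrier G"
  have "product_class (pair_orbit k) = (\<lambda>x. conj_act G (x \<cdot> k) al \<cdot> conj_act G x al) ` carrier G"
    unfolding product_class_def pair_orbit_def by (auto simp: image_iff)
  also have "\<dots> = (\<lambda>x. conj_act G x (turn_product k)) ` carrier G"
    using k by (intro image_cong) (simp_all add: conj_turn_product)
  finally show ?thesis unfolding conj_class_def orbit_def by blast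
qed

lemma translation_length_conj_turn_product:
  assumes k: "k \<in> carrier G" and x: "x \<in> carrier G"
  shows "translation_length (conj_act G x (turn_product k)) = 4 * real (pdeg k)"
  using translation_length_product[of x "x \<cdot> k"] k x
  by (simp add: conj_turn_product PGL.cancel_inv)

lemma involution_square: "x \<in> carrier G \<Longrightarrow> conj_act G x al \<cdot> conj_act G x al = \<one>\<^bsub>G\<^esub>"
  by (simp add: PGL.conj_act_mult[symmetric] alpha_square)

definition shell :: "nat \<Rightarrow> ('a poly ^ 2 ^ 2) set set" where
  "shell K = {k \<in> carrier G. pdeg k \<noteq> 0 \<and> pdeg k \<le> K}"

text \<open>
  If \<open>g a = b\<close> with \<open>a\<close> and \<open>b\<close> conjugate to \<open>alpha\<close>, then \<open>g = b a\<close> because \<open>a\<close> is an involution.  So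
  a reversible element is, up to conjugation, \<open>turn_product k\<close> for some \<open>k\<close>, and its translation
  length is \<open>4 * pdeg k\<close>.
\<close>

lemma classes_eq:
  "{conj_class G g | g. loxodromic g \<and> reversible I g \<and> translation_length g \<le> 4 * real K} =
    (\<lambda>k. conj_class G (turn_product k)) ` shell K"
proof (rule subset_antisym; rule subsetI)
  fix C assume "C \<in> {conj_class G g | g. loxodromic g \<and> reversible I g \<and> translation_length g \<le> 4 * real K}"
  then obtain g where C: "C = conj_class G g" and g: "g \<in> carrier G" "0 < translation_length g"
    "translation_length g \<le> 4 * real K" and rev: "reversible I g" by (auto simp: loxodromic_def)
  obtain a where a: "a \<in> I" "g \<cdot> a \<in> I" using rev by (auto simp: reversible_def)
  obtain x where x: "x \<in> carrier G" "a = conj_act G x al" using a(1) unfolding PGL.conj_class_mem by blast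
  obtain y where y: "y \<in> carrier G" "g \<cdot> a = conj_act G y al" using a(2) unfolding PGL.conj_class_mem by blast
  let ?k = "inv\<^bsub>G\<^esub> x \<cdot> y"
  have k: "?k \<in> carrier G" using x y by simp
  have ac: "a \<in> carrier G" using x by simp
  have "g = (g \<cdot> a) \<cdot> a" using g ac involution_square[OF x(1)] x(2) by (simp add: PGL.m_assoc)
  also have "\<dots> = conj_act G x (turn_product ?k)" using x y k by (simp add: conj_turn_product PGL.cancel_inv)
  finally have gk: "g = conj_act G x (turn_product ?k)" .
  have "translation_length g = 4 * real (pdeg ?k)" unfolding gk by (rule translation_length_conj_turn_product[OF k x(1)])
  then have "?k \<in> shell K" using g k by (simp add: shell_def)
  moreover have "C = conj_class G (turn_product ?k)"
    unfolding C gk by (rule PGL.conj_class_conj_act[OF turn_product_closed[OF k] x(1)])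
  ultimately show "C \<in> (\<lambda>k. conj_class G (turn_product k)) ` shell K" by blast
next
  fix C assume "C \<in> (\<lambda>k. conj_class G (turn_product k)) ` shell K"
  then obtain k where k: "k \<in> carrier G" "pdeg k \<noteq> 0" "pdeg k \<le> K" "C = conj_class G (turn_product k)"
    by (auto simp: shell_def)
  have tl: "translation_length (turn_product k) = 4 * real (pdeg k)"
    using translation_length_conj_turn_product[OF k(1) PGL.one_closed] k by simp
  have one: "conj_act G \<one>\<^bsub>G\<^esub> al = al" by simp
  have I: "al \<in> I" "conj_act G k al \<in> I" unfolding PGL.conj_class_mem using k one PGL.one_closed by metis+
  have pa: "turn_product k \<cdot> al = conj_act G k al"
    using k alpha_square by (simp add: turn_product_def PGL.m_assoc)
  have inv_inv: "inv\<^bsub>G\<^esub> (conj_act G x al) = conj_act G x al" if "x \<in> carrier G" for x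
    using that involution_square[OF that] by (intro PGL.inv_equality) simp_all
  have "inv\<^bsub>G\<^esub> (turn_product k) = al \<cdot> conj_act G k al"
    using k inv_inv[OF k(1)] inv_inv[OF PGL.one_closed] by (simp add: turn_product_def PGL.inv_mult_group)
  then have "al \<cdot> inv\<^bsub>G\<^esub> (turn_product k) = conj_act G k al"
    using k alpha_square by (simp add: PGL.m_assoc[symmetric])
  then have "reversible I (turn_product k)" unfolding reversible_def using I pa by (intro bexI[of _ al]) simp_all
  moreover have "loxodromic (turn_product k)" using k tl by (simp add: loxodromic_def)
  ultimately show "C \<in> {conj_class G g | g. loxodromic g \<and> reversible I g \<and> translation_length g \<le> 4 * real K}"
    using k tl by (intro CollectI exI[of _ "turn_product k"]) simp
qed

text \<open>
  All pairs whose product lies in a given class have the same translation length, so restricting the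
  orbits to \<open>shell K\<close> loses none of them.
\<close>

lemma orbits_of_class:
  assumes k: "k \<in> shell K"
  shows "{P \<in> orbits G (disjoint_pairs I) diag. \<exists>(a, b)\<in>P. b \<cdot> a \<in> conj_class G (turn_product k)} =
    {P \<in> pair_orbit ` shell K. product_class P = conj_class G (turn_product k)}"
proof (rule subset_antisym; rule subsetI)
  have kc: "k \<in> carrier G" "pdeg k \<le> K" using k by (auto simp: shell_def)
  fix P assume P: "P \<in> {P \<in> orbits G (disjoint_pairs I) diag. \<exists>(a, b)\<in>P. b \<cdot> a \<in> conj_class G (turn_product k)}"
  then obtain l where l: "l \<in> carrier G" "pdeg l \<noteq> 0" "P = pair_orbit l" unfolding orbits_eq by blast
  obtain a b where "(a, b) \<in> P" "b \<cdot> a \<in> conj_class G (turn_product k)" using P by blast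
  then have ba: "b \<cdot> a \<in> conj_class G (turn_product k)" "b \<cdot> a \<in> conj_class G (turn_product l)"
    unfolding product_class_pair_orbit[OF l(1), symmetric] product_class_def l by force+
  then have eq: "conj_class G (turn_product l) = conj_class G (turn_product k)"
    using l kc by (intro PGL.conj_class_eqI[of _ _ "b \<cdot> a"]) simp_all
  obtain x where x: "x \<in> carrier G" "b \<cdot> a = conj_act G x (turn_product k)"
    using ba(1) unfolding PGL.conj_class_mem by blast
  obtain y where y: "y \<in> carrier G" "b \<cdot> a = conj_act G y (turn_product l)"
    using ba(2) unfolding PGL.conj_class_mem by blast
  have "4 * real (pdeg k) = 4 * real (pdeg l)"
    using translation_length_conj_turn_product[OF kc(1) x(1)] translation_length_conj_turn_product[OF l(1) y(1)] x y by simp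
  then have "l \<in> shell K" using l kc by (simp add: shell_def)
  then show "P \<in> {P \<in> pair_orbit ` shell K. product_class P = conj_class G (turn_product k)}"
    using l eq by (simp add: product_class_pair_orbit)
next
  fix P assume "P \<in> {P \<in> pair_orbit ` shell K. product_class P = conj_class G (turn_product k)}"
  then obtain l where l: "l \<in> shell K" "P = pair_orbit l" "product_class P = conj_class G (turn_product k)" by blast
  have lc: "l \<in> carrier G" "pdeg l \<noteq> 0" using l by (auto simp: shell_def)
  have mem: "turn_product l \<in> product_class P" unfolding l(2) product_class_pair_orbit[OF lc(1)] PGL.conj_class_mem
    using lc by (intro bexI[of _ "\<one>\<^bsub>G\<^esub>"]) simp_all
  then obtain a b where "(a, b) \<in> P" "turn_product l = b \<cdot> a" unfolding product_class_def by auto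
  moreover have "turn_product l \<in> conj_class G (turn_product k)" using mem l(3) by simp
  ultimately have "(a, b) \<in> P" "b \<cdot> a \<in> conj_class G (turn_product k)" by simp_all
  then have "\<exists>(a, b)\<in>P. b \<cdot> a \<in> conj_class G (turn_product k)" by blast
  moreover have "P \<in> orbits G (disjoint_pairs I) diag" unfolding orbits_eq using l lc by blast
  ultimately show "P \<in> {P \<in> orbits G (disjoint_pairs I) diag. \<exists>(a, b)\<in>P. b \<cdot> a \<in> conj_class G (turn_product k)}" by blast
qed

lemma shell_eq: "shell K = (\<Union>n<K. deg_sphere (Suc n))"
proof -
  have "m \<noteq> 0 \<and> m \<le> K \<longleftrightarrow> (\<exists>n<K. m = Suc n)" for m by (cases m) auto
  then show ?thesis unfolding shell_def deg_sphere_def by auto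
qed

lemma finite_shell: "finite (shell K)"
  unfolding shell_eq by (simp add: finite_deg_sphere)

text \<open>
  Each orbit of pairs is counted for exactly one class, that of the products of its pairs.
\<close>

lemma reversible_count_orbits:
  "reversible_count I (4 * real K) = (\<Sum>P\<in>pair_orbit ` shell K. the_elem (pair_weight ` P))"
proof -
  let ?w = "\<lambda>P. the_elem (pair_weight ` P)"
  have "multiplicity_class I C = (\<Sum>P\<in>{P \<in> pair_orbit ` shell K. product_class P = C}. ?w P)"
    if C: "C \<in> (\<lambda>k. conj_class G (turn_product k)) ` shell K" for C
  proof -
    obtain k where k: "k \<in> shell K" "C = conj_class G (turn_product k)" using C by blast
    show ?thesis unfolding multiplicity_class_def k(2) orbits_of_class[OF k(1)]
      by (intro infsum_finite) (simp add: finite_shell)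
  qed
  then have "reversible_count I (4 * real K) =
      (\<Sum>C\<in>(\<lambda>k. conj_class G (turn_product k)) ` shell K. \<Sum>P\<in>{P \<in> pair_orbit ` shell K. product_class P = C}. ?w P)"
    unfolding reversible_count_def classes_eq by (subst infsum_finite) (simp_all add: finite_shell cong: sum.cong)
  also have "(\<lambda>k. conj_class G (turn_product k)) ` shell K = product_class ` pair_orbit ` shell K"
    unfolding image_image by (intro image_cong) (auto simp: shell_def product_class_pair_orbit)
  also have "(\<Sum>C\<in>product_class ` pair_orbit ` shell K. \<Sum>P\<in>{P \<in> pair_orbit ` shell K. product_class P = C}. ?w P) = (\<Sum>P\<in>pair_orbit ` shell K. ?w P)"
    by (rule sum.image_gen[symmetric]) (simp add: finite_shell)
  finally show ?thesis .
qed

end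

section \<open>The number of orbits\<close>

context finite_anisotropic
begin

lemma pdeg_mult_const:
  assumes "z \<in> \<Gamma>\<^sub>0" "k \<in> carrier G"
  shows "pdeg (z \<cdot> k) = pdeg k" "pdeg (k \<cdot> z) = pdeg k"
proof -
  have z: "z \<in> carrier G" "pdeg z = 0" "pdeg (inv\<^bsub>G\<^esub> z) = 0" using assms by (auto simp: deg_sphere_def pdeg_inv)
  have "inv\<^bsub>G\<^esub> z \<cdot> (z \<cdot> k) = k" "(k \<cdot> z) \<cdot> inv\<^bsub>G\<^esub> z = k"
    using z assms by (simp_all add: PGL.cancel_inv PGL.m_assoc)
  then show "pdeg (z \<cdot> k) = pdeg k" "pdeg (k \<cdot> z) = pdeg k"
    using z assms pdeg_mult_le[of z k] pdeg_mult_le[of k z]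
      pdeg_mult_le[of "inv\<^bsub>G\<^esub> z" "z \<cdot> k"] pdeg_mult_le[of "k \<cdot> z" "inv\<^bsub>G\<^esub> z"] by simp_all
qed

definition fibre :: "nat \<Rightarrow> ('a poly ^ 2 ^ 2) set \<Rightarrow> ('a poly ^ 2 ^ 2) set set" where
  "fibre K k = {l \<in> shell K. pair_orbit l = pair_orbit k}"

text \<open>
  The orbits of pairs correspond to the double cosets of the centraliser of \<open>alpha\<close>.
\<close>

lemma fibre_eq:
  assumes k: "k \<in> shell K"
  shows "fibre K k = (\<lambda>(y, z). y \<cdot> k \<cdot> z) ` (Z \<times> Z)"
proof (rule subset_antisym; rule subsetI)
  have kc: "k \<in> carrier G" using k by (simp add: shell_def)
  fix l assume "l \<in> fibre K k"
  then have l: "l \<in> carrier G" "pair_orbit l = pair_orbit k" by (auto simp: fibre_def shell_def)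
  have "(conj_act G \<one>\<^bsub>G\<^esub> al, conj_act G (\<one>\<^bsub>G\<^esub> \<cdot> l) al) \<in> pair_orbit l"
    unfolding pair_orbit_def using PGL.one_closed by blast
  then have "(al, conj_act G l al) \<in> pair_orbit k" using l by simp
  then obtain x where x: "x \<in> carrier G" "conj_act G x al = al" "conj_act G (x \<cdot> k) al = conj_act G l al"
    unfolding pair_orbit_def by auto
  have xZ: "x \<in> Z" using x by (simp add: PGL.centraliser_iff)
  have "inv\<^bsub>G\<^esub> (x \<cdot> k) \<cdot> l \<in> Z" using PGL.conj_act_eq_iff[of "x \<cdot> k" l al] x l kc by simp
  moreover have "l = x \<cdot> k \<cdot> (inv\<^bsub>G\<^esub> (x \<cdot> k) \<cdot> l)" using x l kc by (simp add: PGL.cancel_inv)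
  ultimately show "l \<in> (\<lambda>(y, z). y \<cdot> k \<cdot> z) ` (Z \<times> Z)"
    using xZ by (intro image_eqI[of _ _ "(x, inv\<^bsub>G\<^esub> (x \<cdot> k) \<cdot> l)"]) simp_all
next
  have kc: "k \<in> carrier G" using k by (simp add: shell_def)
  fix l assume "l \<in> (\<lambda>(y, z). y \<cdot> k \<cdot> z) ` (Z \<times> Z)"
  then obtain y z where yz: "y \<in> Z" "z \<in> Z" "l = y \<cdot> k \<cdot> z" by blast
  have c: "y \<in> carrier G" "z \<in> carrier G" "y \<in> \<Gamma>\<^sub>0" "z \<in> \<Gamma>\<^sub>0"
    using yz Z_const const_carrier by blast+
  have cz: "conj_act G y al = al" "conj_act G z al = al" using yz c by (simp_all add: PGL.centraliser_iff)
  have lc: "l \<in> carrier G" using c kc yz by simp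
  have "pdeg l = pdeg k" using c kc yz by (simp add: pdeg_mult_const)
  then have "l \<in> shell K" using k lc by (simp add: shell_def)
  have 1: "conj_act G l al = conj_act G (y \<cdot> k) al"
    using c kc cz by (simp add: yz(3) PGL.conj_act_comp[symmetric])
  have "pair_orbit l = orbit G diag (conj_act G \<one>\<^bsub>G\<^esub> al, conj_act G l al)"
    using orbit_pair[OF PGL.one_closed lc] lc by simp
  also have "\<dots> = orbit G diag (conj_act G y al, conj_act G (y \<cdot> k) al)" by (simp add: 1 cz)
  also have "\<dots> = pair_orbit k" using orbit_pair[of y "y \<cdot> k"] c kc by (simp add: PGL.cancel_inv)
  finally show "l \<in> fibre K k" using \<open>l \<in> shell K\<close> by (simp add: fibre_def)
qed

text \<open>
  The elements for which the base vertex and its image under \<open>h\<close> have a nontrivial common stabiliser.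
\<close>

abbreviation nongeneric :: "nat \<Rightarrow> ('a poly ^ 2 ^ 2) set set" where
  "nongeneric n \<equiv> {h \<in> deg_sphere n. \<exists>g \<in> deg_sphere 0. g \<noteq> \<one>\<^bsub>PGL2\<^esub> \<and>
      inv\<^bsub>PGL2\<^esub> h \<otimes>\<^bsub>PGL2\<^esub> g \<otimes>\<^bsub>PGL2\<^esub> h \<in> deg_sphere 0}"

lemma generic_intersection:
  assumes "k \<in> carrier G" "k \<notin> nongeneric (pdeg k)" "x \<in> \<Gamma>\<^sub>0" "conj_act G (inv\<^bsub>G\<^esub> k) x \<in> \<Gamma>\<^sub>0"
  shows "x = \<one>\<^bsub>G\<^esub>"
proof (rule ccontr)
  assume "x \<noteq> \<one>\<^bsub>G\<^esub>"
  moreover have "inv\<^bsub>G\<^esub> k \<cdot> x \<cdot> k \<in> \<Gamma>\<^sub>0" using assms by (simp add: conj_act_def)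
  moreover have "k \<in> deg_sphere (pdeg k)" using assms by (simp add: deg_sphere_def)
  ultimately show False using assms(2,3) by blast
qed

text \<open>
  Two factorisations \<open>y k z = y' k z'\<close> give the element \<open>y'\<^sup>-\<^sup>1 y\<close> of \<open>\<Gamma>\<^sub>0 \<inter> k \<Gamma>\<^sub>0 k\<^sup>-\<^sup>1\<close>, which is trivial.
\<close>

lemma card_fibre_generic:
  assumes k: "k \<in> shell K" and nb: "k \<notin> nongeneric (pdeg k)"
  shows "card (fibre K k) = card Z ^ 2"
proof -
  have kc: "k \<in> carrier G" using k by (simp add: shell_def)
  have "inj_on (\<lambda>(y, z). y \<cdot> k \<cdot> z) (Z \<times> Z)"
  proof (rule inj_onI, clarify)
    fix y z y' z'
    assume m: "y \<in> Z" "z \<in> Z" "y' \<in> Z" "z' \<in> Z" and eq: "y \<cdot> k \<cdot> z = y' \<cdot> k \<cdot> z'"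
    have c: "y \<in> carrier G" "z \<in> carrier G" "y' \<in> carrier G" "z' \<in> carrier G"
      using m Z_const const_carrier by blast+
    let ?x = "inv\<^bsub>G\<^esub> y' \<cdot> y"
    have x0: "?x \<in> Z" "z' \<cdot> inv\<^bsub>G\<^esub> z \<in> Z"
      using m subgroup.m_closed[OF subgroup_Z] subgroup.m_inv_closed[OF subgroup_Z] by simp_all
    have "conj_act G (inv\<^bsub>G\<^esub> k) ?x = inv\<^bsub>G\<^esub> k \<cdot> (inv\<^bsub>G\<^esub> y' \<cdot> ((y \<cdot> k \<cdot> z) \<cdot> inv\<^bsub>G\<^esub> z))"
      using c kc by (simp add: conj_act_def PGL.m_assoc)
    also have "\<dots> = z' \<cdot> inv\<^bsub>G\<^esub> z" unfolding eq using c kc by (simp add: PGL.m_assoc PGL.cancel_inv)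
    finally have "conj_act G (inv\<^bsub>G\<^esub> k) ?x \<in> \<Gamma>\<^sub>0" using x0 Z_const by auto
    then have "?x = \<one>\<^bsub>G\<^esub>" using generic_intersection[OF kc nb] x0 Z_const by blast
    then have y: "y = y'" using c PGL.cancel_inv(1)[of y' y] by simp
    have "y' \<cdot> (k \<cdot> z) = y' \<cdot> (k \<cdot> z')" using eq c kc unfolding y by (simp add: PGL.m_assoc)
    then have "inv\<^bsub>G\<^esub> k \<cdot> (inv\<^bsub>G\<^esub> y' \<cdot> (y' \<cdot> (k \<cdot> z))) =
        inv\<^bsub>G\<^esub> k \<cdot> (inv\<^bsub>G\<^esub> y' \<cdot> (y' \<cdot> (k \<cdot> z')))" by simp
    then have "z = z'" using c kc by (simp add: PGL.cancel_inv)
    with y show "y = y' \<and> z = z'" by blast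
  qed
  then show ?thesis
    unfolding fibre_eq[OF k] by (simp add: card_image card_cartesian_product power2_eq_square)
qed

lemma finite_fibre: "finite (fibre K k)"
  unfolding fibre_def using finite_shell[of K] by simp

lemma card_fibre_pos: "k \<in> shell K \<Longrightarrow> 0 < card (fibre K k)"
  using finite_fibre[of K k] by (auto simp: card_gt_0_iff fibre_def)

lemma one_const: "\<one>\<^bsub>G\<^esub> \<in> \<Gamma>\<^sub>0" by (rule subgroup.one_closed[OF subgroup_const])

lemma card_const_pos: "0 < card \<Gamma>\<^sub>0"
  using finite_deg_sphere[of 0, where 'a = 'a] one_const by (auto simp: card_gt_0_iff)

lemma orbit_weight_bounds:
  assumes k: "k \<in> carrier G" shows "0 \<le> orbit_weight k" "orbit_weight k \<le> 1"
proof -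
  let ?S = "{x \<in> \<Gamma>\<^sub>0. conj_act G (inv\<^bsub>G\<^esub> k) x \<in> \<Gamma>\<^sub>0}"
  have "\<one>\<^bsub>G\<^esub> \<in> ?S" using one_const k by simp
  moreover have "finite ?S" by (simp add: finite_deg_sphere)
  ultimately have "0 < card ?S" unfolding card_gt_0_iff by blast
  then have S: "1 \<le> card ?S" by simp
  have "real (card Z) / real (card \<Gamma>\<^sub>0) \<le> 1"
    using card_mono[OF finite_deg_sphere Z_const] card_const_pos by simp
  then have "(real (card Z) / real (card \<Gamma>\<^sub>0)) ^ 2 \<le> 1" by (simp add: power_le_one)
  also have "1 \<le> real (card ?S)" using S by simp
  finally show "orbit_weight k \<le> 1" unfolding orbit_weight_def using S by (subst divide_le_eq_1_pos) auto
qed (simp add: orbit_weight_def)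

lemma orbit_weight_generic:
  assumes k: "k \<in> carrier G" and nb: "k \<notin> nongeneric (pdeg k)"
  shows "orbit_weight k = (real (card Z) / real (card \<Gamma>\<^sub>0)) ^ 2"
proof -
  have "{x \<in> \<Gamma>\<^sub>0. conj_act G (inv\<^bsub>G\<^esub> k) x \<in> \<Gamma>\<^sub>0} = {\<one>\<^bsub>G\<^esub>}"
  proof (rule subset_antisym; rule subsetI)
    fix x assume "x \<in> {x \<in> \<Gamma>\<^sub>0. conj_act G (inv\<^bsub>G\<^esub> k) x \<in> \<Gamma>\<^sub>0}"
    then have "x = \<one>\<^bsub>G\<^esub>" by (intro generic_intersection[OF k nb]) simp_all
    then show "x \<in> {\<one>\<^bsub>G\<^esub>}" by simp
  next
    fix x assume "x \<in> {\<one>\<^bsub>G\<^esub>}"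
    then show "x \<in> {x \<in> \<Gamma>\<^sub>0. conj_act G (inv\<^bsub>G\<^esub> k) x \<in> \<Gamma>\<^sub>0}" using one_const k by simp
  qed
  then show ?thesis by (simp add: orbit_weight_def)
qed

lemma reversible_count_shell:
  "reversible_count I (4 * real K) = (\<Sum>k\<in>shell K. orbit_weight k / real (card (fibre K k)))"
proof -
  let ?F = "\<lambda>k. orbit_weight k / real (card (fibre K k))"
  have "(\<Sum>k\<in>shell K. ?F k) = (\<Sum>P\<in>pair_orbit ` shell K. \<Sum>k\<in>{k \<in> shell K. pair_orbit k = P}. ?F k)"
    by (rule sum.image_gen[OF finite_shell])
  also have "\<dots> = (\<Sum>P\<in>pair_orbit ` shell K. the_elem (pair_weight ` P))"
  proof (rule sum.cong[OF refl])
    fix P assume "P \<in> pair_orbit ` shell K"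
    then obtain k where k: "k \<in> shell K" "P = pair_orbit k" by blast
    have w: "orbit_weight l = orbit_weight k \<and> fibre K l = fibre K k" if "l \<in> fibre K k" for l
    proof -
      have l: "l \<in> carrier G" "pair_orbit l = pair_orbit k" using that by (auto simp: fibre_def shell_def)
      have "orbit_weight l = orbit_weight k" using weight_pair_orbit[OF l(1)] weight_pair_orbit[of k] k l by (simp add: shell_def)
      then show ?thesis using l by (simp add: fibre_def)
    qed
    have "(\<Sum>l\<in>{l \<in> shell K. pair_orbit l = P}. ?F l) = (\<Sum>l\<in>fibre K k. ?F k)"
      unfolding k(2) fibre_def[symmetric] using w by (intro sum.cong) auto
    also have "\<dots> = orbit_weight k" using card_fibre_pos[OF k(1)] by simp
    also have "\<dots> = the_elem (pair_weight ` P)" using k by (simp add: weight_pair_orbit shell_def)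
    finally show "(\<Sum>l\<in>{l \<in> shell K. pair_orbit l = P}. ?F l) = the_elem (pair_weight ` P)" .
  qed
  finally show ?thesis unfolding reversible_count_orbits by simp
qed

text \<open>
  A generic \<open>k\<close> contributes \<open>(card Z / card \<Gamma>\<^sub>0)\<^sup>2 / (card Z)\<^sup>2 = 1 / (card \<Gamma>\<^sub>0)\<^sup>2\<close>.  Every other
  contribution lies between \<open>0\<close> and \<open>1\<close>, and \<open>card_nongeneric_le\<close> bounds their number.
\<close>

lemma reversible_count_estimate:
  "\<exists>C \<ge> 0. \<forall>K. \<bar>reversible_count I (4 * real K) - real (card (shell K)) / real (card \<Gamma>\<^sub>0) ^ 2\<bar>
     \<le> C * (\<Sum>n<K. real CARD('a) ^ Suc n)"
proof -
  obtain C where C: "\<And>n. card (nongeneric n) \<le> C * CARD('a) ^ n" using card_nongeneric_le[where 'a = 'a] by blast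
  let ?g = "1 / real (card \<Gamma>\<^sub>0) ^ 2"
  have "\<bar>reversible_count I (4 * real K) - real (card (shell K)) / real (card \<Gamma>\<^sub>0) ^ 2\<bar>
     \<le> real C * (\<Sum>n<K. real CARD('a) ^ Suc n)" for K
  proof -
    let ?F = "\<lambda>k. orbit_weight k / real (card (fibre K k))"
    define B where "B = (\<Union>n<K. nongeneric (Suc n))"
    have fin: "finite B" by (simp add: B_def finite_deg_sphere)
    have g: "0 \<le> ?g" "?g \<le> 1" using card_const_pos by (simp_all add: Suc_le_eq one_le_power)
    have summand: "\<bar>?F k - ?g\<bar> \<le> (if k \<in> B then 1 else 0)" if k: "k \<in> shell K" for k
    proof (cases "k \<in> nongeneric (pdeg k)")
      case True
      have kc: "k \<in> carrier G" using k by (simp add: shell_def)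
      obtain n where "n < K" "pdeg k = Suc n" using k by (cases "pdeg k") (auto simp: shell_def)
      then have "k \<in> B" using True by (auto simp: B_def)
      moreover have "0 \<le> ?F k" "?F k \<le> 1"
        using orbit_weight_bounds[OF kc] card_fibre_pos[OF k] by (simp_all add: divide_le_eq_1)
      ultimately have "\<bar>?F k - ?g\<bar> \<le> 1" using g by linarith
      then show ?thesis unfolding if_P[OF \<open>k \<in> B\<close>] .
    next
      case False
      have kc: "k \<in> carrier G" using k by (simp add: shell_def)
      have "?F k = ?g" unfolding orbit_weight_generic[OF kc False] card_fibre_generic[OF k False]
        using card_Z_pos by (simp add: power_divide)
      then show ?thesis by simp
    qed
    have "reversible_count I (4 * real K) - real (card (shell K)) / real (card \<Gamma>\<^sub>0) ^ 2 = (\<Sum>k\<in>shell K. ?F k - ?g)"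
      unfolding reversible_count_shell by (simp add: sum_subtractf)
    also have "\<bar>\<dots>\<bar> \<le> (\<Sum>k\<in>shell K. \<bar>?F k - ?g\<bar>)" by (rule sum_abs)
    also have "\<dots> \<le> (\<Sum>k\<in>shell K. if k \<in> B then 1 else 0)" by (intro sum_mono summand)
    also have "\<dots> = real (card (shell K \<inter> B))" by (simp add: sum.If_cases finite_shell)
    also have "card (shell K \<inter> B) \<le> card B" using fin by (intro card_mono) auto
    also have "card B \<le> (\<Sum>n<K. card (nongeneric (Suc n)))" unfolding B_def by (rule card_UN_le) simp
    also have "\<dots> \<le> (\<Sum>n<K. C * CARD('a) ^ Suc n)" by (intro sum_mono C)
    finally show ?thesis by (simp add: sum_distrib_left)
  qed
  then show ?thesis by (intro exI[of _ "real C"]) simp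
qed

lemma card_shell:
  assumes q: "2 \<le> CARD('a)"
  shows "real (card (shell K)) / real (card \<Gamma>\<^sub>0) ^ 2 =
    (real CARD('a) ^ (2 * K) - 1) / (real CARD('a) * (real CARD('a) ^ 2 - 1))"
proof -
  let ?q = "real CARD('a)"
  have g0: "real (card \<Gamma>\<^sub>0) = ?q * (?q ^ 2 - 1)"
    using q unfolding card_deg_sphere_0[OF q] by (simp add: of_nat_diff power2_eq_square algebra_simps)
  have nz: "real (card \<Gamma>\<^sub>0) \<noteq> 0" using card_const_pos by simp
  have "card (shell K) = (\<Sum>n<K. card (deg_sphere (Suc n) :: ('a poly ^ 2 ^ 2) set set))"
    unfolding shell_eq by (rule card_UN_disjoint) (simp, simp add: finite_deg_sphere, auto simp: deg_sphere_def)
  then have "real (card (shell K)) = (\<Sum>n<K. (?q ^ 2 - 1) * ?q ^ (2 * n) * real (card \<Gamma>\<^sub>0))"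
    by (simp add: card_deg_sphere_Suc[OF q])
  also have "\<dots> = (\<Sum>n<K. ?q ^ (2 * Suc n) - ?q ^ (2 * n)) * real (card \<Gamma>\<^sub>0)"
    unfolding sum_distrib_right by (intro sum.cong) (simp_all add: algebra_simps power2_eq_square)
  also have "(\<Sum>n<K. ?q ^ (2 * Suc n) - ?q ^ (2 * n)) = ?q ^ (2 * K) - 1"
    using sum_lessThan_telescope[of "\<lambda>n. ?q ^ (2 * n)" K] by simp
  finally show ?thesis using nz unfolding g0[symmetric] by (simp add: power2_eq_square)
qed

text \<open>
  The main term grows like \<open>q\<^sup>2\<^sup>K\<close>, the error like \<open>q\<^sup>K\<close>.
\<close>

lemma reversible_count_ratio:
  assumes q: "2 \<le> CARD('a)"
  shows "(\<lambda>K. reversible_count I (4 * real K) /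
      (real CARD('a) ^ (2 * K) / (real CARD('a) * (real CARD('a) ^ 2 - 1)))) \<longlonglongrightarrow> 1"
proof -
  let ?q = "real CARD('a)" and ?N = "\<lambda>K. reversible_count I (4 * real K)"
  define d where "d = ?q * (?q ^ 2 - 1)"
  have q2: "2 \<le> ?q" using q by simp
  then have "2 * 2 \<le> ?q * ?q" by (intro mult_mono) auto
  then have d: "0 < d" using q2 by (simp add: d_def power2_eq_square)
  obtain C where C: "0 \<le> C"
    "\<And>K. \<bar>?N K - real (card (shell K)) / real (card \<Gamma>\<^sub>0) ^ 2\<bar> \<le> C * (\<Sum>n<K. ?q ^ Suc n)"
    using reversible_count_estimate by blast
  have geo: "(\<Sum>n<K. ?q ^ Suc n) \<le> ?q * ?q ^ K" for K
  proof (induction K)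
    case (Suc K)
    have "2 * ?q ^ Suc K \<le> ?q * ?q ^ Suc K" by (rule mult_right_mono[OF q2]) simp
    moreover have "?q ^ Suc K = ?q * ?q ^ K" by simp
    ultimately show ?case using Suc unfolding sum.lessThan_Suc by linarith
  qed (use q2 in simp)
  define B where "B = d * (1 / d + C * ?q)"
  have bound: "\<bar>?N K / (?q ^ (2 * K) / d) - 1\<bar> \<le> B * (1 / ?q) ^ K" for K
  proof -
    have pK: "1 \<le> ?q ^ K" using q2 by (simp add: one_le_power)
    have "?N K - ?q ^ (2 * K) / d = (?N K - (?q ^ (2 * K) - 1) / d) - 1 / d" by (simp add: diff_divide_distrib)
    also have "\<bar>\<dots>\<bar> \<le> C * (\<Sum>n<K. ?q ^ Suc n) + 1 / d"
    proof -
      have "\<bar>?N K - (?q ^ (2 * K) - 1) / d\<bar> \<le> C * (\<Sum>n<K. ?q ^ Suc n)"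
        using C(2)[of K] unfolding card_shell[OF q] d_def[symmetric] .
      moreover have "0 < 1 / d" using d by simp
      ultimately show ?thesis by linarith
    qed
    also have "\<dots> \<le> C * (?q * ?q ^ K) + (1 / d) * ?q ^ K"
      using C(1) d pK by (intro add_mono mult_left_mono geo) (simp_all add: divide_right_mono)
    also have "\<dots> = (B / d) * ?q ^ K" using d by (simp add: B_def field_simps)
    finally have 1: "\<bar>?N K - ?q ^ (2 * K) / d\<bar> \<le> (B / d) * ?q ^ K" .
    have "?N K / (?q ^ (2 * K) / d) - 1 = (?N K - ?q ^ (2 * K) / d) * (d / ?q ^ (2 * K))"
      using d q2 by (simp add: field_simps)
    then have "\<bar>?N K / (?q ^ (2 * K) / d) - 1\<bar> = \<bar>?N K - ?q ^ (2 * K) / d\<bar> * (d / ?q ^ (2 * K))"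
      using d q2 by (simp add: abs_mult)
    also have "\<dots> \<le> ((B / d) * ?q ^ K) * (d / ?q ^ (2 * K))"
      using 1 d q2 by (intro mult_right_mono) auto
    also have "\<dots> = B * (1 / ?q) ^ K"
      using d q2 by (simp add: power_divide mult_2 power_add)
    finally show ?thesis .
  qed
  have "(\<lambda>K. (1 / ?q) ^ K) \<longlonglongrightarrow> 0" using q2 by (intro LIMSEQ_realpow_zero) auto
  then have "(\<lambda>K. B * (1 / ?q) ^ K) \<longlonglongrightarrow> 0" by (rule tendsto_mult_right_zero)
  then have "(\<lambda>K. ?N K / (?q ^ (2 * K) / d) - 1) \<longlonglongrightarrow> 0"
    by (rule Lim_null_comparison[rotated]) (intro always_eventually allI, simp only: real_norm_def bound)
  then show ?thesis unfolding d_def by (simp add: LIM_zero_iff)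
qed

end

section \<open>The asymptotic count\<close>

text \<open>
  If \<open>i\<^sup>2 = -1\<close>, then \<open>1 = i\<^sup>q\<^sup>-\<^sup>1 = (-1)\<^sup>(\<^sup>q\<^sup>-\<^sup>1\<^sup>)\<^sup>/\<^sup>2 = -1\<close>, the exponent \<open>(q - 1) / 2\<close> being odd.  So the
  characteristic is \<open>2\<close>, but \<open>q\<close> is odd and vanishes in the field.
\<close>

lemma minus_one_not_square:
  fixes i :: "'a::{finite, field}"
  assumes q: "CARD('a) mod 4 = 3" shows "i * i \<noteq> - 1"
proof
  assume i: "i * i = - 1"
  then have i0: "i \<noteq> 0" by auto
  obtain m where m: "CARD('a) = 4 * m + 3" using q by (metis mult_div_mod_eq)
  have "(\<Prod>y\<in>UNIV - {0}. i * y) = (\<Prod>y\<in>UNIV - {0}. y)"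
    by (rule prod.reindex_bij_witness[of _ "\<lambda>y. y / i" "\<lambda>y. i * y"]) (use i0 in auto)
  then have "i ^ (CARD('a) - 1) * (\<Prod>y\<in>UNIV - {0 :: 'a}. y) = (\<Prod>y\<in>UNIV - {0 :: 'a}. y)"
    by (simp add: prod.distrib card_Diff_singleton)
  then have "i ^ (CARD('a) - 1) = 1" by simp
  moreover have "i ^ (CARD('a) - 1) = (i * i) ^ (2 * m + 1)"
    unfolding m power2_eq_square[symmetric] power_mult[symmetric] by simp
  ultimately have "(- 1 :: 'a) ^ (2 * m + 1) = 1" using i by simp
  then have two: "(1 :: 'a) + 1 = 0" by (simp add: eq_neg_iff_add_eq_0[symmetric])
  \<comment> \<open>Translation by \<open>1\<close> permutes the field, so the sum of all elements shows that \<open>q\<close> is zero in it.\<close>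
  have "(\<Sum>y\<in>(UNIV :: 'a set). y + 1) = (\<Sum>y\<in>(UNIV :: 'a set). y)"
    by (rule sum.reindex_bij_witness[of _ "\<lambda>y. y - 1" "\<lambda>y. y + 1"]) auto
  then have "(of_nat CARD('a) :: 'a) = 0" by (simp add: sum.distrib)
  then have "(1 + 1) * of_nat (2 * m + 1) + (1 :: 'a) = 0" unfolding m by (simp add: algebra_simps)
  then show False unfolding two by simp
qed

theorem corollary1p3:
  fixes q :: nat and I :: "('a::{finite, field} poly ^ 2 ^ 2) set set"
  assumes "CARD('a) = q" and "q mod 4 = 3"
    and "I = conj_class PGL2 (pgl2_of 0 1 (-1) 0)"
  shows "(\<lambda>n::int. reversible_count I (real_of_int n))
           \<sim>[inf at_top (principal {n. 4 dvd n})]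
         (\<lambda>n. real q powr (real_of_int n / 2 - 1) / (real q ^ 2 - 1))"
proof -
  interpret finite_anisotropic "TYPE('a)"
  proof
    fix x y :: 'a assume *: "x * x + y * y = 0"
    show "x = 0"
    proof (rule ccontr)
      assume "x \<noteq> 0"
      then have "(y / x) * (y / x) = - 1" using * by (simp add: field_simps eq_neg_iff_add_eq_0)
      then show False using minus_one_not_square[of "y / x"] assms by simp
    qed
  qed
  have q: "2 \<le> CARD('a)" using assms by (cases "q < 2") auto
  have I: "I = conj_class PGL2 alpha" using assms by (simp add: alpha_eq)
  let ?f = "\<lambda>n::int. reversible_count I (real_of_int n)"
  let ?g = "\<lambda>n::int. real q powr (real_of_int n / 2 - 1) / (real q ^ 2 - 1)"
  let ?F = "inf at_top (principal {n :: int. 4 dvd n})"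
  let ?r = "\<lambda>K. reversible_count I (4 * real K) / (real q ^ (2 * K) / (real q * (real q ^ 2 - 1)))"
  have r: "?r \<longlonglongrightarrow> 1" using reversible_count_ratio[OF q] unfolding I assms(1) .
  have "filterlim (\<lambda>n :: int. nat (n div 4)) sequentially at_top"
    unfolding filterlim_at_top
  proof
    fix Z :: nat
    show "\<forall>\<^sub>F n :: int in at_top. Z \<le> nat (n div 4)"
      using eventually_ge_at_top[of "4 * int Z"] by eventually_elim linarith
  qed
  then have "filterlim (\<lambda>n :: int. nat (n div 4)) sequentially ?F"
    by (rule filterlim_mono) simp_all
  with r have lim: "((\<lambda>n. ?r (nat (n div 4))) \<longlongrightarrow> 1) ?F" by (rule filterlim_compose)
  have "\<forall>\<^sub>F n in ?F. ?r (nat (n div 4)) = ?f n / ?g n"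
    unfolding eventually_inf_principal
    using eventually_ge_at_top[of 0]
  proof eventually_elim
    fix n :: int assume n: "0 \<le> n"
    show "n \<in> {n. 4 dvd n} \<longrightarrow> ?r (nat (n div 4)) = ?f n / ?g n"
    proof
      assume "n \<in> {n. 4 dvd n}"
      then obtain k where k: "n = 4 * k" by (auto elim: dvdE)
      define K where "K = nat k"
      have K: "n = 4 * int K" using k n by (simp add: K_def)
      have q0: "0 < real q" using q assms by simp
      have "real q powr (real_of_int n / 2 - 1) = real q powr (real (2 * K)) / real q powr 1"
        by (simp add: K powr_diff)
      also have "\<dots> = real q ^ (2 * K) / real q" using q0 powr_realpow[OF q0, of "2 * K"] by simp
      finally have "?g n = real q ^ (2 * K) / (real q * (real q ^ 2 - 1))" by simp
      moreover have "nat (n div 4) = K" "real_of_int n = 4 * real K" by (simp_all add: K)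
      ultimately show "?r (nat (n div 4)) = ?f n / ?g n" by simp
    qed
  qed
  with lim have "((\<lambda>n. ?f n / ?g n) \<longlongrightarrow> 1) ?F" by (rule Lim_transform_eventually)
  then show ?thesis by (rule asymp_equivI')
qed

end
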